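(* Let $d\ge1$, $e\in\mathbb{S}^d$, $1\le p<\infty$ and $\alpha\in(0,\frac12]$. Let $W$ be a doubling weight on $B(e,\alpha)$, and let $n$ be a positive integer. Then for any $f\in\Pi_n^d$, $$\int_{B(e,\alpha)}|f(x)|^pW(x)\,d\sigma(x)\sim\int_{B(e,\alpha)}|f(x)|^pW_n(x)\,d\sigma(x),$$ where the constant of equivalence depends only on $d$, $p$ and the doubling constant of $W$. Moreover, there exists a constant $\delta_0>0$, depending only on $d$, $p$ and the doubling constant of $W$, such that for any maximal $(\frac\delta n,\rho)$-separable subset $\Lambda$ of $B(e,\alpha)$ with $\delta\in(0,\delta_0)$ and any $f\in\Pi_n^d$, $$\int_{B(e,\alpha)}|f(x)|^pW(x)\,d\sigma(x)\sim\sum_{\omega\in\Lambda}\Bigl(\max_{x\in B_\rho(\omega,\delta/n)}|f(x)|^p\Bigr)\int_{B_\rho(\omega,\delta/n)}W(y)\,d\sigma(y)$$ $$\sim\sum_{\omega\in\Lambda}\Bigl(\min_{x\in B_\rho(\omega,\delta/n)}|f(x)|^p\Bigr)\int_{B_\rho(\omega,\delta/n)}W(y)\,d\sigma(y),$$ where the constants of equivalence depend only on $d$, $p$ and the doubling constant of $W$.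
   Context: $\mathbb{S}^d$ is the unit sphere of $\mathbb{R}^{d+1}$ with the usual rotation invariant (Lebesgue surface) measure $d\sigma$; $|E|$ denotes the $\sigma$-measure of $E\subset\mathbb{S}^d$. $d(x,y)=\arccos (x\cdot y)$ is the geodesic distance, and $B(e,\alpha)=\{x\in\mathbb{S}^d: d(x,e)\le\alpha\}$. $\Pi_n^d$ is the space of restrictions to $\mathbb{S}^d$ of polynomials in $d+1$ variables of total degree at most $n$. For $x,y\in B(e,\alpha)$ put $b_x=\alpha-d(x,e)$ and $$\rho(x,y)=\frac1\alpha\sqrt{(d(x,y))^2+\alpha\bigl(b_x^{1/2}-b_y^{1/2}\bigr)^2},$$ which is a metric on $B(e,\alpha)$; $B_\rho(x,r)=\{y\in B(e,\alpha):\rho(x,y)\le r\}$. A finite subset $A\subset B(e,\alpha)$ is $(s,\rho)$-separable if $\rho(\xi,\xi')\ge s$ for all distinct $\xi,\xi'\in A$; it is maximal $(s,\rho)$-separable if in addition $B(e,\alpha)=\bigcup_{\xi\in A}B_\rho(\xi,s)$. A weight function (nonnegative integrable function) $W$ on $B(e,\alpha)$ is a doubling weight if there is a constant $L>0$ (the doubling constant) such that for every $x\in B(e,\alpha)$ and $r\in(0,1)$, $\int_{B_\rho(x,2r)}W\,d\sigma\le L\int_{B_\rho(x,r)}W\,d\sigma$. Moreover $$W_n(x)=\frac{1}{|B_\rho(x,\frac1n)|}\int_{B_\rho(x,1/n)}W(y)\,d\sigma(y),\qquad x\in B(e,\alpha).$$ $A\sim B$ means $C^{-1}B\le A\le CB$,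 $C$ being the constant of equivalence. *)

theory Defs
  imports "HOL-Analysis.Analysis"
begin

text \<open>
  The sphere \<open>S^d\<close> is \<^term>\<open>sphere (0 :: real ^ 'n) 1\<close> with \<open>CARD('n) = d + 1\<close>.  Its surface
  measure is obtained from Lebesgue measure by polar coordinates: a Borel set \<open>E\<close> has measure
  \<open>d + 1\<close> times the volume of the cone \<open>{t u | 0 < t \<le> 1, u \<in> E}\<close>; recall
  \<open>sgn x = x /\<^sub>R norm x\<close>.  The completion makes all Lebesgue measurable functions
  on the sphere available, not only the Borel ones.
\<close>

definition surface_measure :: "(real ^ 'n) measure" where
  "surface_measure =
     completion (scale_measure (of_nat CARD('n))
       (distr (restrict_space lborel (cball 0 1 - {0})) (restrict_space borel (sphere 0 1)) sgn))"

lemma sgn_measurable_sphere: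
  "sgn \<in> restrict_space lborel (cball (0 :: real ^ 'n) 1 - {0})
     \<rightarrow>\<^sub>M restrict_space borel (sphere 0 1)"
proof (rule measurable_restrict_space2)
  show "sgn \<in> space (restrict_space lborel (cball (0 :: real ^ 'n) 1 - {0})) \<rightarrow> sphere 0 1"
    by (auto simp: norm_sgn)
  have "(\<lambda>x :: real ^ 'n. x /\<^sub>R norm x) \<in> borel_measurable borel"
    by measurable
  then show "sgn \<in> borel_measurable (restrict_space lborel (cball (0 :: real ^ 'n) 1 - {0}))"
    by (simp add: sgn_div_norm [abs_def] measurable_restrict_space1)
qed

lemma emeasure_surface_measure:
  fixes E :: "(real ^ 'n) set"
  assumes "E \<in> sets borel" "E \<subseteq> sphere 0 1"
  shows "emeasure surface_measure E =
    of_nat CARD('n) * emeasure lborel {x \<in> cball 0 1 - {0}. sgn x \<in> E}"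
proof -
  have E: "E \<in> sets (restrict_space borel (sphere 0 1))"
    using assms by (auto simp: sets_restrict_space)
  have eq: "sgn -` E \<inter> space (restrict_space lborel (cball 0 1 - {0})) =
      {x \<in> cball 0 1 - {0}. sgn x \<in> E}"
    by (auto simp: space_restrict_space)
  have "emeasure (restrict_space lborel (cball 0 1 - {0})) {x \<in> cball 0 1 - {0}. sgn x \<in> E} =
      emeasure lborel {x \<in> cball 0 1 - {0}. sgn x \<in> E}"
    by (rule emeasure_restrict_space) auto
  then show ?thesis
    unfolding surface_measure_def using E
    by (simp add: emeasure_distr[OF sgn_measurable_sphere E] eq del: space_restrict_space2)
qed

definition geodesic_dist :: "real ^ 'n \<Rightarrow> real ^ 'n \<Rightarrow> real" where
  "geodesic_dist x y = arccos (x \<bullet> y)"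

definition cap :: "real ^ 'n \<Rightarrow> real \<Rightarrow> (real ^ 'n) set" where
  "cap e \<alpha> = {x \<in> sphere 0 1. geodesic_dist x e \<le> \<alpha>}"

text \<open>Functions on the sphere are total functions whose values off the sphere are irrelevant;
  likewise for weights on a cap.\<close>

definition sphere_polys :: "nat \<Rightarrow> (real ^ 'n \<Rightarrow> real) set" where
  "sphere_polys n = {f. \<exists>c :: ('n \<Rightarrow> nat) \<Rightarrow> real. \<forall>x\<in>sphere 0 1.
     f x = (\<Sum>k | (\<Sum>i\<in>UNIV. k i) \<le> n. c k * (\<Prod>i\<in>UNIV. (x $ i) ^ k i))}"

lemma finite_bounded_multi_indices: "finite {k :: 'n :: finite \<Rightarrow> nat. (\<Sum>i\<in>UNIV. k i) \<le> n}"
proof (rule finite_subset)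
  show "{k :: 'n \<Rightarrow> nat. (\<Sum>i\<in>UNIV. k i) \<le> n} \<subseteq> PiE UNIV (\<lambda>_. {..n})"
  proof (clarsimp simp: PiE_UNIV_domain)
    fix k :: "'n \<Rightarrow> nat" and i :: 'n
    assume "sum k UNIV \<le> n"
    then show "k i \<le> n"
      using member_le_sum[of i UNIV k] by simp
  qed
  show "finite (PiE (UNIV :: 'n set) (\<lambda>_. {..n}))"
    by (rule finite_PiE) auto
qed

definition rho :: "real ^ 'n \<Rightarrow> real \<Rightarrow> real ^ 'n \<Rightarrow> real ^ 'n \<Rightarrow> real" where
  "rho e \<alpha> x y = 1 / \<alpha> *
     sqrt ((geodesic_dist x y)\<^sup>2 +
           \<alpha> * (sqrt (\<alpha> - geodesic_dist x e) - sqrt (\<alpha> - geodesic_dist y e))\<^sup>2)"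

definition rho_ball :: "real ^ 'n \<Rightarrow> real \<Rightarrow> real ^ 'n \<Rightarrow> real \<Rightarrow> (real ^ 'n) set" where
  "rho_ball e \<alpha> x r = {y \<in> cap e \<alpha>. rho e \<alpha> x y \<le> r}"

definition separable :: "real ^ 'n \<Rightarrow> real \<Rightarrow> real \<Rightarrow> (real ^ 'n) set \<Rightarrow> bool" where
  "separable e \<alpha> s A \<longleftrightarrow>
     finite A \<and> A \<subseteq> cap e \<alpha> \<and> (\<forall>\<xi>\<in>A. \<forall>\<xi>'\<in>A. \<xi> \<noteq> \<xi>' \<longrightarrow> rho e \<alpha> \<xi> \<xi>' \<ge> s)"

definition maximal_separable :: "real ^ 'n \<Rightarrow> real \<Rightarrow> real \<Rightarrow> (real ^ 'n) set \<Rightarrow> bool" where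
  "maximal_separable e \<alpha> s A \<longleftrightarrow>
     separable e \<alpha> s A \<and> cap e \<alpha> = (\<Union>\<xi>\<in>A. rho_ball e \<alpha> \<xi> s)"

definition weight :: "real ^ 'n \<Rightarrow> real \<Rightarrow> (real ^ 'n \<Rightarrow> real) \<Rightarrow> bool" where
  "weight e \<alpha> W \<longleftrightarrow>
     (\<forall>x\<in>cap e \<alpha>. 0 \<le> W x) \<and> set_integrable surface_measure (cap e \<alpha>) W"

definition doubling_weight :: "real ^ 'n \<Rightarrow> real \<Rightarrow> real \<Rightarrow> (real ^ 'n \<Rightarrow> real) \<Rightarrow> bool" where
  "doubling_weight e \<alpha> L W \<longleftrightarrow>
     weight e \<alpha> W \<and> L > 0 \<and>
     (\<forall>x\<in>cap e \<alpha>. \<forall>r\<in>{0<..<1}.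
        (LINT y:rho_ball e \<alpha> x (2 * r)|surface_measure. W y)
          \<le> L * (LINT y:rho_ball e \<alpha> x r|surface_measure. W y))"

definition averaged_weight ::
    "real ^ 'n \<Rightarrow> real \<Rightarrow> (real ^ 'n \<Rightarrow> real) \<Rightarrow> nat \<Rightarrow> real ^ 'n \<Rightarrow> real" where
  "averaged_weight e \<alpha> W n x =
     1 / measure surface_measure (rho_ball e \<alpha> x (1 / real n)) *
     (LINT y:rho_ball e \<alpha> x (1 / real n)|surface_measure. W y)"

definition equiv_const :: "real \<Rightarrow> real \<Rightarrow> real \<Rightarrow> bool" where
  "equiv_const C A B \<longleftrightarrow> inverse C * B \<le> A \<and> A \<le> C * B"

end

theory Submission
  imports Defs "HOL-Complex_Analysis.Conformal_Mappings"
begin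

text \<open>
  For a polynomial \<open>f\<close> of degree \<open>n\<close> and a large \<open>N\<close>, let \<open>f* x\<close> be the supremum over \<open>z\<close> of
  \<open>|f z| / (1 + n \<rho> x z) ^ N\<close>. Bernstein's inequality in the metric \<open>\<rho>\<close>, applied to \<open>f Q\<close> where \<open>Q\<close>
  is a polynomial of degree \<open>n N\<close> with \<open>1 \<le> Q x\<close> that decays like \<open>(1 + n \<rho> x z) ^ - N\<close>, gives
  \<open>|f x - f y| \<le> C n \<rho> x y f* x\<close> for \<open>n \<rho> x y \<le> 1\<close>. Hence \<open>f*\<close> is controlled by the minima of \<open>|f|\<close>
  over the balls of a fine enough net at scale \<open>1 / n\<close>, and because \<open>W\<close> is doubling, the \<open>p\<close>-th
  power of \<open>f*\<close> has at most a constant times the \<open>W\<close>-integral of \<open>|f| ^ p\<close>. Since \<open>f*\<close> bounds both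
  the values and the oscillation of \<open>f\<close> on balls of radius \<open>\<delta> / n\<close>, all the equivalences follow. For
  \<open>W\<^sub>n\<close> one also needs that the surface measure is doubling with respect to \<open>\<rho>\<close>, which is seen by
  contracting the cone over a ball towards its centre.
\<close>

section \<open>Bernstein's inequality\<close>

text \<open>The weight is arbitrary up to doubling, so no weighted inequality for polynomials is
  available to start from: the only analytic input is a Bernstein inequality in one variable and in
  the supremum norm, with a constant that need not be sharp. It reaches the cap through a chart onto
  a ball, lifted to a hemisphere: great circles there correspond to closed curves in the cap along
  which polynomials are almost trigonometric. These curves never leave the cap, which makes the
  estimate uniform in \<alpha> and respects the square root behaviour of \<open>\<rho>\<close> at
  the boundary. Absorbing the oscillation requires the maximal function to be finite, which
  compactness of the cap provides. The exponent is fixed by \<open>2 * K \<le> 2 ^ N\<close>, with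
  \<open>K\<close> a doubling constant for all radii, so that the decay integrates to at most a
  constant times the mass of the ball of radius \<open>1 / n\<close>. Doubling is assumed for radii
  below 1 only and also allows a weight of total mass zero; the first costs a cube of the constant,
  the second is a separate trivial case.\<close>

definition trig_poly :: "nat \<Rightarrow> (real \<Rightarrow> complex) \<Rightarrow> bool" where
  "trig_poly m h \<longleftrightarrow>
     (\<exists>p. degree p \<le> 2 * m \<and> (\<forall>t. h t = cis (- (real m * t)) * poly p (cis t)))"

lemma trig_poly_mono:
  assumes "trig_poly m h" "m \<le> m'"
  shows "trig_poly m' h"
proof -
  obtain p where p: "degree p \<le> 2 * m" "\<And>t. h t = cis (- (real m * t)) * poly p (cis t)"
    using assms(1) unfolding trig_poly_def by blast
  show ?thesis unfolding trig_poly_def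
  proof (intro exI[of _ "monom 1 (m' - m) * p"] conjI allI)
    have "degree (monom (1::complex) (m' - m) * p) \<le> (m' - m) + degree p"
      by (metis degree_monom_eq degree_mult_le one_neq_zero)
    then show "degree (monom 1 (m' - m) * p) \<le> 2 * m'" using p assms(2) by linarith
  next
    fix t
    have "cis (- (real m' * t)) * cis (real (m' - m) * t) = cis (- (real m * t))"
      using assms(2) by (simp add: cis_mult of_nat_diff algebra_simps)
    then show "h t = cis (- (real m' * t)) * poly (monom 1 (m' - m) * p) (cis t)"
      by (simp add: p poly_monom Complex.DeMoivre flip: mult.assoc)
  qed
qed

lemma trig_poly_const: "trig_poly m (\<lambda>_. c)"
proof -
  have "trig_poly 0 (\<lambda>_. c)" unfolding trig_poly_def by (rule exI[of _ "[:c:]"]) auto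
  then show ?thesis by (rule trig_poly_mono) simp
qed

lemma trig_poly_add:
  assumes "trig_poly m f" "trig_poly m g"
  shows "trig_poly m (\<lambda>t. f t + g t)"
proof -
  obtain p q where "degree p \<le> 2 * m" "\<And>t. f t = cis (- (real m * t)) * poly p (cis t)"
    "degree q \<le> 2 * m" "\<And>t. g t = cis (- (real m * t)) * poly q (cis t)"
    using assms unfolding trig_poly_def by blast
  then show ?thesis unfolding trig_poly_def
    by (intro exI[of _ "p + q"]) (auto simp: degree_add_le algebra_simps)
qed

lemma trig_poly_mult:
  assumes "trig_poly m f" "trig_poly m' g"
  shows "trig_poly (m + m') (\<lambda>t. f t * g t)"
proof -
  obtain p q where pq: "degree p \<le> 2 * m" "\<And>t. f t = cis (- (real m * t)) * poly p (cis t)"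
    "degree q \<le> 2 * m'" "\<And>t. g t = cis (- (real m' * t)) * poly q (cis t)"
    using assms unfolding trig_poly_def by blast
  have "cis (- (real (m + m') * t)) = cis (- (real m * t)) * cis (- (real m' * t))" for t
    by (simp add: cis_mult algebra_simps)
  then show ?thesis unfolding trig_poly_def using pq
    by (intro exI[of _ "p * q"]) (auto simp: algebra_simps intro: order.trans[OF degree_mult_le])
qed

lemma trig_poly_cos: "trig_poly 1 (\<lambda>t. complex_of_real (cos t))"
proof -
  have "complex_of_real (cos t) = cis (- t) * poly [:1/2, 0, 1/2:] (cis t)" for t
  proof -
    have "cis (-t) * (1/2 + cis t * (cis t / 2)) = (cis (-t) + (cis (-t) * cis t) * cis t) / 2"
      by (simp add: field_simps)
    also have "\<dots> = complex_of_real (cos t)"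
      by (simp add: cis_mult complex_eq_iff)
    finally show ?thesis by simp
  qed
  then show ?thesis unfolding trig_poly_def by (intro exI[of _ "[:1/2, 0, 1/2:]"]) auto
qed

lemma trig_poly_sin: "trig_poly 1 (\<lambda>t. complex_of_real (sin t))"
proof -
  have "complex_of_real (sin t) = cis (- t) * poly [:\<i>/2, 0, -\<i>/2:] (cis t)" for t
  proof -
    have "cis (-t) * (\<i>/2 + cis t * (cis t * (-\<i>/2))) = \<i>/2 * (cis (-t) - (cis (-t) * cis t) * cis t)"
      by (simp add: field_simps)
    also have "\<dots> = complex_of_real (sin t)"
      by (simp add: cis_mult complex_eq_iff)
    finally show ?thesis by simp
  qed
  then show ?thesis unfolding trig_poly_def by (intro exI[of _ "[:\<i>/2, 0, -\<i>/2:]"]) auto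
qed

section \<open>Derivatives of polynomials on the unit circle\<close>

lemma poly_bound_unit_disc:
  fixes p :: "complex poly"
  assumes "\<And>z. norm z = 1 \<Longrightarrow> norm (poly p z) \<le> M" "norm z \<le> 1"
  shows "norm (poly p z) \<le> M"
proof (rule maximum_modulus_frontier[of "poly p" "cball 0 1"])
  show "poly p holomorphic_on interior (cball 0 1)"
    by (intro holomorphic_intros)
  show "continuous_on (closure (cball 0 1)) (poly p)"
    by (intro continuous_intros)
  show "z \<in> cball 0 1" using assms(2) by simp
  show "norm (poly p w) \<le> M" if "w \<in> frontier (cball 0 1)" for w
    using that by (intro assms(1)) simp
qed simp

text \<open>The reflected polynomial has the same bound on the unit circle, and the maximum
  principle applies to it at \<open>inverse z\<close>, which lies in the disc.\<close>

lemma poly_growth_outside_unit_disc: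
  fixes p :: "complex poly"
  assumes M: "\<And>z. norm z = 1 \<Longrightarrow> norm (poly p z) \<le> M" and d: "degree p \<le> D" and z: "1 \<le> norm z"
  shows "norm (poly p z) \<le> M * norm z ^ D"
proof -
  have M0: "0 \<le> M" using order.trans[OF norm_ge_zero M[of 1]] by simp
  have reflect: "norm (poly (reflect_poly p) w) \<le> M" if "norm w = 1" for w
  proof -
    have "w \<noteq> 0" using that by auto
    then have "norm (poly (reflect_poly p) w) = norm (poly p (inverse w))"
      using that by (simp add: poly_reflect_poly_nz norm_mult norm_power)
    also have "\<dots> \<le> M" using that by (intro M) (simp add: norm_inverse)
    finally show ?thesis .
  qed
  have "z \<noteq> 0" using z by auto
  then have "poly p z = z ^ degree p * poly (reflect_poly p) (inverse z)"
    using poly_reflect_poly_nz[of "inverse z" p] by (simp add: field_simps)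
  then have "norm (poly p z) = norm z ^ degree p * norm (poly (reflect_poly p) (inverse z))"
    by (simp add: norm_mult norm_power)
  also have "\<dots> \<le> norm z ^ degree p * M"
    using z by (intro mult_left_mono poly_bound_unit_disc[OF reflect])
      (auto simp: norm_divide divide_simps)
  also have "\<dots> \<le> norm z ^ D * M"
    using z d M0 by (intro mult_right_mono power_increasing) auto
  finally show ?thesis by (simp add: mult.commute)
qed

text \<open>Cauchy's estimate on the circle of radius \<open>1 / D\<close> about \<open>z\<close>:
  there the growth factor is at most \<open>(1 + 1 / D) ^ D\<close>, hence at most e and so at most
  3.\<close>

lemma poly_deriv_bound_unit_circle:
  fixes p :: "complex poly"
  assumes M: "\<And>z. norm z = 1 \<Longrightarrow> norm (poly p z) \<le> M" and d: "degree p \<le> D" "D \<ge> 1"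
    and z: "norm z = 1"
  shows "norm (poly (pderiv p) z) \<le> 3 * real D * M"
proof -
  have M0: "0 \<le> M" using order.trans[OF norm_ge_zero M[of 1]] by simp
  have "norm ((deriv ^^ 1) (poly p) z) \<le> fact 1 * (3 * M) / (1 / real D) ^ 1"
  proof (rule Cauchy_inequality)
    show "poly p holomorphic_on ball z (1 / real D)" by (intro holomorphic_intros)
    show "continuous_on (cball z (1 / real D)) (poly p)" by (intro continuous_intros)
    show "0 < 1 / real D" using d by simp
    fix w assume w: "norm (z - w) = 1 / real D"
    have nw: "norm w \<le> 1 + 1 / real D"
      using norm_triangle_ineq4[of z "z - w"] w z by simp
    show "norm (poly p w) \<le> 3 * M"
    proof (cases "norm w \<le> 1")
      case True
      then show ?thesis using poly_bound_unit_disc[OF M True] M0 by simp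
    next
      case False
      then have "norm (poly p w) \<le> M * norm w ^ D"
        using poly_growth_outside_unit_disc[OF M d(1)] by simp
      also have "M * norm w ^ D \<le> M * (1 + 1 / real D) ^ D"
        using nw M0 by (intro mult_left_mono power_mono) auto
      also have "\<dots> \<le> M * exp 1"
        using exp_ge_one_plus_x_over_n_power_n[of D 1] d M0 by (intro mult_left_mono) auto
      also have "\<dots> \<le> M * 3" using M0 exp_le by (intro mult_left_mono)
      finally show ?thesis by simp
    qed
  qed
  moreover have "deriv (poly p) z = poly (pderiv p) z" by (intro DERIV_imp_deriv poly_DERIV)
  ultimately show ?thesis by (simp add: field_simps)
qed

text \<open>Bernstein's inequality up to the constant: in 7 = 1 + 3 * 2 the 1 comes from
  differentiating the factor \<open>cis (- (m * t))\<close> and the rest from the polynomial of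
  degree \<open>2 * m\<close>.\<close>

lemma trig_poly_lipschitz:
  assumes h: "trig_poly m h" and M: "\<And>t. norm (h t) \<le> M"
  shows "norm (h s - h t) \<le> 7 * real m * M * \<bar>s - t\<bar>"
proof (cases "m = 0")
  case True
  then obtain p where p: "degree p = 0" "\<And>t. h t = poly p (cis t)"
    using h unfolding trig_poly_def by auto
  then obtain c where "p = [:c:]" by (auto elim: degree_eq_zeroE)
  then show ?thesis using p True by simp
next
  case False
  obtain p where p: "degree p \<le> 2 * m" "\<And>t. h t = cis (- (real m * t)) * poly p (cis t)"
    using h unfolding trig_poly_def by blast
  have Mp: "norm (poly p z) \<le> M" if z: "norm z = 1" for z
  proof -
    obtain t where t: "z = cis t"
      using z rcis_cmod_Arg[of z] by (metis mult_1 of_real_1 rcis_def)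
    have "norm (h t) = norm (cis (- (real m * t))) * norm (poly p (cis t))"
      unfolding p(2) by (rule norm_mult)
    then have "norm (h t) = norm (poly p z)" unfolding t norm_cis by simp
    then show ?thesis using M[of t] by simp
  qed
  let ?h' = "\<lambda>t. (- (real m) *\<^sub>R (\<i> * cis (- (real m * t)))) * poly p (cis t)
     + cis (- (real m * t)) * (poly (pderiv p) (cis t) * (\<i> * cis t))"
  have der: "(h has_vector_derivative ?h' t) (at t)" for t
  proof -
    have c1: "(cis has_vector_derivative (\<i> * cis t)) (at t)" for t
      unfolding has_vector_derivative_complex_iff
      by (auto intro!: derivative_eq_intros)
    have c2: "((\<lambda>t. cis (- (real m * t))) has_vector_derivative
        (- (real m) *\<^sub>R (\<i> * cis (- (real m * t))))) (at t)"
    proof -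
      have "((cis \<circ> (\<lambda>t. - (real m * t))) has_vector_derivative
          ((- real m) *\<^sub>R (\<i> * cis (- (real m * t))))) (at t)"
        by (rule vector_diff_chain_at[OF _ c1])
          (auto intro!: derivative_eq_intros simp flip: has_real_derivative_iff_has_vector_derivative)
      then show ?thesis by (simp add: o_def)
    qed
    have c3: "((\<lambda>t. poly p (cis t)) has_vector_derivative
        (poly (pderiv p) (cis t) * (\<i> * cis t))) (at t)"
      using field_vector_diff_chain_at[OF c1[of t] poly_DERIV[of p "cis t"]]
      by (simp add: o_def mult_ac)
    show ?thesis unfolding p(2)[abs_def]
      using has_vector_derivative_mult[OF c2 c3] by (simp add: add.commute)
  qed
  have bd: "norm (?h' t) \<le> 7 * real m * M" for t
  proof -
    have "norm (?h' t) \<le> real m * norm (poly p (cis t)) + norm (poly (pderiv p) (cis t))"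
      by (rule order.trans[OF norm_triangle_ineq]) (simp add: norm_mult)
    also have "\<dots> \<le> real m * M + 3 * real (2 * m) * M"
      using poly_deriv_bound_unit_circle[OF Mp p(1), of "cis t"] Mp[of "cis t"] False
      by (intro add_mono mult_left_mono) auto
    finally show ?thesis by (simp add: algebra_simps)
  qed
  have "norm (h s - h t) \<le> 7 * real m * M * norm (s - t)"
  proof (rule differentiable_bound[of UNIV h "\<lambda>t x. x *\<^sub>R ?h' t"])
    show "(h has_derivative (\<lambda>x. x *\<^sub>R ?h' t)) (at t within UNIV)" for t
      using der[of t] by (simp add: has_vector_derivative_def)
    show "onorm (\<lambda>x. x *\<^sub>R ?h' t) \<le> 7 * real m * M" for t
    proof (rule onorm_le)
      fix x :: real
      show "norm (x *\<^sub>R ?h' t) \<le> 7 * real m * M * norm x"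
        unfolding norm_scaleR real_norm_def mult.commute[of "\<bar>x\<bar>"]
        by (intro mult_right_mono bd) simp
    qed
  qed simp_all
  then show ?thesis by simp
qed

text \<open>Generated inductively so that restrictions to curves can be treated one coordinate
  factor at a time. Constants carry every index, so the index only bounds the degree from
  above.\<close>

inductive spoly :: "nat \<Rightarrow> (real ^ 'n \<Rightarrow> real) \<Rightarrow> bool" where
  const: "spoly m (\<lambda>_. c)"
| add: "spoly m f \<Longrightarrow> spoly m g \<Longrightarrow> spoly m (\<lambda>x. f x + g x)"
| coord: "spoly m f \<Longrightarrow> spoly (Suc m) (\<lambda>x. x $ i * f x)"

lemma spoly_mono: "spoly m f \<Longrightarrow> m \<le> m' \<Longrightarrow> spoly m' f"
proof (induction arbitrary: m' rule: spoly.induct)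
  case (coord m f i)
  then obtain k where "m' = Suc k" "m \<le> k" by (cases m') auto
  then show ?case using coord spoly.coord by blast
qed (auto intro: spoly.intros)

lemma spoly_scale: "spoly m f \<Longrightarrow> spoly m (\<lambda>x. c * f x)"
proof (induction rule: spoly.induct)
  case (coord m f i)
  then show ?case using spoly.coord[of m "\<lambda>x. c * f x" i] by (simp add: mult.left_commute)
qed (auto simp: distrib_left intro: spoly.intros)

lemma spoly_diff:
  assumes "spoly m f" "spoly m g" shows "spoly m (\<lambda>x. f x - g x)"
  using spoly.add[OF assms(1) spoly_scale[OF assms(2), of "-1"]] by simp

lemma spoly_mult: "spoly m f \<Longrightarrow> spoly m' g \<Longrightarrow> spoly (m + m') (\<lambda>x. f x * g x)"
proof (induction rule: spoly.induct)
  case (const m c)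
  then show ?case by (intro spoly_mono[OF spoly_scale[of m']]) auto
next
  case (add m f h)
  then show ?case by (simp add: distrib_right spoly.add)
next
  case (coord m f i)
  then show ?case using spoly.coord[of "m + m'" "\<lambda>x. f x * g x" i] by (simp add: mult.assoc)
qed

lemma spoly_coord: "spoly 1 (\<lambda>x. x $ i)"
  using spoly.coord[OF spoly.const[of 0 1], of i] by simp

lemma spoly_sum:
  "finite A \<Longrightarrow> (\<And>i. i \<in> A \<Longrightarrow> spoly m (f i)) \<Longrightarrow> spoly m (\<lambda>x. \<Sum>i\<in>A. f i x)"
  by (induction A rule: finite_induct) (auto intro: spoly.intros)

lemma spoly_inner: "spoly 1 (\<lambda>x. a \<bullet> x)"
  unfolding inner_vec_def inner_real_def by (intro spoly_sum spoly_scale spoly_coord) simp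

lemma spoly_power: "spoly m f \<Longrightarrow> spoly (m * k) (\<lambda>x. f x ^ k)"
  by (induction k) (auto intro: spoly.const spoly_mult)

lemma spoly_monomial:
  assumes "finite A" shows "spoly (\<Sum>i\<in>A. k i) (\<lambda>x. \<Prod>i\<in>A. (x $ i) ^ k i)"
  using assms
proof (induction A rule: finite_induct)
  case empty
  then show ?case by (simp add: spoly.const)
next
  case (insert i A)
  have "spoly (k i) (\<lambda>x. (x $ i) ^ k i)" using spoly_power[OF spoly_coord, of "k i"] by simp
  then show ?case using insert spoly_mult by simp
qed

lemma sphere_polys_spoly:
  assumes "f \<in> sphere_polys n"
  obtains g where "spoly n g" "\<And>x. x \<in> sphere 0 1 \<Longrightarrow> f x = g x"
proof -
  obtain c where c: "\<forall>x\<in>sphere 0 1.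
     f x = (\<Sum>k | (\<Sum>i\<in>UNIV. k i) \<le> n. c k * (\<Prod>i\<in>UNIV. (x $ i) ^ k i))"
    using assms unfolding sphere_polys_def by blast
  have "spoly n (\<lambda>x. \<Sum>k | (\<Sum>i\<in>UNIV. k i) \<le> n. c k * (\<Prod>i\<in>UNIV. (x $ i) ^ k i))"
    by (intro spoly_sum finite_bounded_multi_indices spoly_scale spoly_mono[OF spoly_monomial])
      simp_all
  then show ?thesis using that c by blast
qed

lemma spoly_continuous: "spoly m f \<Longrightarrow> continuous_on A f"
  by (induction rule: spoly.induct) (auto intro!: continuous_intros)

section \<open>Elementary inequalities for square roots, sine and cosine\<close>

lemma abs_sqrt_diff_mult_add:
  "0 \<le> a \<Longrightarrow> 0 \<le> b \<Longrightarrow> \<bar>sqrt a - sqrt b\<bar> * (sqrt a + sqrt b) = \<bar>a - b\<bar>"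
proof -
  assume ab: "0 \<le> a" "0 \<le> b"
  then have "(sqrt a - sqrt b) * (sqrt a + sqrt b) = a - b"
    by (simp add: algebra_simps flip: power2_eq_square)
  then show ?thesis using ab by (metis abs_mult abs_of_nonneg add_nonneg_nonneg real_sqrt_ge_zero)
qed

lemma abs_sqrt_diff_le:
  assumes "0 \<le> a" "0 \<le> b" "c > 0" "c \<le> sqrt a + sqrt b"
  shows "\<bar>sqrt a - sqrt b\<bar> \<le> \<bar>a - b\<bar> / c"
proof -
  have "\<bar>sqrt a - sqrt b\<bar> * c \<le> \<bar>a - b\<bar>"
    unfolding abs_sqrt_diff_mult_add[OF assms(1,2), symmetric] using assms by (intro mult_left_mono) auto
  then show ?thesis using assms by (simp add: field_simps)
qed

lemma abs_sqrt_diff_sq_le: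
  assumes "0 \<le> a" "0 \<le> b"
  shows "\<bar>sqrt a - sqrt b\<bar>\<^sup>2 \<le> \<bar>a - b\<bar>"
  unfolding abs_sqrt_diff_mult_add[OF assms, symmetric] power2_eq_square
  using assms by (intro mult_left_mono) (auto simp: abs_le_iff)

lemma abs_cos_diff_le: "\<bar>cos x - cos y\<bar> \<le> \<bar>x - y\<bar>" for x y :: real
proof -
  have "\<bar>cos x - cos y\<bar> = 2 * \<bar>sin ((x + y) / 2)\<bar> * \<bar>sin ((y - x) / 2)\<bar>"
    by (simp add: cos_diff_cos abs_mult)
  also have "\<dots> \<le> 2 * 1 * \<bar>(y - x) / 2\<bar>"
    by (intro mult_mono abs_sin_x_le_abs_x) auto
  finally show ?thesis by simp
qed

lemma abs_sin_diff_le: "\<bar>sin x - sin y\<bar> \<le> \<bar>x - y\<bar>" for x y :: real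
  using abs_cos_diff_le[of "pi/2 - x" "pi/2 - y"] by (simp add: cos_diff)

text \<open>\<open>S\<close> runs through the projection of a great circle to the unit ball of the hyperplane orthogonal
  to \<open>e\<close>, and \<open>X\<close> through a curve in the cap. Since \<open>c\<^sup>2\<close> is a trigonometric polynomial, a
  polynomial along \<open>X\<close> has the form \<open>p + c r\<close> with trigonometric polynomials \<open>p\<close> and \<open>r\<close>, which are
  recovered from its even and odd part with respect to \<open>t \<mapsto> t + \<pi>\<close>.\<close>

locale cap_curve =
  fixes e a b :: "real ^ 'n" and \<kappa> :: real
  assumes e: "norm e = 1" and ortho: "a \<bullet> e = 0" "b \<bullet> e = 0" and \<kappa>: "0 \<le> \<kappa>" "\<kappa> \<le> 1/4"
    and le1: "norm (cos t *\<^sub>R a + sin t *\<^sub>R b) \<le> 1"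
begin

definition "S t = cos t *\<^sub>R a + sin t *\<^sub>R b"
definition "c t = sqrt (1 - \<kappa>\<^sup>2 * (norm (S t))\<^sup>2)"
text \<open>With \<theta> the angle between \<open>X t\<close> and \<open>e\<close>, the length of
  \<open>\<kappa> *\<^sub>R S t\<close> is sin(\<theta>/2) and \<open>c t\<close> is
  cos(\<theta>/2). The double angle formulas turn the right side into cos \<theta> times
  \<open>e\<close> plus sin \<theta> times the unit vector in the direction of
  \<open>S t\<close>.\<close>

definition "X t = (1 - 2 * \<kappa>\<^sup>2 * (norm (S t))\<^sup>2) *\<^sub>R e + (2 * \<kappa> * c t) *\<^sub>R S t"

lemma S_le: "norm (S t) \<le> 1" using le1 by (simp add: S_def)

lemma S_ortho: "S t \<bullet> e = 0" by (simp add: S_def inner_add_left ortho)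

lemma S_pi: "S (t + pi) = - S t" by (simp add: S_def)

lemma c_pi: "c (t + pi) = c t" by (simp add: c_def S_pi)

lemma \<kappa>S_le: "\<kappa>\<^sup>2 * (norm (S t))\<^sup>2 \<le> 1/16"
proof -
  have "\<kappa>\<^sup>2 * (norm (S t))\<^sup>2 \<le> (1/4)\<^sup>2 * 1\<^sup>2"
    using S_le \<kappa> by (intro mult_mono power_mono) auto
  then show ?thesis by (simp add: power2_eq_square)
qed

lemma c_sq: "(c t)\<^sup>2 = 1 - \<kappa>\<^sup>2 * (norm (S t))\<^sup>2"
  using \<kappa>S_le[of t] by (simp add: c_def)

lemma c_bounds: "1/2 \<le> c t" "c t \<le> 1"
proof -
  show "1/2 \<le> c t"
    unfolding c_def using \<kappa>S_le[of t] by (intro real_le_rsqrt) (simp add: power2_eq_square)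
  show "c t \<le> 1" unfolding c_def by (simp add: zero_le_mult_iff)
qed

lemma norm_X: "norm (X t) = 1"
proof -
  have "(norm (X t))\<^sup>2 = (1 - 2 * \<kappa>\<^sup>2 * (norm (S t))\<^sup>2)\<^sup>2 + 4 * \<kappa>\<^sup>2 * (c t)\<^sup>2 * (norm (S t))\<^sup>2"
    using norm_add_Pythagorean[of "(1 - 2 * \<kappa>\<^sup>2 * (norm (S t))\<^sup>2) *\<^sub>R e" "(2 * \<kappa> * c t) *\<^sub>R S t"] S_ortho[of t]
    by (simp add: X_def orthogonal_def inner_commute[of e] e power_mult_distrib)
  also have "\<dots> = 1" unfolding c_sq by (simp add: power2_eq_square algebra_simps)
  finally show ?thesis using norm_ge_zero[of "X t"] by (auto simp: power2_eq_1_iff)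
qed

lemma X_e: "X t \<bullet> e = 1 - 2 * \<kappa>\<^sup>2 * (norm (S t))\<^sup>2"
  using S_ortho[of t] e by (simp add: X_def inner_add_left dot_square_norm)

lemma S_lipschitz: "norm (S s - S t) \<le> 2 * \<bar>s - t\<bar>"
proof -
  have a: "norm a \<le> 1" using le1[of 0] by simp
  have b: "norm b \<le> 1" using le1[of "pi/2"] by simp
  have "S s - S t = (cos s - cos t) *\<^sub>R a + (sin s - sin t) *\<^sub>R b"
    by (simp add: S_def algebra_simps)
  also have "norm \<dots> \<le> \<bar>cos s - cos t\<bar> * norm a + \<bar>sin s - sin t\<bar> * norm b"
    by (rule order.trans[OF norm_triangle_ineq]) simp
  also have "\<dots> \<le> \<bar>s - t\<bar> * 1 + \<bar>s - t\<bar> * 1"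
    using a b abs_cos_diff_le abs_sin_diff_le by (intro add_mono mult_mono) auto
  finally show ?thesis by simp
qed

lemma c_lipschitz: "\<bar>c s - c t\<bar> \<le> 2 * \<bar>s - t\<bar>"
proof -
  have "\<bar>c s - c t\<bar> \<le> \<bar>(c s)\<^sup>2 - (c t)\<^sup>2\<bar> / 1"
    using abs_sqrt_diff_le[of "(c s)\<^sup>2" "(c t)\<^sup>2" 1] c_bounds[of s] c_bounds[of t] by simp
  also have "\<dots> = \<kappa>\<^sup>2 * \<bar>norm (S s) - norm (S t)\<bar> * (norm (S s) + norm (S t))"
  proof -
    have "(c s)\<^sup>2 - (c t)\<^sup>2 = - (\<kappa>\<^sup>2 * ((norm (S s) - norm (S t)) * (norm (S s) + norm (S t))))"
      unfolding c_sq by (simp add: power2_eq_square algebra_simps)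
    then show ?thesis by (simp add: abs_mult)
  qed
  also have "\<dots> \<le> (1/4)\<^sup>2 * (2 * \<bar>s - t\<bar>) * (1 + 1)"
    using \<kappa> S_le norm_triangle_ineq3[of "S s" "S t"] S_lipschitz[of s t]
    by (intro mult_mono power_mono add_mono) auto
  also have "\<dots> = \<bar>s - t\<bar> / 4" by (simp add: power2_eq_square)
  also have "\<dots> \<le> 2 * \<bar>s - t\<bar>" by simp
  finally show ?thesis .
qed

lemma norm_S_sq: "(norm (S t))\<^sup>2 =
    cos t * cos t * (a \<bullet> a) + (2 * (a \<bullet> b)) * (sin t * cos t) + sin t * sin t * (b \<bullet> b)"
  unfolding S_def power2_norm_eq_inner
  by (simp add: inner_add_left inner_add_right inner_commute[of b a] distrib_left power2_eq_square mult_ac)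

lemma trig_poly_scale: "trig_poly m f \<Longrightarrow> trig_poly m (\<lambda>t. z * f t)"
  using trig_poly_mult[OF trig_poly_const[of 0 z]] by simp

lemma trig_poly_quadratic:
  fixes u v :: "real \<Rightarrow> real"
  assumes "trig_poly 1 (\<lambda>t. complex_of_real (u t))" "trig_poly 1 (\<lambda>t. complex_of_real (v t))"
  shows "trig_poly 2 (\<lambda>t. complex_of_real (u t * v t))"
  using trig_poly_mult[OF assms] by (simp add: numeral_2_eq_2)

lemma trig_poly_norm_S_sq: "trig_poly 2 (\<lambda>t. complex_of_real ((norm (S t))\<^sup>2))"
proof -
  have "trig_poly 2 (\<lambda>t. complex_of_real (a \<bullet> a) * complex_of_real (cos t * cos t)
     + complex_of_real (2 * (a \<bullet> b)) * complex_of_real (sin t * cos t)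
     + complex_of_real (b \<bullet> b) * complex_of_real (sin t * sin t))"
    by (intro trig_poly_add trig_poly_scale trig_poly_quadratic trig_poly_cos trig_poly_sin)
  then show ?thesis unfolding norm_S_sq by (simp add: mult_ac)
qed

lemma trig_poly_S: "trig_poly 1 (\<lambda>t. complex_of_real (S t $ i))"
proof -
  have "trig_poly 1 (\<lambda>t. complex_of_real (a $ i) * complex_of_real (cos t)
     + complex_of_real (b $ i) * complex_of_real (sin t))"
    by (intro trig_poly_add trig_poly_scale trig_poly_cos trig_poly_sin)
  then show ?thesis by (simp add: S_def mult_ac)
qed

text \<open>Each coordinate of \<open>X\<close> is \<open>A + c B\<close> with \<open>A\<close> of
  degree 2 and invariant under the shift by pi, and \<open>B\<close> of degree 1 and changing sign.
  In \<open>(A + c B) (p + c r) = (A p + c\<^sup>2 B r) + c (A r + B p)\<close> the factor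
  \<open>c\<^sup>2\<close> has degree 2, so a coordinate costs at most three degrees, and the
  parities persist.\<close>

lemma spoly_curve_decomposition:
  assumes "spoly m g"
  shows "\<exists>p r. trig_poly (3 * m) p \<and> trig_poly (3 * m) r \<and> (\<forall>t. p (t + pi) = p t) \<and>
    (\<forall>t. r (t + pi) = - r t) \<and>
    (\<forall>t. complex_of_real (g (X t)) = p t + complex_of_real (c t) * r t)"
  using assms
proof (induction rule: spoly.induct)
  case (const m z)
  then show ?case
    by (intro exI[of _ "\<lambda>_. complex_of_real z"] exI[of _ "\<lambda>_. 0"]) (auto simp: trig_poly_const)
next
  case (add m f g)
  then obtain p r p' r' where "trig_poly (3 * m) p" "trig_poly (3 * m) r"
    "\<And>t. p (t + pi) = p t" "\<And>t. r (t + pi) = - r t"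
    "\<And>t. complex_of_real (f (X t)) = p t + complex_of_real (c t) * r t"
    "trig_poly (3 * m) p'" "trig_poly (3 * m) r'"
    "\<And>t. p' (t + pi) = p' t" "\<And>t. r' (t + pi) = - r' t"
    "\<And>t. complex_of_real (g (X t)) = p' t + complex_of_real (c t) * r' t" by metis
  then show ?case
    by (intro exI[of _ "\<lambda>t. p t + p' t"] exI[of _ "\<lambda>t. r t + r' t"])
      (auto simp: trig_poly_add algebra_simps)
next
  case (coord m f i)
  then obtain p r where pr: "trig_poly (3 * m) p" "trig_poly (3 * m) r"
    "\<And>t. p (t + pi) = p t" "\<And>t. r (t + pi) = - r t"
    "\<And>t. complex_of_real (f (X t)) = p t + complex_of_real (c t) * r t" by metis
  define A where "A t = complex_of_real (e $ i) + complex_of_real (- 2 * \<kappa>\<^sup>2 * e $ i) * complex_of_real ((norm (S t))\<^sup>2)" for t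
  define B where "B t = complex_of_real (2 * \<kappa>) * complex_of_real (S t $ i)" for t
  define c2 where "c2 t = 1 + complex_of_real (- \<kappa>\<^sup>2) * complex_of_real ((norm (S t))\<^sup>2)" for t
  have c2: "c2 t = complex_of_real (c t) * complex_of_real (c t)" for t
  proof -
    have "c2 t = complex_of_real ((c t)\<^sup>2)" unfolding c_sq c2_def by simp
    then show ?thesis by (simp add: power2_eq_square)
  qed
  have A: "trig_poly 2 A" "A (t + pi) = A t" for t
    unfolding A_def by (intro trig_poly_add trig_poly_const trig_poly_scale trig_poly_norm_S_sq) (simp add: S_pi)
  have B: "trig_poly 1 B" "B (t + pi) = - B t" for t
    unfolding B_def by (intro trig_poly_scale trig_poly_S) (simp add: S_pi)
  have C: "trig_poly 2 c2" "c2 (t + pi) = c2 t" for t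
    unfolding c2_def by (intro trig_poly_add trig_poly_const trig_poly_scale trig_poly_norm_S_sq) (simp add: S_pi)
  have Xi: "complex_of_real (X t $ i) = A t + complex_of_real (c t) * B t" for t
    by (simp add: X_def A_def B_def algebra_simps)
  have CB: "trig_poly 3 (\<lambda>t. c2 t * B t)" using trig_poly_mult[OF C(1) B(1)] by simp
  have 1: "trig_poly (3 * Suc m) (\<lambda>t. A t * p t + (c2 t * B t) * r t)"
    by (intro trig_poly_add trig_poly_mono[OF trig_poly_mult[OF A(1) pr(1)]]
        trig_poly_mono[OF trig_poly_mult[OF CB pr(2)]]) auto
  have 2: "trig_poly (3 * Suc m) (\<lambda>t. A t * r t + B t * p t)"
    by (intro trig_poly_add trig_poly_mono[OF trig_poly_mult[OF A(1) pr(2)]]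
        trig_poly_mono[OF trig_poly_mult[OF B(1) pr(1)]]) auto
  show ?case
  proof (intro exI conjI allI)
    fix t
    show "complex_of_real (X t $ i * f (X t)) =
      (A t * p t + (c2 t * B t) * r t) + complex_of_real (c t) * (A t * r t + B t * p t)"
      unfolding of_real_mult Xi pr(5) c2 by (simp add: algebra_simps)
  qed (use 1 2 A B C pr in auto)
qed

text \<open>The shift by pi turns \<open>p + c r\<close> into \<open>p - c r\<close>, so half the
  sum and half the difference bound \<open>p\<close> and \<open>c r\<close> by \<open>M\<close>.
  Since \<open>c\<close> is at least 1/2, \<open>r\<close> is bounded by \<open>2 * M\<close>, and
  Bernstein's inequality applies to \<open>p\<close> and \<open>r\<close> separately.\<close>

lemma spoly_curve_lipschitz:
  assumes g: "spoly m g" and m: "m \<ge> 1" and M: "\<And>t. \<bar>g (X t)\<bar> \<le> M"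
  shows "\<bar>g (X s) - g (X t)\<bar> \<le> 70 * real m * M * \<bar>s - t\<bar>"
proof -
  obtain p r where pr: "trig_poly (3 * m) p" "trig_poly (3 * m) r"
    "\<And>t. p (t + pi) = p t" "\<And>t. r (t + pi) = - r t"
    "\<And>t. complex_of_real (g (X t)) = p t + complex_of_real (c t) * r t"
    using spoly_curve_decomposition[OF g] by blast
  have M0: "0 \<le> M" using order.trans[OF abs_ge_zero M] .
  define h where "h t = complex_of_real (g (X t))" for t
  have nh: "norm (h t) \<le> M" for t using M by (simp add: h_def)
  have h2: "h (t + pi) = p t - complex_of_real (c t) * r t" for t
    unfolding h_def pr(5) pr(3,4) c_pi by simp
  have half: "norm (u / 2) \<le> M" if "norm u \<le> M + M" for u :: complex
    using that by (simp add: norm_divide)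
  have p_eq: "p t = (h t + h (t + pi)) / 2" for t
    unfolding h2 by (simp add: h_def pr(5))
  have np: "norm (p t) \<le> M" for t
    unfolding p_eq by (intro half order.trans[OF norm_triangle_ineq] add_mono nh)
  have cr_eq: "complex_of_real (c t) * r t = (h t - h (t + pi)) / 2" for t
    unfolding h2 by (simp add: h_def pr(5))
  have crn: "norm (complex_of_real (c t) * r t) \<le> M" for t
    unfolding cr_eq by (intro half order.trans[OF norm_triangle_ineq4] add_mono nh)
  have cr: "c t * norm (r t) \<le> M" for t
    using crn[of t] c_bounds[of t] by (simp add: norm_mult)
  have nr: "norm (r t) \<le> 2 * M" for t
  proof -
    have "1/2 * norm (r t) \<le> c t * norm (r t)" using c_bounds[of t] by (intro mult_right_mono) auto
    then show ?thesis using cr[of t] by simp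
  qed
  have "h s - h t = (p s - p t) + (complex_of_real (c s) * (r s - r t) + complex_of_real (c s - c t) * r t)"
    by (simp add: h_def pr(5) algebra_simps)
  also have "norm \<dots> \<le> norm (p s - p t) + (\<bar>c s\<bar> * norm (r s - r t) + \<bar>c s - c t\<bar> * norm (r t))"
    by (rule order.trans[OF norm_triangle_ineq add_left_mono[OF order.trans[OF norm_triangle_ineq]]])
      (simp add: norm_mult flip: of_real_diff)
  also have "\<dots> \<le> 7 * real (3 * m) * M * \<bar>s - t\<bar> + (1 * (7 * real (3 * m) * (2 * M) * \<bar>s - t\<bar>) + (2 * \<bar>s - t\<bar>) * (2 * M))"
    using c_bounds[of s] M0
    by (intro add_mono mult_mono trig_poly_lipschitz pr np nr c_lipschitz) auto
  also have "\<dots> = (63 * real m + 4) * M * \<bar>s - t\<bar>" by (simp add: algebra_simps)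
  \<comment> \<open>The additive 4 stems from the variation of \<open>c\<close> and is absorbed by
    means of \<open>m \<ge> 1\<close>.\<close>
  also have "\<dots> \<le> 70 * real m * M * \<bar>s - t\<bar>"
    using m M0 by (intro mult_right_mono) auto
  finally show ?thesis by (simp add: h_def flip: of_real_diff)
qed

end

section \<open>The Bernstein inequality on a spherical cap\<close>

lemma half_le_sin:
  fixes u :: real
  assumes "0 \<le> u" "u \<le> 1"
  shows "u / 2 \<le> sin u"
proof -
  have "sin 0 - 0/2 \<le> sin u - u/2"
  proof (rule DERIV_nonneg_imp_nondecreasing[OF assms(1)])
    fix x :: real assume x: "0 \<le> x" "x \<le> u"
    have "cos (pi/3) \<le> cos x"
      using x assms pi_gt3 by (intro cos_monotone_0_pi_le) auto
    then have "0 \<le> cos x - 1/2" by (simp add: cos_60)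
    then show "\<exists>y. ((\<lambda>x. sin x - x/2) has_real_derivative y) (at x) \<and> y \<ge> 0"
      by (intro exI[of _ "cos x - 1/2"] conjI) (auto intro!: derivative_eq_intros)
  qed
  then show ?thesis by simp
qed

lemma quarter_le_sin:
  fixes u :: real
  assumes "0 \<le> u" "u \<le> pi / 2"
  shows "u / 4 \<le> sin u"
proof (cases "u \<le> 1")
  case True
  then show ?thesis using half_le_sin[of u] assms by simp
next
  case False
  have "1/2 \<le> sin (1::real)" using half_le_sin[of 1] by simp
  also have "\<dots> \<le> sin u" using False assms by (intro sin_monotone_2pi_le) auto
  finally show ?thesis using assms pi_less_4 by simp
qed

lemma norm_diff_sq_sphere:
  fixes x y :: "'a :: real_inner"
  assumes "norm x = 1" "norm y = 1"
  shows "(norm (x - y))\<^sup>2 = 2 - 2 * (x \<bullet> y)"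
  using assms dot_norm_neg[of x y] by (simp add: field_simps)

lemma abs_inner_le_1:
  fixes x y :: "'a :: real_inner"
  assumes "norm x = 1" "norm y = 1"
  shows "\<bar>x \<bullet> y\<bar> \<le> 1"
  using Cauchy_Schwarz_ineq2[of x y] assms by simp

lemma norm_diff_eq_sin_arccos:
  fixes x y :: "'a :: real_inner"
  assumes "norm x = 1" "norm y = 1"
  shows "norm (x - y) = 2 * sin (arccos (x \<bullet> y) / 2)"
proof -
  define t where "t = arccos (x \<bullet> y)"
  have t: "0 \<le> t" "t \<le> pi" "cos t = x \<bullet> y"
    using abs_inner_le_1[OF assms] by (auto simp: t_def arccos_bounded abs_le_iff cos_arccos_abs)
  have "cos t = 1 - 2 * (sin (t/2))\<^sup>2" using cos_double_sin[of "t/2"] by simp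
  then have eq: "(norm (x - y))\<^sup>2 = (2 * sin (t/2))\<^sup>2"
    using norm_diff_sq_sphere[OF assms] t by (simp add: power_mult_distrib)
  have "0 \<le> sin (t/2)" using t by (intro sin_ge_zero) auto
  then have "norm (x - y) = 2 * sin (t/2)" by (intro power2_eq_imp_eq[OF eq]) auto
  then show ?thesis by (simp add: t_def)
qed

lemma arccos_inner_le:
  fixes x y :: "'a :: real_inner"
  assumes "norm x = 1" "norm y = 1"
  shows "arccos (x \<bullet> y) \<le> 4 * norm (x - y)"
proof -
  have "0 \<le> arccos (x \<bullet> y)" "arccos (x \<bullet> y) \<le> pi"
    using abs_inner_le_1[OF assms] by (auto simp: arccos_lbound arccos_ubound abs_le_iff)
  then show ?thesis
    using quarter_le_sin[of "arccos (x \<bullet> y) / 2"] norm_diff_eq_sin_arccos[OF assms] by simp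
qed

lemma norm_diff_le_arccos:
  fixes x y :: "'a :: real_inner"
  assumes "norm x = 1" "norm y = 1"
  shows "norm (x - y) \<le> arccos (x \<bullet> y)"
proof -
  have "0 \<le> arccos (x \<bullet> y)" 
    using abs_inner_le_1[OF assms] by (auto simp: arccos_lbound abs_le_iff)
  then show ?thesis
    using sin_x_le_x[of "arccos (x \<bullet> y) / 2"] norm_diff_eq_sin_arccos[OF assms] by simp
qed

lemma norm_sub_proj_sq:
  fixes a x :: "'a :: real_inner"
  assumes "norm x = 1" "norm a = 1"
  shows "(norm (x - (x \<bullet> a) *\<^sub>R a))\<^sup>2 = 1 - (x \<bullet> a)\<^sup>2"
proof -
  have "x \<bullet> x = 1" "a \<bullet> a = 1" using assms by (simp_all add: dot_square_norm)
  then show ?thesis unfolding power2_norm_eq_inner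
    by (simp add: inner_diff_left inner_diff_right inner_commute[of a x] power2_eq_square)
qed

locale spherical_cap =
  fixes e :: "real ^ 'n" and \<alpha> :: real
  assumes e: "norm e = 1" and \<alpha>: "0 < \<alpha>" "\<alpha> \<le> 1/2"
begin

abbreviation "\<rho> \<equiv> rho e \<alpha>"

definition "height x = x \<bullet> e - cos \<alpha>"

text \<open>Equivalent to \<open>\<rho>\<close>, but algebraic in \<open>x\<close>, \<open>y\<close> and their heights.\<close>

definition "hdist x y = (norm (x - y) + \<bar>sqrt (height x) - sqrt (height y)\<bar>) / \<alpha>"

lemma \<alpha>_pi: "\<alpha> < pi" using \<alpha> pi_gt3 by simp

lemma cap_iff: "x \<in> cap e \<alpha> \<longleftrightarrow> norm x = 1 \<and> cos \<alpha> \<le> x \<bullet> e"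
proof (cases "norm x = 1")
  case True
  have x: "-1 \<le> x \<bullet> e" "x \<bullet> e \<le> 1" using abs_inner_le_1[OF True e] by auto
  have "arccos (x \<bullet> e) \<le> arccos (cos \<alpha>) \<longleftrightarrow> cos \<alpha> \<le> x \<bullet> e"
    using x by (intro arccos_le_mono) (auto simp: abs_le_iff)
  then show ?thesis using True \<alpha> \<alpha>_pi by (simp add: cap_def geodesic_dist_def arccos_cos)
qed (simp add: cap_def)

lemma cap_D:
  assumes "x \<in> cap e \<alpha>"
  shows "norm x = 1" "cos \<alpha> \<le> x \<bullet> e" "x \<bullet> e \<le> 1" "0 \<le> height x"
  using assms abs_inner_le_1[of x e] e by (auto simp: cap_iff height_def)

lemma cos_\<alpha>: "3/4 \<le> cos \<alpha>" "cos \<alpha> < 1"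
proof -
  have 1: "1 - cos \<alpha> = 2 * (sin (\<alpha>/2))\<^sup>2" using cos_double_sin[of "\<alpha>/2"] by simp
  have 2: "sin (\<alpha>/2) \<le> 1/4" "0 < sin (\<alpha>/2)"
    using sin_x_le_x[of "\<alpha>/2"] \<alpha> \<alpha>_pi by (auto intro!: sin_gt_zero)
  have "(sin (\<alpha>/2))\<^sup>2 \<le> (1/4)\<^sup>2" using 2 by (intro power_mono) auto
  then show "3/4 \<le> cos \<alpha>" using 1 by (simp add: power_divide)
  have "0 < (sin (\<alpha>/2))\<^sup>2" using 2(2) by (rule zero_less_power)
  then show "cos \<alpha> < 1" using 1 by linarith
qed

text \<open>Half the chord from \<open>e\<close> to the boundary of the cap; this normalization
  gives \<open>flat\<close> norm 1 exactly on the boundary.\<close>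

definition "\<kappa> = sin (\<alpha>/2)"

lemma \<kappa>: "0 < \<kappa>" "\<alpha>/4 \<le> \<kappa>" "\<kappa> \<le> 1/4" "2 * \<kappa>\<^sup>2 = 1 - cos \<alpha>"
  using half_le_sin[of "\<alpha>/2"] sin_x_le_x[of "\<alpha>/2"] \<alpha> \<alpha>_pi cos_double_sin[of "\<alpha>/2"]
  by (auto simp: \<kappa>_def intro!: sin_gt_zero)

text \<open>Coordinates in which the cap is the unit ball of the hyperplane orthogonal to \<open>e\<close> and
  spherical polynomials that are even about \<open>e\<close> become polynomials.\<close>

definition "flat x = (1 / (\<kappa> * sqrt (2 * (1 + x \<bullet> e)))) *\<^sub>R (x - (x \<bullet> e) *\<^sub>R e)"

text \<open>The chordal distance on the upper hemisphere of the lifted points is comparable to \<open>\<rho>\<close>.\<close>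

definition "lift x = flat x + sqrt (1 - (norm (flat x))\<^sup>2) *\<^sub>R e"

lemma flat_e: "flat x \<bullet> e = 0"
  using e by (simp add: flat_def inner_diff_left dot_square_norm)

text \<open>At angle \<theta> from \<open>e\<close> the norm of \<open>flat x\<close> is
  sin(\<theta>/2) / sin(\<alpha>/2): \<open>flat\<close> is Lambert's azimuthal projection,
  rescaled.\<close>

lemma norm_flat_sq:
  assumes "x \<in> cap e \<alpha>"
  shows "2 * \<kappa>\<^sup>2 * (norm (flat x))\<^sup>2 = 1 - x \<bullet> e"
proof -
  note x = cap_D[OF assms]
  have p: "0 < 1 + x \<bullet> e" using x cos_\<alpha> by simp
  have "(norm (flat x))\<^sup>2 = (1 - (x \<bullet> e)\<^sup>2) / (\<kappa>\<^sup>2 * (2 * (1 + x \<bullet> e)))"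
    using norm_sub_proj_sq[OF x(1) e] p \<kappa>(1)
    by (simp add: flat_def power_mult_distrib power_divide)
  also have "1 - (x \<bullet> e)\<^sup>2 = (1 - x \<bullet> e) * (1 + x \<bullet> e)"
    by (simp add: power2_eq_square algebra_simps)
  also have "(1 - x \<bullet> e) * (1 + x \<bullet> e) / (\<kappa>\<^sup>2 * (2 * (1 + x \<bullet> e))) = (1 - x \<bullet> e) / (2 * \<kappa>\<^sup>2)"
    using p \<kappa>(1) by (simp add: divide_simps)
  finally show ?thesis using \<kappa>(1) by simp
qed

text \<open>Hence the coordinate of \<open>lift x\<close> along \<open>e\<close> is a multiple of
  \<open>sqrt (height x)\<close>, which is how square roots of heights enter
  \<open>hdist\<close>.\<close>

lemma height_flat:
  assumes "x \<in> cap e \<alpha>"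
  shows "1 - (norm (flat x))\<^sup>2 = height x / (2 * \<kappa>\<^sup>2)"
proof -
  have "height x = 2 * \<kappa>\<^sup>2 * (1 - (norm (flat x))\<^sup>2)"
    using norm_flat_sq[OF assms] \<kappa>(4)
    unfolding height_def right_diff_distrib mult_1_right by linarith
  then show ?thesis using \<kappa>(1) by simp
qed

lemma norm_flat_le:
  assumes "x \<in> cap e \<alpha>" shows "(norm (flat x))\<^sup>2 \<le> 1"
proof -
  have "0 \<le> height x / (2 * \<kappa>\<^sup>2)" using cap_D(4)[OF assms] by (intro divide_nonneg_nonneg) auto
  then show ?thesis unfolding height_flat[OF assms, symmetric] by simp
qed

lemma norm_lift:
  assumes "x \<in> cap e \<alpha>" shows "norm (lift x) = 1"
proof -
  have "(norm (lift x))\<^sup>2 = 1"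
    using norm_add_Pythagorean[of "flat x" "sqrt (1 - (norm (flat x))\<^sup>2) *\<^sub>R e"] flat_e[of x]
      norm_flat_le[OF assms] e
    by (simp add: lift_def orthogonal_def power_mult_distrib)
  then show ?thesis using norm_ge_zero[of "lift x"] by (auto simp: power2_eq_1_iff)
qed

text \<open>\<open>flat\<close> is \<open>1 / \<kappa>\<close> times a quotient
  \<open>Q / P\<close>, where \<open>Q\<close> has Lipschitz constant 1 and norm at most 1, and
  \<open>P\<close> has Lipschitz constant 2 and is at least 1. With
  \<open>\<alpha> / 4 \<le> \<kappa>\<close> this gives 4 * 3 = 12.\<close>

lemma norm_flat_diff_le:
  assumes "x \<in> cap e \<alpha>" "y \<in> cap e \<alpha>"
  shows "norm (flat x - flat y) \<le> 12 / \<alpha> * norm (x - y)"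
proof -
  define P where "P x = sqrt (2 * (1 + x \<bullet> e))" for x
  define Q where "Q x = x - (x \<bullet> e) *\<^sub>R e" for x
  note x = cap_D[OF assms(1)] and y = cap_D[OF assms(2)]
  have P1: "1 \<le> P z" if "z \<in> cap e \<alpha>" for z
    using cap_D[OF that] cos_\<alpha> by (simp add: P_def)
  note Px = P1[OF assms(1)] and Py = P1[OF assms(2)]
  have ip: "\<bar>(x - y) \<bullet> e\<bar> \<le> norm (x - y)"
    using Cauchy_Schwarz_ineq2[of "x - y" e] e by simp
  have "(norm (Q x - Q y))\<^sup>2 \<le> (norm (x - y))\<^sup>2"
  proof -
    have "x - y = (Q x - Q y) + ((x - y) \<bullet> e) *\<^sub>R e" by (simp add: Q_def algebra_simps)
    moreover have "orthogonal (Q x - Q y) (((x - y) \<bullet> e) *\<^sub>R e)"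
      using e by (simp add: orthogonal_def Q_def inner_diff_left dot_square_norm)
    ultimately show ?thesis using norm_add_Pythagorean
      by (metis le_add_same_cancel1 zero_le_power2)
  qed
  then have Qd: "norm (Q x - Q y) \<le> norm (x - y)" by (rule power2_le_imp_le) simp
  have "(norm (Q y))\<^sup>2 \<le> 1\<^sup>2" using norm_sub_proj_sq[OF y(1) e] by (simp add: Q_def)
  then have Qy: "norm (Q y) \<le> 1" by (rule power2_le_imp_le) simp
  have "\<bar>P x - P y\<bar> \<le> \<bar>2 * (1 + x \<bullet> e) - 2 * (1 + y \<bullet> e)\<bar> / 1"
    unfolding P_def
  proof (intro abs_sqrt_diff_le)
    show "1 \<le> sqrt (2 * (1 + x \<bullet> e)) + sqrt (2 * (1 + y \<bullet> e))" using Px Py unfolding P_def by linarith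
  qed (use x y cos_\<alpha> in auto)
  also have "\<dots> = 2 * \<bar>(x - y) \<bullet> e\<bar>" unfolding inner_diff_left by (simp add: abs_if)
  finally have Pd: "\<bar>P x - P y\<bar> \<le> 2 * norm (x - y)" using ip by simp
  have inv: "\<bar>1 / P x - 1 / P y\<bar> \<le> 2 * norm (x - y)"
  proof -
    have "\<bar>1 / P x - 1 / P y\<bar> = \<bar>P x - P y\<bar> / (P x * P y)"
      using Px Py by (simp add: field_simps abs_divide abs_minus_commute) 
    also have "\<dots> \<le> \<bar>P x - P y\<bar> / 1"
      using Px Py mult_mono[of 1 "P x" 1 "P y"] by (intro divide_left_mono) auto
    finally show ?thesis using Pd by simp
  qed
  have "flat x - flat y = (1 / \<kappa>) *\<^sub>R ((1 / P x) *\<^sub>R (Q x - Q y) + (1 / P x - 1 / P y) *\<^sub>R Q y)"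
    by (simp add: flat_def P_def Q_def algebra_simps)
  also have "norm \<dots> = (1 / \<kappa>) * norm ((1 / P x) *\<^sub>R (Q x - Q y) + (1 / P x - 1 / P y) *\<^sub>R Q y)"
    using \<kappa> by simp
  also have "norm ((1 / P x) *\<^sub>R (Q x - Q y) + (1 / P x - 1 / P y) *\<^sub>R Q y) \<le>
      \<bar>1 / P x\<bar> * norm (Q x - Q y) + \<bar>1 / P x - 1 / P y\<bar> * norm (Q y)"
    by (rule order.trans[OF norm_triangle_ineq]) (simp only: norm_scaleR order.refl)
  also have "\<dots> \<le> 1 * norm (x - y) + (2 * norm (x - y)) * 1"
    using Px Qd Qy inv by (intro add_mono mult_mono) auto
  finally have "norm (flat x - flat y) \<le> (1 / \<kappa>) * (3 * norm (x - y))"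
    using \<kappa> by (simp add: field_simps)
  also have "\<dots> \<le> (4 / \<alpha>) * (3 * norm (x - y))"
    using \<kappa> \<alpha> by (intro mult_right_mono) (auto simp: field_simps)
  finally show ?thesis by simp
qed

lemma norm_lift_diff_le:
  assumes "x \<in> cap e \<alpha>" "y \<in> cap e \<alpha>"
  shows "norm (lift x - lift y) \<le> 12 * hdist x y"
proof -
  let ?h = "\<lambda>x. sqrt (height x)"
  have k: "sqrt (1 - (norm (flat z))\<^sup>2) = ?h z / (sqrt 2 * \<kappa>)" if "z \<in> cap e \<alpha>" for z
    unfolding height_flat[OF that] using \<kappa>(1) by (simp add: real_sqrt_divide real_sqrt_mult)
  have "lift x - lift y = (flat x - flat y) + ((?h x - ?h y) / (sqrt 2 * \<kappa>)) *\<^sub>R e"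
    by (simp add: lift_def k assms diff_divide_distrib algebra_simps)
  also have "norm \<dots> \<le> norm (flat x - flat y) + \<bar>?h x - ?h y\<bar> / (sqrt 2 * \<kappa>)"
    by (rule order.trans[OF norm_triangle_ineq]) (use e \<kappa> in simp)
  also have "\<dots> \<le> 12 / \<alpha> * norm (x - y) + \<bar>?h x - ?h y\<bar> / (\<alpha> / 12)"
  proof (intro add_mono norm_flat_diff_le assms divide_left_mono)
    have "1 * (\<alpha>/4) \<le> sqrt 2 * \<kappa>" using \<kappa> \<alpha> by (intro mult_mono) auto
    then show "\<alpha> / 12 \<le> sqrt 2 * \<kappa>" using \<alpha> by simp
  qed (use \<kappa> \<alpha> in auto)
  finally show ?thesis by (simp add: hdist_def add_divide_distrib algebra_simps)
qed

text \<open>The great circle through the lifted points \<open>u\<close> and \<open>v\<close>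
  projects to a curve \<open>S\<close> in the unit ball, and the matching curve \<open>X\<close> in
  the cap runs from \<open>x\<close> at time 0 to \<open>y\<close> at time \<open>T\<close>. Thus
  the inequality along curves applies, and \<open>T\<close> is at most a constant times the distance
  of \<open>u\<close> and \<open>v\<close>.\<close>

theorem spoly_cap_lipschitz:
  assumes g: "spoly m g" and m: "m \<ge> 1" and M: "\<And>z. z \<in> cap e \<alpha> \<Longrightarrow> \<bar>g z\<bar> \<le> M"
    and xy: "x \<in> cap e \<alpha>" "y \<in> cap e \<alpha>"
  shows "\<bar>g x - g y\<bar> \<le> 3360 * real m * M * hdist x y"
proof -
  note kap = \<kappa>
  define u where "u = lift x"
  define v where "v = lift y"
  have uv: "norm u = 1" "norm v = 1" using norm_lift xy by (auto simp: u_def v_def)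
  define T where "T = arccos (u \<bullet> v)"
  have T: "0 \<le> T" "T \<le> pi" "cos T = u \<bullet> v"
    using abs_inner_le_1[OF uv] by (auto simp: T_def arccos_lbound arccos_ubound abs_le_iff cos_arccos_abs)
  \<comment> \<open>If \<open>sin T = 0\<close>, then \<open>w = 0\<close> by the convention \<open>1 / 0 = 0\<close>, and \<open>v = cos T *\<^sub>R u\<close>.\<close>
  define w where "w = (1 / sin T) *\<^sub>R (v - cos T *\<^sub>R u)"
  have vu: "(norm (v - cos T *\<^sub>R u))\<^sup>2 = (sin T)\<^sup>2"
    using norm_sub_proj_sq[OF uv(2,1)] T(3) by (simp add: sin_squared_eq inner_commute)
  have v_eq: "cos T *\<^sub>R u + sin T *\<^sub>R w = v"
    using vu by (cases "sin T = 0") (auto simp: w_def)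
  have w_le: "norm w \<le> 1"
  proof (cases "sin T = 0")
    case False
    have "(norm w)\<^sup>2 = 1" using vu False by (simp add: w_def power_mult_distrib power_divide)
    then show ?thesis by (auto simp: power2_eq_1_iff)
  qed (simp add: w_def)
  have uw: "u \<bullet> w = 0" using T uv by (simp add: w_def inner_diff_right dot_square_norm)
  define a where "a = flat x"
  define b where "b = (1 / sin T) *\<^sub>R (flat y - cos T *\<^sub>R flat x)"
  have proj_u: "u = a + (u \<bullet> e) *\<^sub>R e"
    using flat_e[of x] e by (simp add: u_def lift_def a_def inner_add_left dot_square_norm)
  have proj_v: "v = flat y + (v \<bullet> e) *\<^sub>R e"
    using flat_e[of y] e by (simp add: v_def lift_def inner_add_left dot_square_norm)
  have proj_w: "w = b + (w \<bullet> e) *\<^sub>R e"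
  proof -
    have "w = (1 / sin T) *\<^sub>R ((flat y + (v \<bullet> e) *\<^sub>R e) - cos T *\<^sub>R (a + (u \<bullet> e) *\<^sub>R e))"
      unfolding w_def using proj_u proj_v by simp
    also have "\<dots> = b + ((1 / sin T) * (v \<bullet> e - cos T * (u \<bullet> e))) *\<^sub>R e"
      by (simp add: b_def a_def algebra_simps)
    also have "(1 / sin T) * (v \<bullet> e - cos T * (u \<bullet> e)) = w \<bullet> e"
      by (simp add: w_def inner_diff_left)
    finally show ?thesis .
  qed
  have ortho: "a \<bullet> e = 0" "b \<bullet> e = 0" by (simp_all add: a_def b_def inner_diff_left flat_e)
  \<comment> \<open>Projecting orthogonally to \<open>e\<close> does not increase norms, and the
    points \<open>cos t *\<^sub>R u + sin t *\<^sub>R w\<close> have norm at most 1.\<close>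
  interpret cap_curve e a b \<kappa>
  proof
    fix t
    let ?s = "cos t *\<^sub>R a + sin t *\<^sub>R b" and ?r = "cos t * (u \<bullet> e) + sin t * (w \<bullet> e)"
    have "cos t *\<^sub>R u + sin t *\<^sub>R w = ?s + ?r *\<^sub>R e"
      by (subst proj_u, subst proj_w) (simp add: algebra_simps)
    then have "(norm (cos t *\<^sub>R u + sin t *\<^sub>R w))\<^sup>2 = (norm ?s)\<^sup>2 + ?r\<^sup>2"
      using norm_add_Pythagorean[of ?s "?r *\<^sub>R e"] e
      by (simp add: orthogonal_def inner_add_left ortho)
    moreover have "(norm (cos t *\<^sub>R u + sin t *\<^sub>R w))\<^sup>2 = (cos t)\<^sup>2 + (sin t)\<^sup>2 * (norm w)\<^sup>2"
      using norm_add_Pythagorean[of "cos t *\<^sub>R u" "sin t *\<^sub>R w"] uw uv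
      by (simp add: orthogonal_def power_mult_distrib)
    moreover have "(sin t)\<^sup>2 * (norm w)\<^sup>2 \<le> (sin t)\<^sup>2 * 1\<^sup>2"
      using w_le by (intro mult_left_mono power_mono) auto
    ultimately have "(norm ?s)\<^sup>2 + ?r\<^sup>2 \<le> (sin t)\<^sup>2 + (cos t)\<^sup>2"
      unfolding power_one mult_1_right by linarith
    then have "(norm ?s)\<^sup>2 \<le> 1\<^sup>2"
      using zero_le_power2[of ?r] unfolding sin_cos_squared_add power_one by linarith
    then show "norm ?s \<le> 1" by (rule power2_le_imp_le) simp
  qed (use ortho e kap in auto)
  \<comment> \<open>The bound \<open>M\<close> holds on the cap only, whereas the inequality along
    the curve needs it at all times, not just between 0 and \<open>T\<close>.\<close>
  have X_cap: "X t \<in> cap e \<alpha>" for t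
  proof -
    have "\<kappa>\<^sup>2 * (norm (S t))\<^sup>2 \<le> \<kappa>\<^sup>2 * 1\<^sup>2"
      using S_le[of t] by (intro mult_left_mono power_mono) auto
    then have "cos \<alpha> \<le> X t \<bullet> e" using kap(4) unfolding X_e power_one by linarith
    then show ?thesis by (simp add: cap_iff norm_X)
  qed
  \<comment> \<open>The formula for \<open>X\<close> in terms of \<open>S\<close> inverts the chart
    \<open>flat\<close>.\<close>
  have X_flat: "X t = z" if t: "S t = flat z" and z: "z \<in> cap e \<alpha>" for t z
  proof -
    have p: "0 < 1 + z \<bullet> e" using cap_D[OF z] cos_\<alpha> by simp
    have n: "1 - \<kappa>\<^sup>2 * (norm (flat z))\<^sup>2 = (1 + z \<bullet> e) / 2"
      using norm_flat_sq[OF z] by simp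
    define P where "P = sqrt (2 * (1 + z \<bullet> e))"
    have "P > 0" using p by (simp add: P_def)
    have "c t = P / 2"
      unfolding c_def t n P_def using p by (intro real_sqrt_unique) (auto simp: power_divide)
    then have "2 * \<kappa> * c t * (1 / (\<kappa> * P)) = 1" using \<open>P > 0\<close> kap(1) by simp
    then have "(2 * \<kappa> * c t) *\<^sub>R flat z = z - (z \<bullet> e) *\<^sub>R e"
      unfolding flat_def P_def[symmetric] scaleR_scaleR by (simp only: scaleR_one)
    then show ?thesis using norm_flat_sq[OF z] by (simp add: X_def t)
  qed
  have X0: "X 0 = x" by (intro X_flat xy, unfold S_def) (simp add: a_def)
  have XT: "X T = y"
  proof (intro X_flat xy)
    have "S T + (cos T * (u \<bullet> e) + sin T * (w \<bullet> e)) *\<^sub>R e = cos T *\<^sub>R u + sin T *\<^sub>R w"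
      using arg_cong[OF proj_u, of "\<lambda>z. cos T *\<^sub>R z"] arg_cong[OF proj_w, of "\<lambda>z. sin T *\<^sub>R z"]
      unfolding S_def by (simp add: scaleR_add_left scaleR_add_right)
    also have "\<dots> = flat y + (v \<bullet> e) *\<^sub>R e" using v_eq proj_v by simp
    also have "v \<bullet> e = cos T * (u \<bullet> e) + sin T * (w \<bullet> e)"
      by (subst v_eq[symmetric]) (simp add: inner_add_left)
    finally show "S T = flat y" by simp
  qed
  \<comment> \<open>The arc is at most 4 times the chord, and the chord at most
    \<open>12 * hdist x y\<close>: 70 * 4 * 12 = 3360.\<close>
  have "\<bar>g x - g y\<bar> \<le> 70 * real m * M * \<bar>0 - T\<bar>"
    unfolding X0[symmetric] XT[symmetric] by (intro spoly_curve_lipschitz g m M X_cap)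
  also have "\<dots> \<le> 70 * real m * M * (4 * (12 * hdist x y))"
  proof (intro mult_left_mono)
    have "\<bar>0 - T\<bar> \<le> 4 * norm (u - v)" using arccos_inner_le[OF uv] T by (simp add: T_def)
    then show "\<bar>0 - T\<bar> \<le> 4 * (12 * hdist x y)"
      using norm_lift_diff_le[OF xy] by (simp add: u_def v_def)
  qed (use order.trans[OF abs_ge_zero M[OF xy(1)]] in auto)
  finally show ?thesis by simp
qed

end

section \<open>Localized polynomials\<close>

text \<open>The Fejer kernel without normalization: its value at cos t is the square of sin(nt/2) /
  sin(t/2). The recursion is that of 1 - cos(nt) divided by 1 - cos t; the summand 2 arises from 2 -
  2 cos t.\<close>

fun fejer :: "nat \<Rightarrow> real poly" where
  "fejer 0 = 0"
| "fejer (Suc 0) = 1"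
| "fejer (Suc (Suc n)) = [:0, 2:] * fejer (Suc n) - fejer n + [:2:]"

lemma degree_fejer: "degree (fejer n) \<le> n"
proof (induction n rule: fejer.induct)
  case (3 n)
  have "degree ([:0, 2:] * fejer (Suc n)) \<le> Suc (Suc n)"
    using degree_mult_le[of "[:0, 2:]" "fejer (Suc n)"] 3 by simp
  then show ?case using 3 by (auto intro!: degree_add_le degree_diff_le)
qed auto

lemma fejer_cos: "poly (fejer n) (cos t) * (1 - cos t) = 1 - cos (real n * t)"
proof (induction n rule: fejer.induct)
  case (3 n)
  have "cos (real (Suc (Suc n)) * t) + cos (real n * t) = 2 * cos t * cos (real (Suc n) * t)"
    using cos_add[of "real (Suc n) * t" t] cos_diff[of "real (Suc n) * t" t]
    by (simp add: algebra_simps)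
  moreover have "poly (fejer (Suc (Suc n))) (cos t) * (1 - cos t) =
      2 * cos t * (poly (fejer (Suc n)) (cos t) * (1 - cos t))
      - poly (fejer n) (cos t) * (1 - cos t) + 2 * (1 - cos t)"
    by (simp add: algebra_simps)
  ultimately show ?case unfolding 3 by (simp add: algebra_simps)
qed auto

lemma fejer_1: "poly (fejer n) 1 = (real n)\<^sup>2"
  by (induction n rule: fejer.induct) (auto simp: power2_eq_square algebra_simps)

lemma abs_sin_mult_le: "\<bar>sin (real n * u)\<bar> \<le> real n * \<bar>sin u\<bar>"
proof (induction n)
  case (Suc n)
  have "sin (real (Suc n) * u) = sin (real n * u) * cos u + cos (real n * u) * sin u"
    using sin_add[of "real n * u" u] by (simp add: distrib_right add.commute)
  also have "\<bar>\<dots>\<bar> \<le> \<bar>sin (real n * u)\<bar> * \<bar>cos u\<bar> + \<bar>cos (real n * u)\<bar> * \<bar>sin u\<bar>"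
    by (rule order.trans[OF abs_triangle_ineq]) (simp add: abs_mult)
  also have "\<dots> \<le> (real n * \<bar>sin u\<bar>) * 1 + 1 * \<bar>sin u\<bar>"
    using Suc by (intro add_mono mult_mono) auto
  finally show ?case by (simp add: algebra_simps)
qed simp

lemma fejer_bounds:
  assumes "-1 \<le> a" "a \<le> 1"
  shows "0 \<le> poly (fejer n) a" "poly (fejer n) a \<le> (real n)\<^sup>2" "(1 - a) * poly (fejer n) a \<le> 2"
proof -
  define t where "t = arccos a"
  have a: "a = cos t" using assms by (simp add: t_def)
  have 1: "poly (fejer n) a * (1 - a) = 1 - cos (real n * t)" unfolding a by (rule fejer_cos)
  then show "(1 - a) * poly (fejer n) a \<le> 2"
    using cos_ge_minus_one[of "real n * t"] by (simp add: mult.commute)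
  show "0 \<le> poly (fejer n) a" "poly (fejer n) a \<le> (real n)\<^sup>2"
  proof -
    have half: "1 - cos s = 2 * (sin (s/2))\<^sup>2" for s :: real using cos_double_sin[of "s/2"] by simp
    have "\<bar>sin (real n * (t/2))\<bar>\<^sup>2 \<le> (real n * \<bar>sin (t/2)\<bar>)\<^sup>2"
      by (intro power_mono abs_sin_mult_le) auto
    then have "1 - cos (real n * t) \<le> (real n)\<^sup>2 * (1 - a)"
      unfolding half a by (simp add: power_mult_distrib)
    then have 2: "poly (fejer n) a * (1 - a) \<le> (real n)\<^sup>2 * (1 - a)" using 1 by simp
    have "0 \<le> poly (fejer n) a \<and> poly (fejer n) a \<le> (real n)\<^sup>2"
    proof (cases "a = 1")
      case False
      then have p: "0 < 1 - a" using assms by simp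
      have "0 \<le> poly (fejer n) a * (1 - a)" unfolding 1 by simp
      then show ?thesis using p 2 by (simp add: zero_le_mult_iff)
    qed (simp add: fejer_1)
    then show "0 \<le> poly (fejer n) a" "poly (fejer n) a \<le> (real n)\<^sup>2" by auto
  qed
qed

definition fejer_power :: "nat \<Rightarrow> nat \<Rightarrow> real poly" where
  "fejer_power n N = smult (1 / (real n) ^ (2 * N)) (fejer n ^ N)"

lemma degree_fejer_power: "degree (fejer_power n N) \<le> n * N"
proof -
  have "degree (fejer_power n N) \<le> degree (fejer n ^ N)"
    unfolding fejer_power_def by (rule degree_smult_le)
  also have "\<dots> \<le> degree (fejer n) * N" by (rule degree_power_le)
  also have "\<dots> \<le> n * N" using degree_fejer by simp
  finally show ?thesis .
qed

lemma poly_fejer_power: "poly (fejer_power n N) a = (poly (fejer n) a / (real n)\<^sup>2) ^ N"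
  by (simp add: fejer_power_def power_divide power_mult)

lemma fejer_power_1: "n \<ge> 1 \<Longrightarrow> poly (fejer_power n N) 1 = 1"
  by (simp add: poly_fejer_power fejer_1)

text \<open>\<open>\<Delta>\<close> will be a chordal distance between points of a unit sphere. The
  bounds \<open>F \<le> 1\<close> and \<open>(1 - a) * poly (fejer n) a \<le> 2\<close> give
  \<open>F * (1 + n * \<Delta>)\<^sup>2 \<le> 2 + 8\<close>; of this quadratic decay only the first
  power is kept.\<close>

lemma fejer_power_bounds:
  assumes n: "n \<ge> 1" and a: "-1 \<le> a" "a \<le> 1" and \<Delta>: "0 \<le> \<Delta>" "\<Delta>\<^sup>2 \<le> 2 - 2 * a"
  shows "0 \<le> poly (fejer_power n N) a" "poly (fejer_power n N) a \<le> 10 ^ N / (1 + real n * \<Delta>) ^ N"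
proof -
  define F where "F = poly (fejer n) a / (real n)\<^sup>2"
  note b = fejer_bounds[OF a, of n]
  have F: "0 \<le> F" "F \<le> 1" using b n by (auto simp: F_def)
  show "0 \<le> poly (fejer_power n N) a" using F by (simp add: poly_fejer_power F_def)
  have p: "1 \<le> 1 + real n * \<Delta>" using \<Delta> by simp
  have "F * (1 + real n * \<Delta>) \<le> F * (1 + real n * \<Delta>)\<^sup>2"
    using F p by (intro mult_left_mono self_le_power) auto
  also have "(1 + real n * \<Delta>)\<^sup>2 \<le> 2 + 2 * (real n)\<^sup>2 * \<Delta>\<^sup>2"
    using sum_squares_bound[of 1 "real n * \<Delta>"] by (simp add: power2_eq_square algebra_simps)
  also have "F * (2 + 2 * (real n)\<^sup>2 * \<Delta>\<^sup>2) \<le> F * (2 + 2 * (real n)\<^sup>2 * (2 - 2 * a))"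
    using F \<Delta> by (intro mult_left_mono add_left_mono) auto
  also have "\<dots> = 2 * F + 4 * ((1 - a) * poly (fejer n) a)"
    using n by (simp add: F_def field_simps)
  also have "\<dots> \<le> 10" using F b(3) by linarith
  finally have "F * (1 + real n * \<Delta>) \<le> 10" using F(1) by (simp add: mult_left_mono)
  then have "F \<le> 10 / (1 + real n * \<Delta>)" using p by (simp add: field_simps)
  then have "F ^ N \<le> (10 / (1 + real n * \<Delta>)) ^ N" using F by (intro power_mono) auto
  then show "poly (fejer_power n N) a \<le> 10 ^ N / (1 + real n * \<Delta>) ^ N"
    by (simp add: poly_fejer_power F_def power_divide)
qed

text \<open>Power sums of the two numbers \<open>A x + b\<close> and \<open>A x - b\<close> with
  \<open>b\<^sup>2 = C x\<close>, generated by the recursion for numbers with sum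
  \<open>2 * A x\<close> and product \<open>A x ^ 2 - C x\<close>. They are polynomial in
  \<open>x\<close> although \<open>b\<close> need not be.\<close>

fun even_part :: "(real ^ 'n \<Rightarrow> real) \<Rightarrow> (real ^ 'n \<Rightarrow> real) \<Rightarrow> nat \<Rightarrow> real ^ 'n \<Rightarrow> real" where
  "even_part A C 0 = (\<lambda>x. 2)"
| "even_part A C (Suc 0) = (\<lambda>x. 2 * A x)"
| "even_part A C (Suc (Suc k)) =
    (\<lambda>x. 2 * A x * even_part A C (Suc k) x - (A x ^ 2 - C x) * even_part A C k x)"

lemma spoly_even_part:
  assumes "spoly 1 A" "spoly 2 C"
  shows "spoly k (even_part A C k)"
proof (induction k rule: fejer.induct)
  case (3 k)
  have "spoly 2 (\<lambda>x. A x ^ 2)" using spoly_power[OF assms(1), of 2] by (simp only: mult_1)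
  then have "spoly (2 + k) (\<lambda>x. (A x ^ 2 - C x) * even_part A C k x)"
    by (intro spoly_mult spoly_diff assms 3)
  moreover have "spoly (1 + Suc k) (\<lambda>x. 2 * A x * even_part A C (Suc k) x)"
    by (intro spoly_mult spoly_scale assms 3)
  ultimately have "spoly (2 + k) (\<lambda>x. 2 * A x * even_part A C (Suc k) x - (A x ^ 2 - C x) * even_part A C k x)"
    by (intro spoly_diff) simp_all
  then show ?case by simp
qed (use assms in \<open>auto intro: spoly.const spoly_scale\<close>)

lemma even_part_eq: "b\<^sup>2 = C x \<Longrightarrow> even_part A C k x = (A x + b) ^ k + (A x - b) ^ k"
proof (induction k rule: fejer.induct)
  case (3 k)
  have "even_part A C (Suc (Suc k)) x = 2 * A x * ((A x + b) ^ Suc k + (A x - b) ^ Suc k)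
      - (A x ^ 2 - b\<^sup>2) * ((A x + b) ^ k + (A x - b) ^ k)"
    using 3 by simp
  also have "\<dots> = (A x + b) ^ Suc (Suc k) + (A x - b) ^ Suc (Suc k)"
    by (simp add: power2_eq_square algebra_simps)
  finally show ?case .
qed auto

text \<open>Adding both signs of the square root \<open>b\<close> leaves even powers of
  \<open>b\<close> only; as \<open>C\<close> has degree 2 where \<open>A\<close> has degree 1, the
  degree does not grow.\<close>

lemma spoly_symmetrized:
  assumes "spoly 1 A" "spoly 2 C" "degree p \<le> m"
  obtains g where "spoly m g" "\<And>x b. b\<^sup>2 = C x \<Longrightarrow> g x = poly p (A x + b) + poly p (A x - b)"
proof
  let ?g = "\<lambda>x. \<Sum>k\<le>degree p. coeff p k * even_part A C k x"
  show "spoly m ?g"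
    using assms by (intro spoly_sum spoly_scale spoly_mono[OF spoly_even_part]) auto
  show "?g x = poly p (A x + b) + poly p (A x - b)" if "b\<^sup>2 = C x" for x b
    using that by (simp add: even_part_eq poly_altdef distrib_left sum.distrib)
qed

section \<open>The localized polynomial on the cap\<close>

context spherical_cap
begin

lemma sin_\<alpha>: "0 < sin \<alpha>" "sin \<alpha> \<le> \<alpha>"
  using \<alpha> \<alpha>_pi sin_x_le_x[of \<alpha>] by (auto intro!: sin_gt_zero)

text \<open>A second chart, in which polynomials of the chart coordinates are spherical polynomials.\<close>

definition "disc x = (1 / sin \<alpha>) *\<^sub>R (x - (x \<bullet> e) *\<^sub>R e)"

definition "rise x = sqrt (1 - (norm (disc x))\<^sup>2)"

lemma disc_e: "disc x \<bullet> e = 0"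
  using e by (simp add: disc_def inner_diff_left dot_square_norm)

lemma height_disc:
  assumes "norm x = 1"
  shows "1 - (norm (disc x))\<^sup>2 = ((x \<bullet> e)\<^sup>2 - (cos \<alpha>)\<^sup>2) / (sin \<alpha>)\<^sup>2"
proof -
  have "(norm (disc x))\<^sup>2 = (1 - (x \<bullet> e)\<^sup>2) / (sin \<alpha>)\<^sup>2"
    using norm_sub_proj_sq[OF assms e] sin_\<alpha> by (simp add: disc_def power_divide)
  moreover have "1 = (1 - (cos \<alpha>)\<^sup>2) / (sin \<alpha>)\<^sup>2"
    using sin_\<alpha>(1) unfolding sin_squared_eq[symmetric] by simp
  ultimately show ?thesis by (simp add: diff_divide_distrib)
qed

text \<open>\<open>height\<close> and the square of \<open>rise\<close> differ by the factor
  \<open>x \<bullet> e + cos \<alpha>\<close> and a constant. This factor lies between 3/2 and 2, so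
  both vanish in the same way at the boundary.\<close>

lemma rise:
  assumes "x \<in> cap e \<alpha>"
  shows "0 \<le> rise x" "(rise x)\<^sup>2 = 1 - (norm (disc x))\<^sup>2"
    "sqrt (height x) = sin \<alpha> * rise x / sqrt (x \<bullet> e + cos \<alpha>)"
proof -
  note x = cap_D[OF assms]
  have h: "1 - (norm (disc x))\<^sup>2 = height x * (x \<bullet> e + cos \<alpha>) / (sin \<alpha>)\<^sup>2"
    unfolding height_disc[OF x(1)] height_def by (simp add: power2_eq_square algebra_simps)
  have p: "0 < x \<bullet> e + cos \<alpha>" using x cos_\<alpha> by simp
  have nn: "0 \<le> 1 - (norm (disc x))\<^sup>2" unfolding h using x p by simp
  show "0 \<le> rise x" "(rise x)\<^sup>2 = 1 - (norm (disc x))\<^sup>2" using nn by (auto simp: rise_def)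
  have "rise x = sqrt (height x) * sqrt (x \<bullet> e + cos \<alpha>) / sin \<alpha>"
    unfolding rise_def h using sin_\<alpha> by (simp add: real_sqrt_mult real_sqrt_divide)
  then show "sqrt (height x) = sin \<alpha> * rise x / sqrt (x \<bullet> e + cos \<alpha>)"
    using p sin_\<alpha> by simp
qed

text \<open>On the unit sphere the coordinate along \<open>e\<close> is determined up to sign by the
  projection, and stably so here, since on the cap it is at least 3/4.\<close>

lemma inner_e_diff_le:
  assumes "x \<in> cap e \<alpha>" "z \<in> cap e \<alpha>"
  shows "\<bar>x \<bullet> e - z \<bullet> e\<bar> \<le> 2 * \<alpha> * norm (disc x - disc z)"
    "norm (x - z) \<le> 3 * \<alpha> * norm (disc x - disc z)"
proof -
  define Q where "Q x = x - (x \<bullet> e) *\<^sub>R e" for x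
  note x = cap_D[OF assms(1)] and z = cap_D[OF assms(2)]
  have Q: "(norm (Q y))\<^sup>2 = 1 - (y \<bullet> e)\<^sup>2" "norm (Q y) \<le> 1" if "norm y = 1" for y
  proof -
    show 1: "(norm (Q y))\<^sup>2 = 1 - (y \<bullet> e)\<^sup>2" using norm_sub_proj_sq[OF that e] by (simp add: Q_def)
    then have "(norm (Q y))\<^sup>2 \<le> 1\<^sup>2" by simp
    then show "norm (Q y) \<le> 1" by (rule power2_le_imp_le) simp
  qed
  have "Q x - Q z = sin \<alpha> *\<^sub>R (disc x - disc z)" using sin_\<alpha> by (simp add: Q_def disc_def algebra_simps)
  then have "norm (Q x - Q z) = sin \<alpha> * norm (disc x - disc z)" using sin_\<alpha> by simp
  also have "\<dots> \<le> \<alpha> * norm (disc x - disc z)" using sin_\<alpha> by (intro mult_right_mono) auto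
  finally have Qd: "norm (Q x - Q z) \<le> \<alpha> * norm (disc x - disc z)" .
  have "\<bar>x \<bullet> e - z \<bullet> e\<bar> * 1 \<le> \<bar>x \<bullet> e - z \<bullet> e\<bar> * (x \<bullet> e + z \<bullet> e)"
    using x z cos_\<alpha> by (intro mult_left_mono) auto
  also have "\<dots> = \<bar>(norm (Q z))\<^sup>2 - (norm (Q x))\<^sup>2\<bar>"
  proof -
    have "0 \<le> x \<bullet> e + z \<bullet> e" using x z cos_\<alpha> by simp
    then have "\<bar>x \<bullet> e - z \<bullet> e\<bar> * (x \<bullet> e + z \<bullet> e) = \<bar>(x \<bullet> e - z \<bullet> e) * (x \<bullet> e + z \<bullet> e)\<bar>"
      by (simp add: abs_mult)
    also have "(x \<bullet> e - z \<bullet> e) * (x \<bullet> e + z \<bullet> e) = (norm (Q z))\<^sup>2 - (norm (Q x))\<^sup>2"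
      using Q x z by (simp add: power2_eq_square algebra_simps)
    finally show ?thesis .
  qed
  also have "\<dots> = \<bar>norm (Q z) - norm (Q x)\<bar> * (norm (Q z) + norm (Q x))"
  proof -
    have "(norm (Q z))\<^sup>2 - (norm (Q x))\<^sup>2 = (norm (Q z) - norm (Q x)) * (norm (Q z) + norm (Q x))"
      by (simp add: power2_eq_square algebra_simps)
    then show ?thesis by (simp add: abs_mult)
  qed
  also have "\<dots> \<le> (\<alpha> * norm (disc x - disc z)) * (1 + 1)"
  proof (intro mult_mono add_mono Q x z)
    show "\<bar>norm (Q z) - norm (Q x)\<bar> \<le> \<alpha> * norm (disc x - disc z)"
      using norm_triangle_ineq3[of "Q z" "Q x"] Qd by (simp add: norm_minus_commute)
  qed (use \<alpha> in auto)
  finally show 1: "\<bar>x \<bullet> e - z \<bullet> e\<bar> \<le> 2 * \<alpha> * norm (disc x - disc z)" by simp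
  have "x - z = (Q x - Q z) + (x \<bullet> e - z \<bullet> e) *\<^sub>R e" by (simp add: Q_def algebra_simps)
  also have "norm \<dots> \<le> norm (Q x - Q z) + \<bar>x \<bullet> e - z \<bullet> e\<bar>"
    by (rule order.trans[OF norm_triangle_ineq]) (use e in simp)
  finally show "norm (x - z) \<le> 3 * \<alpha> * norm (disc x - disc z)" using 1 Qd by simp
qed

text \<open>\<open>\<Delta>\<close> is the chordal distance of points lifted to a hemisphere over
  the chart \<open>disc\<close>. The last bound is the direction needed for decay: points far apart
  in \<open>hdist\<close> are far apart after lifting.\<close>

lemma disc_lift_hdist:
  assumes "x \<in> cap e \<alpha>" "z \<in> cap e \<alpha>"
  defines "\<Delta> \<equiv> norm ((disc x + rise x *\<^sub>R e) - (disc z + rise z *\<^sub>R e))"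
  shows "\<Delta>\<^sup>2 = 2 - 2 * (disc x \<bullet> disc z + rise x * rise z)"
    "\<bar>disc x \<bullet> disc z\<bar> + rise x * rise z \<le> 1" "hdist x z \<le> 7 * \<Delta>"
proof -
  note x = cap_D[OF assms(1)] and z = cap_D[OF assms(2)]
  note rx = rise[OF assms(1)] and rz = rise[OF assms(2)]
  have T: "(disc x + rise x *\<^sub>R e) - (disc z + rise z *\<^sub>R e) = (disc x - disc z) + (rise x - rise z) *\<^sub>R e"
    by (simp add: algebra_simps)
  have \<Delta>2: "\<Delta>\<^sup>2 = (norm (disc x - disc z))\<^sup>2 + (rise x - rise z)\<^sup>2"
    unfolding \<Delta>_def T
    using norm_add_Pythagorean[of "disc x - disc z" "(rise x - rise z) *\<^sub>R e"] e
    by (simp add: orthogonal_def inner_diff_left disc_e)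
  also have "(norm (disc x - disc z))\<^sup>2 = (norm (disc x))\<^sup>2 + (norm (disc z))\<^sup>2 - 2 * (disc x \<bullet> disc z)"
    using dot_norm_neg[of "disc x" "disc z"] by simp
  finally show "\<Delta>\<^sup>2 = 2 - 2 * (disc x \<bullet> disc z + rise x * rise z)"
    using rx(2) rz(2) by (simp add: power2_diff)
  have "\<bar>disc x \<bullet> disc z\<bar> \<le> norm (disc x) * norm (disc z)" by (rule Cauchy_Schwarz_ineq2)
  moreover have "2 * (norm (disc x) * norm (disc z)) \<le> (norm (disc x))\<^sup>2 + (norm (disc z))\<^sup>2"
    using sum_squares_bound[of "norm (disc x)" "norm (disc z)"] by (simp add: mult.assoc)
  moreover have "2 * (rise x * rise z) \<le> (rise x)\<^sup>2 + (rise z)\<^sup>2"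
    using sum_squares_bound[of "rise x" "rise z"] by (simp add: mult.assoc)
  ultimately show "\<bar>disc x \<bullet> disc z\<bar> + rise x * rise z \<le> 1" using rx(2) rz(2) by linarith
  have "(norm (disc x - disc z))\<^sup>2 \<le> \<Delta>\<^sup>2" "\<bar>rise x - rise z\<bar>\<^sup>2 \<le> \<Delta>\<^sup>2" using \<Delta>2 by auto
  then have d: "norm (disc x - disc z) \<le> \<Delta>" "\<bar>rise x - rise z\<bar> \<le> \<Delta>"
    by (auto intro: power2_le_imp_le simp: \<Delta>_def)
  have \<Delta>0: "0 \<le> \<Delta>" by (simp add: \<Delta>_def)
  define D where "D y = sqrt (y \<bullet> e + cos \<alpha>)" for y
  have D1: "1 \<le> D x" "1 \<le> D z" using x z cos_\<alpha> by (auto simp: D_def)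
  have "\<bar>D x - D z\<bar> \<le> \<bar>(x \<bullet> e + cos \<alpha>) - (z \<bullet> e + cos \<alpha>)\<bar> / 1"
    unfolding D_def
  proof (intro abs_sqrt_diff_le)
    show "1 \<le> sqrt (x \<bullet> e + cos \<alpha>) + sqrt (z \<bullet> e + cos \<alpha>)" using D1 unfolding D_def by linarith
  qed (use x z cos_\<alpha> in auto)
  then have "\<bar>D x - D z\<bar> \<le> 2 * \<alpha> * norm (disc x - disc z)"
    using inner_e_diff_le(1)[OF assms(1,2)] by simp
  also have "\<dots> \<le> 1 * \<Delta>" using \<alpha> d by (intro mult_mono) auto
  finally have DD: "\<bar>D x - D z\<bar> \<le> \<Delta>" by simp
  have inv: "\<bar>1 / D x - 1 / D z\<bar> \<le> \<Delta>"
  proof -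
    have "1 / D x - 1 / D z = (D z - D x) / (D x * D z)"
      using D1 by (simp add: field_simps)
    then have "\<bar>1 / D x - 1 / D z\<bar> = \<bar>D x - D z\<bar> / (D x * D z)"
      using D1 by (simp add: abs_minus_commute)
    also have "\<dots> \<le> \<bar>D x - D z\<bar> / 1"
      using D1 mult_mono[of 1 "D x" 1 "D z"] by (intro divide_left_mono) auto
    finally show ?thesis using DD by simp
  qed
  have "(rise z)\<^sup>2 \<le> 1\<^sup>2" using rz(2) by simp
  then have rz1: "rise z \<le> 1" by (rule power2_le_imp_le) simp
  have "sqrt (height x) - sqrt (height z) =
      sin \<alpha> * ((rise x - rise z) * (1 / D x) + rise z * (1 / D x - 1 / D z))"
    unfolding rx(3) rz(3) D_def[symmetric] by (simp add: algebra_simps)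
  also have "\<bar>\<dots>\<bar> \<le> sin \<alpha> * (\<bar>rise x - rise z\<bar> * \<bar>1 / D x\<bar> + \<bar>rise z\<bar> * \<bar>1 / D x - 1 / D z\<bar>)"
    using sin_\<alpha> unfolding abs_mult
    by (intro mult_mono order.trans[OF abs_triangle_ineq]) (auto simp: abs_mult)
  also have "\<dots> \<le> \<alpha> * (\<Delta> * 1 + 1 * \<Delta>)"
    using sin_\<alpha> d inv rz(1) rz1 D1 \<Delta>0 \<alpha>(1) by (intro mult_mono add_mono) auto
  finally have h: "\<bar>sqrt (height x) - sqrt (height z)\<bar> \<le> \<alpha> * (2 * \<Delta>)" by simp
  have "norm (x - z) \<le> 3 * \<alpha> * \<Delta>"
    by (rule order.trans[OF inner_e_diff_le(2)[OF assms(1,2)]]) (use d \<alpha> in simp)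
  then have "norm (x - z) + \<bar>sqrt (height x) - sqrt (height z)\<bar> \<le> \<alpha> * (5 * \<Delta>)"
    using h by (simp add: algebra_simps)
  also have "\<dots> \<le> \<alpha> * (7 * \<Delta>)" using \<alpha> \<Delta>0 by (intro mult_left_mono) auto
  finally show "hdist x z \<le> 7 * \<Delta>" using \<alpha> by (simp add: hdist_def field_simps)
qed

lemma hdist_nonneg: "0 \<le> hdist x y"
  using \<alpha> by (simp add: hdist_def)

text \<open>The kernel is evaluated at the inner product of the lifted points over \<open>x\<close>
  and \<open>z\<close>. As \<open>rise z\<close> is a square root, the value for the mirror image of
  the lifted \<open>z\<close> in the hyperplane is added, which leaves a polynomial in
  \<open>z\<close>. At \<open>z = x\<close> the first term is 1 and the second nonnegative. The
  factor 70 is the 10 of the kernel times the 7 of \<open>disc_lift_hdist\<close>.\<close>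

lemma localized_spoly:
  assumes x: "x \<in> cap e \<alpha>" and n: "n \<ge> 1"
  obtains Q where "spoly (n * N) Q" "1 \<le> Q x"
    "\<And>z. z \<in> cap e \<alpha> \<Longrightarrow> \<bar>Q z\<bar> \<le> 2 * 70 ^ N / (1 + real n * hdist x z) ^ N"
proof -
  define A where "A z = ((1 / sin \<alpha>) *\<^sub>R disc x) \<bullet> z" for z
  define C where "C z = ((rise x)\<^sup>2 / (sin \<alpha>)\<^sup>2) * ((e \<bullet> z) ^ 2 - (cos \<alpha>)\<^sup>2)" for z
  have A: "spoly 1 A" unfolding A_def by (rule spoly_inner)
  have "spoly 2 (\<lambda>z. (e \<bullet> z) ^ 2)" using spoly_power[OF spoly_inner, of 2 e] by simp
  then have C: "spoly 2 C" unfolding C_def by (intro spoly_scale spoly_diff spoly.const)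
  obtain Q where Q: "spoly (n * N) Q"
    "\<And>z b. b\<^sup>2 = C z \<Longrightarrow> Q z = poly (fejer_power n N) (A z + b) + poly (fejer_power n N) (A z - b)"
    using spoly_symmetrized[OF A C degree_fejer_power] by blast
  have Aeq: "A z = disc x \<bullet> disc z" for z
    using disc_e[of x] by (simp add: A_def disc_def[of z] inner_diff_right)
  have Qeq: "Q z = poly (fejer_power n N) (disc x \<bullet> disc z + rise x * rise z)
      + poly (fejer_power n N) (disc x \<bullet> disc z - rise x * rise z)" if "z \<in> cap e \<alpha>" for z
  proof -
    have "(rise x * rise z)\<^sup>2 = C z"
      using rise(2)[OF that] height_disc[OF cap_D(1)[OF that]]
      by (simp add: C_def power_mult_distrib inner_commute)
    from Q(2)[OF this] show ?thesis by (simp add: Aeq)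
  qed
  \<comment> \<open>Since both values of \<open>rise\<close> are nonnegative, the mirror image is no
    closer to the lifted \<open>x\<close>, so the bound for \<open>s = 1\<close> serves for
    \<open>s = -1\<close> as well.\<close>
  have bd: "0 \<le> poly (fejer_power n N) (disc x \<bullet> disc z + s * (rise x * rise z))"
    "poly (fejer_power n N) (disc x \<bullet> disc z + s * (rise x * rise z)) \<le>
       70 ^ N / (1 + real n * hdist x z) ^ N"
    if z: "z \<in> cap e \<alpha>" and s: "s = 1 \<or> s = -1" for z s
  proof -
    define \<Delta> where "\<Delta> = norm ((disc x + rise x *\<^sub>R e) - (disc z + rise z *\<^sub>R e))"
    note d = disc_lift_hdist[OF x z, folded \<Delta>_def]
    have r: "0 \<le> rise x * rise z" using rise(1) x z by simp
    have \<Delta>0: "0 \<le> \<Delta>" by (simp add: \<Delta>_def)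
    have b: "-1 \<le> disc x \<bullet> disc z + s * (rise x * rise z)" "disc x \<bullet> disc z + s * (rise x * rise z) \<le> 1"
      "\<Delta>\<^sup>2 \<le> 2 - 2 * (disc x \<bullet> disc z + s * (rise x * rise z))"
      using d(1,2) r s by auto
    note f = fejer_power_bounds[OF n b(1,2) \<Delta>0 b(3)]
    show "0 \<le> poly (fejer_power n N) (disc x \<bullet> disc z + s * (rise x * rise z))" by (rule f)
    have R0: "0 \<le> hdist x z" by (rule hdist_nonneg)
    have "1 + real n * hdist x z \<le> 7 * (1 + real n * \<Delta>)"
      using mult_left_mono[OF d(3), of "real n"] by (simp add: algebra_simps)
    then have "10 / (1 + real n * \<Delta>) \<le> 70 / (1 + real n * hdist x z)"
      using \<Delta>0 R0 by (simp add: divide_simps add_pos_nonneg)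
    then have "(10 / (1 + real n * \<Delta>)) ^ N \<le> (70 / (1 + real n * hdist x z)) ^ N"
      using \<Delta>0 by (intro power_mono) auto
    then show "poly (fejer_power n N) (disc x \<bullet> disc z + s * (rise x * rise z)) \<le>
        70 ^ N / (1 + real n * hdist x z) ^ N"
      using f(2)[of N] by (simp add: power_divide)
  qed
  show ?thesis
  proof
    show "spoly (n * N) Q" by (rule Q)
    have "disc x \<bullet> disc x + rise x * rise x = 1"
      using rise(2)[OF x] by (simp add: dot_square_norm power2_eq_square)
    then show "1 \<le> Q x" using bd(1)[OF x, of "-1"] n by (simp add: Qeq[OF x] fejer_power_1)
    fix z assume z: "z \<in> cap e \<alpha>"
    show "\<bar>Q z\<bar> \<le> 2 * 70 ^ N / (1 + real n * hdist x z) ^ N"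
      using bd[OF z, of 1] bd[OF z, of "-1"] by (simp add: Qeq[OF z])
  qed
qed

text \<open>\<open>Q\<close> cancels the growth allowed for \<open>f\<close>, so \<open>f Q\<close>
  and \<open>Q\<close> are bounded on the cap and have degree at most \<open>n * (N + 1)\<close>.
  The increment of \<open>f\<close> times \<open>Q x\<close> is the increment of \<open>f Q\<close>
  minus \<open>f y\<close> times that of \<open>Q\<close>, and \<open>1 \<le> Q x\<close> removes
  the factor again.\<close>

lemma spoly_local_lipschitz:
  assumes f: "spoly n f" and n: "n \<ge> 1" and xy: "x \<in> cap e \<alpha>" "y \<in> cap e \<alpha>"
    and near: "real n * hdist x y \<le> 4"
    and S: "\<And>z. z \<in> cap e \<alpha> \<Longrightarrow> \<bar>f z\<bar> \<le> S * (1 + real n * hdist x z) ^ N"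
  shows "\<bar>f x - f y\<bar> \<le> 6720 * (real N + 1) * 70 ^ N * (1 + 5 ^ N) * (real n * hdist x y) * S"
proof -
  let ?R = "hdist"
  obtain Q where Q: "spoly (n * N) Q" "1 \<le> Q x"
    and Qb: "\<And>z. z \<in> cap e \<alpha> \<Longrightarrow> \<bar>Q z\<bar> \<le> 2 * 70 ^ N / (1 + real n * ?R x z) ^ N"
    using localized_spoly[OF xy(1) n, of N] by blast
  have p1: "1 \<le> 1 + real n * ?R x z" for z using hdist_nonneg by simp
  then have pN: "1 \<le> (1 + real n * ?R x z) ^ N" for z by (rule one_le_power)
  have m: "n * (N + 1) \<ge> 1" using n by simp
  have S0: "0 \<le> S" using order.trans[OF abs_ge_zero S[OF xy(1)]] pN[of x] by (simp add: zero_le_mult_iff)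
  have fQ: "\<bar>f z * Q z\<bar> \<le> 2 * 70 ^ N * S" if z: "z \<in> cap e \<alpha>" for z
  proof -
    have "\<bar>f z * Q z\<bar> \<le> (S * (1 + real n * ?R x z) ^ N) * (2 * 70 ^ N / (1 + real n * ?R x z) ^ N)"
      unfolding abs_mult using S[OF z] Qb[OF z] pN[of z] S0 by (intro mult_mono) auto
    moreover have "(1 + real n * ?R x z) ^ N \<noteq> 0" using pN[of z] by linarith
    moreover have "S * P * (K / P) = K * S" if "P \<noteq> 0" for P K using that by simp
    ultimately show ?thesis by metis
  qed
  have Q1: "\<bar>Q z\<bar> \<le> 2 * 70 ^ N" if z: "z \<in> cap e \<alpha>" for z
  proof -
    have "2 * 70 ^ N / (1 + real n * ?R x z) ^ N \<le> 2 * 70 ^ N / 1"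
      using pN[of z] by (intro divide_left_mono) auto
    then show ?thesis using Qb[OF z] by simp
  qed
  have sfQ: "spoly (n * (N + 1)) (\<lambda>z. f z * Q z)" using spoly_mult[OF f Q(1)] by (simp add: algebra_simps)
  have sQ: "spoly (n * (N + 1)) Q" by (rule spoly_mono[OF Q(1)]) simp
  note L1 = spoly_cap_lipschitz[OF sfQ m fQ xy] and L2 = spoly_cap_lipschitz[OF sQ m Q1 xy]
  have fy: "\<bar>f y\<bar> \<le> S * 5 ^ N"
  proof -
    have "(1 + real n * ?R x y) ^ N \<le> 5 ^ N" using near p1[of y] by (intro power_mono) auto
    then show ?thesis using S[OF xy(2)] mult_left_mono[OF _ S0] by (meson order_trans)
  qed
  have "\<bar>f x - f y\<bar> \<le> Q x * \<bar>f x - f y\<bar>" using Q(2) mult_right_mono[of 1 "Q x" "\<bar>f x - f y\<bar>"] by simp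
  also have "\<dots> = \<bar>(f x * Q x - f y * Q y) - f y * (Q x - Q y)\<bar>"
  proof -
    have "Q x * \<bar>f x - f y\<bar> = \<bar>Q x * (f x - f y)\<bar>" using Q(2) by (simp add: abs_mult)
    also have "Q x * (f x - f y) = (f x * Q x - f y * Q y) - f y * (Q x - Q y)"
      by (simp add: algebra_simps)
    finally show ?thesis .
  qed
  also have "\<dots> \<le> \<bar>f x * Q x - f y * Q y\<bar> + \<bar>f y\<bar> * \<bar>Q x - Q y\<bar>"
    by (rule order.trans[OF abs_triangle_ineq4]) (simp add: abs_mult)
  also have "\<dots> \<le> 3360 * real (n * (N + 1)) * (2 * 70 ^ N * S) * ?R x y
      + (S * 5 ^ N) * (3360 * real (n * (N + 1)) * (2 * 70 ^ N) * ?R x y)"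
    using fy L1 L2 S0 by (intro add_mono mult_mono) auto
  also have "\<dots> = 6720 * (real N + 1) * 70 ^ N * (1 + 5 ^ N) * (real n * ?R x y) * S"
    by (simp add: algebra_simps)
  finally show ?thesis .
qed

end

section \<open>The metric of the cap\<close>

text \<open>Splitting \<open>x\<close> and \<open>z\<close> along \<open>y\<close> gives
  \<open>x \<bullet> z = cos a * cos b + ?p \<bullet> ?q\<close> with components of norm
  \<open>sin a\<close> and \<open>sin b\<close>; Cauchy-Schwarz yields
  \<open>cos (a + b) \<le> x \<bullet> z\<close>. Beyond pi nothing is to be shown.\<close>

lemma arccos_inner_triangle:
  fixes x y z :: "'a :: real_inner"
  assumes "norm x = 1" "norm y = 1" "norm z = 1"
  shows "arccos (x \<bullet> z) \<le> arccos (x \<bullet> y) + arccos (y \<bullet> z)"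
proof -
  define a where "a = arccos (x \<bullet> y)"
  define b where "b = arccos (z \<bullet> y)"
  have ab: "0 \<le> a" "0 \<le> b" "cos a = x \<bullet> y" "cos b = z \<bullet> y"
      "sin a = sqrt (1 - (x \<bullet> y)\<^sup>2)" "sin b = sqrt (1 - (z \<bullet> y)\<^sup>2)"
    using abs_inner_le_1[of x y] abs_inner_le_1[of z y] assms
    by (auto simp: a_def b_def arccos_lbound abs_le_iff cos_arccos_abs sin_arccos_abs)
  have xz: "-1 \<le> x \<bullet> z" "x \<bullet> z \<le> 1" using abs_inner_le_1[of x z] assms by auto
  have "arccos (x \<bullet> z) \<le> a + b"
  proof (cases "a + b \<le> pi")
    case True
    let ?p = "x - (x \<bullet> y) *\<^sub>R y" and ?q = "z - (z \<bullet> y) *\<^sub>R y"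
    have n: "norm ?p = sin a" "norm ?q = sin b"
      unfolding ab(5,6)
      using real_sqrt_unique[OF norm_sub_proj_sq[OF assms(1,2)] norm_ge_zero]
        real_sqrt_unique[OF norm_sub_proj_sq[OF assms(3,2)] norm_ge_zero] by simp_all
    have yy: "y \<bullet> y = 1" using assms by (simp add: dot_square_norm)
    have "x \<bullet> z = (x \<bullet> y) * (z \<bullet> y) + ?p \<bullet> ?q"
      by (simp add: inner_diff_left inner_diff_right yy inner_commute[of y z])
    also have "\<dots> \<ge> cos a * cos b - sin a * sin b"
      using Cauchy_Schwarz_ineq2[of ?p ?q] unfolding n ab(3,4) by linarith
    finally have "cos (a + b) \<le> x \<bullet> z" by (simp add: cos_add)
    then have "arccos (x \<bullet> z) \<le> arccos (cos (a + b))" using xz by (intro arccos_le_arccos) auto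
    then show ?thesis using ab True by (simp add: arccos_cos)
  next
    case False
    then show ?thesis using arccos_ubound[OF xz] by simp
  qed
  then show ?thesis by (simp add: a_def b_def inner_commute)
qed

lemma abs_cos_diff_bounds:
  fixes a b :: real
  assumes "0 \<le> a" "0 \<le> b" "a + b \<le> 1"
  shows "\<bar>cos a - cos b\<bar> \<le> \<bar>a - b\<bar> * (a + b) / 2" "\<bar>a - b\<bar> * (a + b) / 8 \<le> \<bar>cos a - cos b\<bar>"
proof -
  let ?s = "(a + b) / 2" and ?t = "\<bar>a - b\<bar> / 2"
  have "\<bar>sin ((b - a) / 2)\<bar> = sin ?t"
  proof -
    have "0 \<le> sin ?t" using assms pi_gt3 by (intro sin_ge_zero) auto
    moreover have "(b - a) / 2 = ?t \<or> (b - a) / 2 = - ?t" by (auto simp: abs_if)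
    ultimately show ?thesis by (metis abs_minus_cancel abs_of_nonneg sin_minus)
  qed
  moreover have "0 \<le> sin ?s" using assms pi_gt3 by (intro sin_ge_zero) auto
  ultimately have eq: "\<bar>cos a - cos b\<bar> = 2 * sin ?s * sin ?t"
    by (simp add: cos_diff_cos abs_mult)
  have s: "sin ?s \<le> ?s" "?s / 2 \<le> sin ?s" using sin_x_le_x[of ?s] half_le_sin[of ?s] assms by auto
  have t: "sin ?t \<le> ?t" "?t / 2 \<le> sin ?t" using sin_x_le_x[of ?t] half_le_sin[of ?t] assms by auto
  have "2 * sin ?s * sin ?t \<le> 2 * ?s * ?t"
    using s t assms \<open>0 \<le> sin ?s\<close> by (intro mult_mono) auto
  also have "\<dots> = \<bar>a - b\<bar> * (a + b) / 2" by (simp add: field_simps)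
  finally show "\<bar>cos a - cos b\<bar> \<le> \<bar>a - b\<bar> * (a + b) / 2" unfolding eq .
  have "\<bar>a - b\<bar> * (a + b) / 8 = 2 * (?s / 2) * (?t / 2)" by (simp add: field_simps)
  also have "\<dots> \<le> 2 * sin ?s * sin ?t"
    using s t assms \<open>0 \<le> sin ?s\<close> by (intro mult_mono) auto
  finally show "\<bar>a - b\<bar> * (a + b) / 8 \<le> \<bar>cos a - cos b\<bar>" unfolding eq .
qed

section \<open>Comparison of \<open>\<rho>\<close> with \<open>hdist\<close>\<close>

context spherical_cap
begin

definition "angle x = geodesic_dist x e"

lemma angle:
  assumes "x \<in> cap e \<alpha>"
  shows "0 \<le> angle x" "angle x \<le> \<alpha>" "cos (angle x) = x \<bullet> e"
  using assms abs_inner_le_1[of x e] e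
  by (auto simp: angle_def cap_def geodesic_dist_def arccos_lbound abs_le_iff)

lemma height_angle: "x \<in> cap e \<alpha> \<Longrightarrow> height x = cos (angle x) - cos \<alpha>"
  by (simp add: angle height_def)

text \<open>A difference of cosines is comparable to the difference times the sum of the angles, and
  that sum lies between \<alpha> and 2\<alpha>. So heights replace the distances to the boundary, up
  to a factor \<alpha>.\<close>

lemma height_bounds:
  assumes "x \<in> cap e \<alpha>"
  shows "\<alpha> / 8 * (\<alpha> - angle x) \<le> height x" "height x \<le> \<alpha> * (\<alpha> - angle x)"
proof -
  note a = angle[OF assms]
  note b = abs_cos_diff_bounds[of "angle x" \<alpha>]
  have h: "\<bar>cos (angle x) - cos \<alpha>\<bar> = height x" 
    using cap_D(4)[OF assms] height_angle[OF assms] by simp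
  have "\<alpha> / 8 * (\<alpha> - angle x) \<le> (\<alpha> - angle x) * (angle x + \<alpha>) / 8"
    using a mult_left_mono[of \<alpha> "angle x + \<alpha>" "\<alpha> - angle x"] by (simp add: mult.commute)
  then show "\<alpha> / 8 * (\<alpha> - angle x) \<le> height x" using b(2) a \<alpha> h by simp
  have "(\<alpha> - angle x) * (angle x + \<alpha>) / 2 \<le> (\<alpha> - angle x) * (2 * \<alpha>) / 2"
    using a \<alpha> by (intro divide_right_mono mult_left_mono) auto
  then show "height x \<le> \<alpha> * (\<alpha> - angle x)" using b(1) a \<alpha> h by (simp add: mult.commute)
qed

lemma geodesic_dist_bounds:
  assumes "x \<in> cap e \<alpha>" "y \<in> cap e \<alpha>"
  shows "norm (x - y) \<le> geodesic_dist x y" "geodesic_dist x y \<le> 4 * norm (x - y)"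
    "\<bar>angle x - angle y\<bar> \<le> geodesic_dist x y"
  using norm_diff_le_arccos[of x y] arccos_inner_le[of x y] cap_D(1)[OF assms(1)] cap_D(1)[OF assms(2)] e
    arccos_inner_triangle[of x y e] arccos_inner_triangle[of y x e]
  by (auto simp: geodesic_dist_def angle_def inner_commute)

text \<open>As the norm of a pair \<open>\<rho>\<close> inherits the triangle inequality from its
  two components.\<close>

lemma rho_eq: "\<rho> x y = norm (geodesic_dist x y, sqrt \<alpha> * (sqrt (\<alpha> - angle x) - sqrt (\<alpha> - angle y))) / \<alpha>"
  using \<alpha> by (simp add: rho_def norm_Pair angle_def power_mult_distrib)

text \<open>Differences of roots are differences divided by sums of roots. Heights vary by at most
  \<alpha> times the angles, and \<open>sqrt (height z)\<close> is at least a third of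
  \<open>sqrt \<alpha> * sqrt (\<alpha> - angle z)\<close>. The exceptional case is that of two
  boundary points.\<close>

lemma sqrt_height_diff_le:
  assumes "x \<in> cap e \<alpha>" "y \<in> cap e \<alpha>"
  shows "\<bar>sqrt (height x) - sqrt (height y)\<bar> \<le>
    3 * (sqrt \<alpha> * \<bar>sqrt (\<alpha> - angle x) - sqrt (\<alpha> - angle y)\<bar>)"
    (is "\<bar>?p - ?q\<bar> \<le> 3 * (sqrt \<alpha> * \<bar>?u - ?v\<bar>)")
proof (cases "?u + ?v = 0")
  case True
  note a = angle[OF assms(1)] angle[OF assms(2)]
  have "angle x = \<alpha>" "angle y = \<alpha>" using True a by (auto simp: add_nonneg_eq_0_iff)
  then show ?thesis using height_angle[OF assms(1)] height_angle[OF assms(2)] by simp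
next
  case False
  note a = angle[OF assms(1)] angle[OF assms(2)]
  have uv: "0 < ?u + ?v" using False a by (simp add: less_le)
  have low: "sqrt \<alpha> / 3 * sqrt (\<alpha> - angle z) \<le> sqrt (height z)" if "z \<in> cap e \<alpha>" for z
  proof -
    have "(sqrt \<alpha> / 3 * sqrt (\<alpha> - angle z))\<^sup>2 = \<alpha> / 9 * (\<alpha> - angle z)"
      using angle[OF that] \<alpha> by (simp add: power_mult_distrib power_divide)
    also have "\<dots> \<le> \<alpha> / 8 * (\<alpha> - angle z)" using angle[OF that] \<alpha> by (intro mult_right_mono) auto
    also have "\<dots> \<le> height z" by (rule height_bounds[OF that])
    finally show ?thesis by (rule real_le_rsqrt)
  qed
  have "\<bar>?p - ?q\<bar> \<le> \<bar>height x - height y\<bar> / (sqrt \<alpha> / 3 * (?u + ?v))"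
  proof (intro abs_sqrt_diff_le)
    show "sqrt \<alpha> / 3 * (?u + ?v) \<le> ?p + ?q"
      using low[OF assms(1)] low[OF assms(2)] by (simp only: distrib_left)
    show "0 < sqrt \<alpha> / 3 * (?u + ?v)" using uv \<alpha> by (intro mult_pos_pos) auto
  qed (use assms cap_D(4) in auto)
  also have "\<bar>height x - height y\<bar> \<le> \<alpha> * \<bar>angle x - angle y\<bar>"
  proof -
    have "\<bar>height x - height y\<bar> \<le> \<bar>angle x - angle y\<bar> * (angle x + angle y) / 2"
      using abs_cos_diff_bounds(1)[of "angle x" "angle y"] a \<alpha> height_angle assms by simp
    also have "\<dots> \<le> \<bar>angle x - angle y\<bar> * (2 * \<alpha>) / 2"
      using a by (intro divide_right_mono mult_left_mono) auto
    finally show ?thesis by (simp add: mult.commute)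
  qed
  also have "\<bar>angle x - angle y\<bar> = \<bar>?u - ?v\<bar> * (?u + ?v)"
    using abs_sqrt_diff_mult_add[of "\<alpha> - angle x" "\<alpha> - angle y"] a by (simp add: abs_minus_commute)
  also have "\<alpha> * (\<bar>?u - ?v\<bar> * (?u + ?v)) / (sqrt \<alpha> / 3 * (?u + ?v)) = 3 * (sqrt \<alpha> * \<bar>?u - ?v\<bar>)"
  proof -
    have "\<alpha> = sqrt \<alpha> * sqrt \<alpha>" using \<alpha> by simp
    then have "\<alpha> * (\<bar>?u - ?v\<bar> * (?u + ?v)) = 3 * (sqrt \<alpha> * \<bar>?u - ?v\<bar>) * (sqrt \<alpha> / 3 * (?u + ?v))"
      by (simp add: mult_ac)
    moreover have "sqrt \<alpha> / 3 * (?u + ?v) \<noteq> 0" using uv \<alpha> by simp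
    ultimately show ?thesis by (metis nonzero_mult_div_cancel_right)
  qed
  finally show ?thesis using uv \<alpha> by (simp add: divide_right_mono)
qed

text \<open>Cosine is flat at 0, so heights control angles only away from \<open>e\<close>; that is
  the case of an angle sum of at least \<open>\<alpha> / 2\<close>. Otherwise both points are far
  from the boundary, where the square roots are harmless and the geodesic distance suffices.\<close>

lemma sqrt_angle_diff_le:
  assumes "x \<in> cap e \<alpha>" "y \<in> cap e \<alpha>"
  shows "sqrt \<alpha> * \<bar>sqrt (\<alpha> - angle x) - sqrt (\<alpha> - angle y)\<bar> \<le>
    4 * norm (x - y) + 16 * \<bar>sqrt (height x) - sqrt (height y)\<bar>"
    (is "sqrt \<alpha> * \<bar>?u - ?v\<bar> \<le> _ + 16 * \<bar>?p - ?q\<bar>")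
proof (cases "?u + ?v = 0")
  case True
  then have "?u = 0" "?v = 0" using angle[OF assms(1)] angle[OF assms(2)] by (auto simp: add_nonneg_eq_0_iff)
  then show ?thesis by simp
next
  case False
  note a = angle[OF assms(1)] angle[OF assms(2)]
  have uv: "0 < ?u + ?v" using False a by (simp add: less_le)
  have ang: "\<bar>angle x - angle y\<bar> = \<bar>?u - ?v\<bar> * (?u + ?v)"
    using abs_sqrt_diff_mult_add[of "\<alpha> - angle x" "\<alpha> - angle y"] a by (simp add: abs_minus_commute)
  have s: "sqrt \<alpha> * sqrt \<alpha> = \<alpha>" "0 < sqrt \<alpha>" using \<alpha> by auto
  show ?thesis
  proof (cases "\<alpha> / 2 \<le> angle x + angle y")
    case True
    have up: "sqrt (height z) \<le> sqrt \<alpha> * sqrt (\<alpha> - angle z)" if "z \<in> cap e \<alpha>" for z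
      using height_bounds(2)[OF that] by (simp flip: real_sqrt_mult)
    have "\<bar>?u - ?v\<bar> * (?u + ?v) * (\<alpha> / 16) \<le> \<bar>angle x - angle y\<bar> * (angle x + angle y) / 8"
      unfolding ang[symmetric] using True mult_left_mono[OF True, of "\<bar>angle x - angle y\<bar> / 8"] by simp
    also have "\<dots> \<le> \<bar>height x - height y\<bar>"
      using abs_cos_diff_bounds(2)[of "angle x" "angle y"] a \<alpha> height_angle assms by simp
    also have "\<dots> = \<bar>?p - ?q\<bar> * (?p + ?q)"
      using abs_sqrt_diff_mult_add cap_D(4) assms by simp
    also have "\<dots> \<le> \<bar>?p - ?q\<bar> * (sqrt \<alpha> * (?u + ?v))"
      using up[OF assms(1)] up[OF assms(2)] by (intro mult_left_mono) (auto simp: distrib_left)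
    finally have that: "\<bar>?u - ?v\<bar> * (?u + ?v) * (\<alpha> / 16) \<le> \<bar>?p - ?q\<bar> * (sqrt \<alpha> * (?u + ?v))" .
    have "(sqrt \<alpha> * \<bar>?u - ?v\<bar>) * (sqrt \<alpha> * (?u + ?v)) \<le> (16 * \<bar>?p - ?q\<bar>) * (sqrt \<alpha> * (?u + ?v))"
    proof -
      have "(sqrt \<alpha> * \<bar>?u - ?v\<bar>) * (sqrt \<alpha> * (?u + ?v)) =
          (sqrt \<alpha> * sqrt \<alpha>) * (\<bar>?u - ?v\<bar> * (?u + ?v))" by (simp only: mult_ac)
      also have "\<dots> = 16 * (\<bar>?u - ?v\<bar> * (?u + ?v) * (\<alpha> / 16))" unfolding s(1) by simp
      finally show ?thesis using that unfolding mult.assoc by linarith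
    qed
    moreover have "0 < sqrt \<alpha> * (?u + ?v)" using uv s by simp
    ultimately have L: "sqrt \<alpha> * \<bar>?u - ?v\<bar> \<le> 16 * \<bar>?p - ?q\<bar>" by (rule mult_right_le_imp_le)
    show ?thesis by (rule order.trans[OF L]) simp
  next
    case False
    have "sqrt (\<alpha> / 4) \<le> ?u" "sqrt (\<alpha> / 4) \<le> ?v" using False a \<alpha> by auto
    then have "sqrt \<alpha> \<le> ?u + ?v" by (simp add: real_sqrt_divide)
    then have "sqrt \<alpha> * \<bar>?u - ?v\<bar> \<le> (?u + ?v) * \<bar>?u - ?v\<bar>" by (intro mult_right_mono) auto
    also have "\<dots> \<le> geodesic_dist x y" using geodesic_dist_bounds(3)[OF assms] ang by (simp add: mult.commute)
    also have "\<dots> \<le> 4 * norm (x - y)" by (rule geodesic_dist_bounds[OF assms])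
    finally have L: "sqrt \<alpha> * \<bar>?u - ?v\<bar> \<le> 4 * norm (x - y)" .
    show ?thesis by (rule order.trans[OF L]) simp
  qed
qed

lemma hdist_le_rho:
  assumes "x \<in> cap e \<alpha>" "y \<in> cap e \<alpha>"
  shows "hdist x y \<le> 4 * \<rho> x y"
proof -
  let ?s = "sqrt \<alpha> * (sqrt (\<alpha> - angle x) - sqrt (\<alpha> - angle y))"
  have "\<bar>?s\<bar> = sqrt \<alpha> * \<bar>sqrt (\<alpha> - angle x) - sqrt (\<alpha> - angle y)\<bar>" using \<alpha> by (simp add: abs_mult)
  then have "norm (x - y) + \<bar>sqrt (height x) - sqrt (height y)\<bar> \<le>
      norm (geodesic_dist x y) + 3 * norm ?s"
    using geodesic_dist_bounds(1)[OF assms] sqrt_height_diff_le[OF assms] by simp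
  also have "\<dots> \<le> 4 * norm (geodesic_dist x y, ?s)"
    using norm_fst_le[of "geodesic_dist x y" ?s] norm_snd_le[of ?s "geodesic_dist x y"] by simp
  finally show ?thesis using \<alpha> unfolding hdist_def rho_eq by (simp add: divide_right_mono)
qed

lemma rho_le_hdist:
  assumes "x \<in> cap e \<alpha>" "y \<in> cap e \<alpha>"
  shows "\<rho> x y \<le> 16 * hdist x y"
proof -
  let ?s = "sqrt \<alpha> * (sqrt (\<alpha> - angle x) - sqrt (\<alpha> - angle y))"
  have s: "\<bar>?s\<bar> = sqrt \<alpha> * \<bar>sqrt (\<alpha> - angle x) - sqrt (\<alpha> - angle y)\<bar>" using \<alpha> by (simp add: abs_mult)
  have "norm (geodesic_dist x y, ?s) \<le> norm (geodesic_dist x y) + norm ?s" by (rule norm_Pair_le)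
  also have "\<dots> \<le> 4 * norm (x - y) + (4 * norm (x - y) + 16 * \<bar>sqrt (height x) - sqrt (height y)\<bar>)"
    using geodesic_dist_bounds[OF assms] sqrt_angle_diff_le[OF assms] s by simp
  also have "\<dots> \<le> 16 * (norm (x - y) + \<bar>sqrt (height x) - sqrt (height y)\<bar>)"
    by simp
  finally show ?thesis using \<alpha> unfolding hdist_def rho_eq by (simp add: divide_right_mono)
qed

lemma rho_nonneg: "0 \<le> \<rho> x y"
  using \<alpha> by (simp add: rho_eq)

lemma rho_commute: "\<rho> x y = \<rho> y x"
  by (simp add: rho_def geodesic_dist_def inner_commute power2_commute)

lemma rho_refl: "x \<in> cap e \<alpha> \<Longrightarrow> \<rho> x x = 0"
  using cap_D(1)[of x] by (simp add: rho_def geodesic_dist_def dot_square_norm)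

lemma rho_triangle:
  assumes "x \<in> cap e \<alpha>" "y \<in> cap e \<alpha>" "z \<in> cap e \<alpha>"
  shows "\<rho> x z \<le> \<rho> x y + \<rho> y z"
proof -
  let ?s = "\<lambda>x y. sqrt \<alpha> * (sqrt (\<alpha> - angle x) - sqrt (\<alpha> - angle y))"
  have g: "geodesic_dist x z \<le> geodesic_dist x y + geodesic_dist y z"
    unfolding geodesic_dist_def by (intro arccos_inner_triangle) (use cap_D(1) assms in auto)
  have g0: "0 \<le> geodesic_dist x z"
    using geodesic_dist_bounds(1)[OF assms(1,3)] norm_ge_zero order.trans by blast
  have s: "?s x z = ?s x y + ?s y z" by (simp add: algebra_simps)
  have "norm (geodesic_dist x z, ?s x z) \<le> norm (geodesic_dist x y + geodesic_dist y z, ?s x z)"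
    unfolding norm_Pair using g g0 by (intro real_sqrt_le_mono add_right_mono power_mono) auto
  also have "(geodesic_dist x y + geodesic_dist y z, ?s x z) =
      (geodesic_dist x y, ?s x y) + (geodesic_dist y z, ?s y z)" by (simp add: s)
  also have "norm \<dots> \<le> norm (geodesic_dist x y, ?s x y) + norm (geodesic_dist y z, ?s y z)"
    by (rule norm_triangle_ineq)
  finally show ?thesis using \<alpha> unfolding rho_eq by (simp add: divide_right_mono flip: add_divide_distrib)
qed

lemma e_in_cap: "e \<in> cap e \<alpha>" using e \<alpha> by (simp add: cap_iff dot_square_norm)

text \<open>Both components are at most \<alpha>, so sqrt 2 would do. Any radius below 2 makes the
  cap a ball about \<open>e\<close> whose half radius is below 1, where doubling is assumed.\<close>

lemma rho_center_le:
  assumes "x \<in> cap e \<alpha>"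
  shows "\<rho> x e \<le> 3/2"
proof -
  note a = angle[OF assms]
  have ae: "angle e = 0" using e by (simp add: angle_def geodesic_dist_def dot_square_norm)
  have gx: "geodesic_dist x e = angle x" by (simp add: angle_def)
  have "\<bar>sqrt (\<alpha> - angle x) - sqrt \<alpha>\<bar> \<le> sqrt \<alpha>" using a by (auto simp: abs_le_iff)
  then have "\<bar>sqrt (\<alpha> - angle x) - sqrt \<alpha>\<bar>\<^sup>2 \<le> (sqrt \<alpha>)\<^sup>2" by (intro power_mono) auto
  then have "(sqrt (\<alpha> - angle x) - sqrt \<alpha>)\<^sup>2 \<le> \<alpha>" using \<alpha> by simp
  then have "(angle x)\<^sup>2 + \<alpha> * (sqrt (\<alpha> - angle x) - sqrt \<alpha>)\<^sup>2 \<le> \<alpha>\<^sup>2 + \<alpha> * \<alpha>"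
    using a \<alpha> by (intro add_mono power_mono mult_left_mono) auto
  also have "\<dots> \<le> (3/2 * \<alpha>)\<^sup>2" by (simp add: power2_eq_square)
  finally have "sqrt ((angle x)\<^sup>2 + \<alpha> * (sqrt (\<alpha> - angle x) - sqrt \<alpha>)\<^sup>2) \<le> 3/2 * \<alpha>"
    using \<alpha> by (intro real_le_lsqrt) auto
  then show ?thesis using \<alpha> ae gx unfolding rho_def angle_def[symmetric] by (simp add: field_simps)
qed

lemma spoly_rho_lipschitz:
  assumes f: "spoly n f" and n: "n \<ge> 1" and xy: "x \<in> cap e \<alpha>" "y \<in> cap e \<alpha>"
    and near: "real n * \<rho> x y \<le> 1"
    and S: "\<And>z. z \<in> cap e \<alpha> \<Longrightarrow> \<bar>f z\<bar> \<le> S * (1 + real n * \<rho> x z) ^ N"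
  shows "\<bar>f x - f y\<bar> \<le> 26880 * (real N + 1) * 70 ^ N * (1 + 5 ^ N) * 16 ^ N * (real n * \<rho> x y) * S"
proof -
  have "\<bar>f x\<bar> \<le> S" using S[OF xy(1)] rho_refl[OF xy(1)] by simp
  then have S0: "0 \<le> S" using abs_ge_zero order.trans by blast
  have R: "hdist x y \<le> 4 * \<rho> x y" by (rule hdist_le_rho[OF xy])
  have nR: "real n * hdist x y \<le> 4 * (real n * \<rho> x y)"
    using mult_left_mono[OF R, of "real n"] by simp
  have "\<bar>f x - f y\<bar> \<le> 6720 * (real N + 1) * 70 ^ N * (1 + 5 ^ N) * (real n * hdist x y) * (S * 16 ^ N)"
  proof (rule spoly_local_lipschitz[OF f n xy])
    show "real n * hdist x y \<le> 4" using nR near by simp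
    fix z assume z: "z \<in> cap e \<alpha>"
    have "1 + real n * \<rho> x z \<le> 16 * (1 + real n * hdist x z)"
      using mult_left_mono[OF rho_le_hdist[OF xy(1) z], of "real n"] by simp
    then have "(1 + real n * \<rho> x z) ^ N \<le> (16 * (1 + real n * hdist x z)) ^ N"
      using rho_nonneg by (intro power_mono) auto
    then have "S * (1 + real n * \<rho> x z) ^ N \<le> S * 16 ^ N * (1 + real n * hdist x z) ^ N"
      unfolding power_mult_distrib mult.assoc using S0 by (rule mult_left_mono)
    then show "\<bar>f z\<bar> \<le> S * 16 ^ N * (1 + real n * hdist x z) ^ N" using S[OF z] by simp
  qed
  also have "\<dots> \<le> 6720 * (real N + 1) * 70 ^ N * (1 + 5 ^ N) * (4 * (real n * \<rho> x y)) * (S * 16 ^ N)"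
    using nR S0 by (intro mult_right_mono mult_left_mono) auto
  finally show ?thesis by (simp add: algebra_simps)
qed

end

section \<open>Doubling metric measure spaces\<close>

text \<open>The intended measure is the weight times surface measure on the cap. A pseudometric is
  enough. Boundedness makes nets finite and lets finitely many dyadic balls exhaust the space;
  positivity of balls excludes the zero weight.\<close>

locale doubling_space = finite_measure M for M :: "'a measure" +
  fixes d :: "'a \<Rightarrow> 'a \<Rightarrow> real" and K :: real
  assumes K: "1 \<le> K"
    and d_measurable: "x \<in> space M \<Longrightarrow> d x \<in> borel_measurable M"
    and d_nonneg: "0 \<le> d x y"
    and d_refl: "x \<in> space M \<Longrightarrow> d x x = 0"
    and d_commute: "d x y = d y x"
    and d_triangle: "x \<in> space M \<Longrightarrow> y \<in> space M \<Longrightarrow> z \<in> space M \<Longrightarrow> d x z \<le> d x y + d y z"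
    and d_bounded: "x \<in> space M \<Longrightarrow> y \<in> space M \<Longrightarrow> d x y \<le> 4"
    and doubling: "x \<in> space M \<Longrightarrow> 0 < r \<Longrightarrow>
      measure M {y \<in> space M. d x y \<le> 2 * r} \<le> K * measure M {y \<in> space M. d x y \<le> r}"
    and ball_pos: "x \<in> space M \<Longrightarrow> 0 < r \<Longrightarrow> 0 < measure M {y \<in> space M. d x y \<le> r}"
begin

definition B :: "'a \<Rightarrow> real \<Rightarrow> 'a set" where "B x r = {y \<in> space M. d x y \<le> r}"

definition net :: "real \<Rightarrow> 'a set \<Rightarrow> bool" where
  "net s A \<longleftrightarrow> finite A \<and> A \<subseteq> space M \<and> (\<forall>x\<in>A. \<forall>y\<in>A. x \<noteq> y \<longrightarrow> s \<le> d x y)"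

lemma B_sets [measurable]: "x \<in> space M \<Longrightarrow> B x r \<in> sets M"
  unfolding B_def using d_measurable by (auto intro: borel_measurable_le)

lemma B_subset: "B x r \<subseteq> space M" by (auto simp: B_def)

lemma measure_B_mono: "x \<in> space M \<Longrightarrow> y \<in> space M \<Longrightarrow> B x r \<subseteq> B y s \<Longrightarrow> measure M (B x r) \<le> measure M (B y s)"
  by (intro finite_measure_mono B_sets)

lemma B_subset_B:
  assumes "x \<in> space M" "y \<in> space M" "d x y + r \<le> s"
  shows "B x r \<subseteq> B y s"
proof
  fix z assume z: "z \<in> B x r"
  then have "d y z \<le> d y x + d x z" using assms d_triangle by (auto simp: B_def)
  then show "z \<in> B y s" using z assms d_commute[of x y] by (simp add: B_def)
qed

lemma doubling_power:
  assumes x: "x \<in> space M" and r: "0 < r" and R: "R \<le> 2 ^ k * r"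
  shows "measure M (B x R) \<le> K ^ k * measure M (B x r)"
proof -
  have "measure M (B x (2 ^ k * r)) \<le> K ^ k * measure M (B x r)"
  proof (induction k)
    case (Suc k)
    have "measure M (B x (2 ^ Suc k * r)) \<le> K * measure M (B x (2 ^ k * r))"
      using doubling[OF x, of "2 ^ k * r"] r by (simp add: B_def mult.assoc)
    also have "\<dots> \<le> K * (K ^ k * measure M (B x r))" using Suc K by (intro mult_left_mono) auto
    finally show ?case by (simp add: mult.assoc)
  qed simp
  moreover have "measure M (B x R) \<le> measure M (B x (2 ^ k * r))"
    using R x by (intro measure_B_mono) (auto simp: B_def)
  ultimately show ?thesis by simp
qed

text \<open>Balls of radius \<open>s / 3\<close> about the points of \<open>A\<close> are disjoint
  and lie in \<open>B x (2 * r)\<close>, while \<open>k\<close> doublings of one of them cover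
  \<open>B x (2 * r)\<close>, being a ball of radius at least \<open>3 * r\<close>.\<close>

lemma packing:
  assumes A: "net s A" "A \<subseteq> B x r" and x: "x \<in> space M" and s: "0 < s" "s \<le> r" "9 * r \<le> 2 ^ k * s"
  shows "real (card A) \<le> K ^ k"
proof -
  have A': "finite A" "A \<subseteq> space M" using A by (auto simp: net_def)
  have disj: "disjoint_family_on (\<lambda>w. B w (s / 3)) A"
    unfolding disjoint_family_on_def
  proof (intro ballI impI, rule ccontr)
    fix v w assume vw: "v \<in> A" "w \<in> A" "v \<noteq> w" "B v (s / 3) \<inter> B w (s / 3) \<noteq> {}"
    then obtain y where "y \<in> space M" "d v y \<le> s / 3" "d w y \<le> s / 3" by (auto simp: B_def)
    moreover have "s \<le> d v w" "v \<in> space M" "w \<in> space M" using vw A by (auto simp: net_def)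
    ultimately show False using d_triangle[of v y w] d_commute[of w y] s by simp
  qed
  have xr: "d x w \<le> r" if "w \<in> A" for w using A that by (auto simp: B_def)
  have "real (card A) * measure M (B x (2 * r)) = (\<Sum>w\<in>A. measure M (B x (2 * r)))" by simp
  also have "\<dots> \<le> (\<Sum>w\<in>A. K ^ k * measure M (B w (s / 3)))"
  proof (rule sum_mono)
    fix w assume w: "w \<in> A"
    have wM: "w \<in> space M" using w A' by auto
    have "measure M (B x (2 * r)) \<le> measure M (B w (3 * r))"
      using x wM xr[OF w] by (intro measure_B_mono B_subset_B) auto
    also have "\<dots> \<le> K ^ k * measure M (B w (s / 3))"
      using s by (intro doubling_power wM) auto
    finally show "measure M (B x (2 * r)) \<le> K ^ k * measure M (B w (s / 3))" .
  qed
  also have "\<dots> = K ^ k * (\<Sum>w\<in>A. measure M (B w (s / 3)))" by (simp add: sum_distrib_left)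
  also have "(\<Sum>w\<in>A. measure M (B w (s / 3))) = measure M (\<Union>w\<in>A. B w (s / 3))"
    using A' disj by (intro finite_measure_finite_Union[symmetric]) auto
  also have "\<dots> \<le> measure M (B x (2 * r))"
  proof (rule finite_measure_mono)
    show "(\<Union>w\<in>A. B w (s / 3)) \<subseteq> B x (2 * r)"
    proof (rule UN_least)
      fix w assume "w \<in> A"
      then show "B w (s / 3) \<subseteq> B x (2 * r)"
        using x A' xr[of w] d_commute[of x w] s by (intro B_subset_B) auto
    qed
  qed (use x in auto)
  finally have "real (card A) * measure M (B x (2 * r)) \<le> K ^ k * measure M (B x (2 * r))"
    using K by (simp add: mult_left_mono)
  moreover have "0 < measure M (B x (2 * r))" using ball_pos[OF x, of "2 * r"] s by (simp add: B_def)
  ultimately show ?thesis by (rule mult_right_le_imp_le)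
qed

text \<open>The centres whose balls contain \<open>x\<close> form a net in \<open>B x s\<close>;
  packing applies with \<open>r = s\<close>, and 9 is at most 2 ^ 4.\<close>

lemma overlap:
  assumes A: "net s A" and s: "0 < s" and x: "x \<in> space M"
  shows "(\<Sum>w\<in>A. indicator (B w s) x) \<le> K ^ 4"
proof -
  let ?A = "A \<inter> {w. x \<in> B w s}"
  have "(\<Sum>w\<in>A. indicator (B w s) x :: real) = real (card ?A)"
    using A by (simp add: indicator_def sum.If_cases net_def)
  also have "\<dots> \<le> K ^ 4"
  proof (rule packing[of s])
    show "net s ?A" using A by (auto simp: net_def)
    show "?A \<subseteq> B x s" using A by (auto simp: B_def net_def d_commute)
  qed (use s x in auto)
  finally show ?thesis .
qed

text \<open>Packing bounds the cardinality of nets, and a net of largest cardinality must cover,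
  since an uncovered point could be added.\<close>

lemma maximal_net_exists:
  assumes s: "0 < s"
  obtains A where "net s A" "space M = (\<Union>w\<in>A. B w s)"
proof -
  obtain k where k: "9 * max 4 s / s < 2 ^ k" using real_arch_pow[of 2] by auto
  have bound: "card A \<le> nat \<lceil>K ^ k\<rceil>" if A: "net s A" for A
  proof (cases "A = {}")
    case False
    then obtain x where x: "x \<in> A" by auto
    then have xM: "x \<in> space M" using A by (auto simp: net_def)
    have "real (card A) \<le> K ^ k"
    proof (rule packing[OF A _ xM s])
      show "A \<subseteq> B x (max 4 s)"
      proof
        fix y assume "y \<in> A"
        then have "y \<in> space M" using A by (auto simp: net_def)
        then show "y \<in> B x (max 4 s)" using d_bounded[OF xM] by (simp add: B_def le_max_iff_disj)
      qed
      show "9 * max 4 s \<le> 2 ^ k * s" using k s by (simp add: field_simps)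
    qed simp
    then show ?thesis by linarith
  qed simp
  have "net s {}" by (simp add: net_def)
  obtain A where A: "net s A" and max: "\<And>A'. net s A' \<Longrightarrow> card A' \<le> card A"
  proof -
    have "\<forall>A. net s A \<longrightarrow> card A < Suc (nat \<lceil>K ^ k\<rceil>)" using bound by (auto simp: less_Suc_eq_le)
    from ex_has_greatest_nat[of "net s", OF \<open>net s {}\<close> this] show ?thesis using that by blast
  qed
  have "x \<in> (\<Union>w\<in>A. B w s)" if x: "x \<in> space M" for x
  proof (rule ccontr)
    assume "x \<notin> (\<Union>w\<in>A. B w s)"
    then have far: "s < d w x" if "w \<in> A" for w using that x by (auto simp: B_def not_le)
    have far': "s < d x w" if "w \<in> A" for w using far[OF that] by (subst d_commute)
    have "x \<notin> A" using far[of x] d_refl[OF x] s by auto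
    moreover have "net s (insert x A)"
      using A x far far' by (auto simp: net_def less_imp_le)
    ultimately show False using max[of "insert x A"] A by (simp add: net_def)
  qed
  then have "space M = (\<Union>w\<in>A. B w s)" using B_subset by blast
  with A show ?thesis by (rule that)
qed

lemma integrable_indicator_B:
  fixes g :: "'a \<Rightarrow> real"
  assumes "sets N = sets M" "integrable N g" "w \<in> space M"
  shows "integrable N (\<lambda>x. indicator (B w r) x * g x)"
  using integrable_real_mult_indicator[OF _ assms(2), of "B w r"] assms by (simp add: mult.commute)

lemma integral_indicator_B:
  assumes "sets N = sets M" "w \<in> space M"
  shows "(\<integral>x. indicator (B w r) x * c \<partial>N) = c * measure N (B w r)"
  using B_subset[of w r] sets_eq_imp_space_eq[OF assms(1)] by (simp add: Int_absorb2 mult.commute)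

text \<open>The overlap bound is pointwise, so it integrates against any measure \<open>N\<close> on
  the same sets; besides \<open>M\<close> itself this will be the surface measure.\<close>

lemma sum_integral_overlap:
  fixes g :: "'a \<Rightarrow> real"
  assumes A: "net s A" and s: "0 < s" and N: "sets N = sets M"
    and g: "integrable N g" "\<And>x. x \<in> space M \<Longrightarrow> 0 \<le> g x"
  shows "(\<Sum>w\<in>A. \<integral>x. indicator (B w s) x * g x \<partial>N) \<le> K ^ 4 * (\<integral>x. g x \<partial>N)"
proof -
  have sp: "space N = space M" using N by (rule sets_eq_imp_space_eq)
  have int: "integrable N (\<lambda>x. indicator (B w s) x * g x)" if "w \<in> A" for w
    using that A by (intro integrable_indicator_B N g) (auto simp: net_def)
  have "(\<Sum>w\<in>A. \<integral>x. indicator (B w s) x * g x \<partial>N) = (\<integral>x. (\<Sum>w\<in>A. indicator (B w s) x * g x) \<partial>N)"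
    using int by (intro Bochner_Integration.integral_sum[symmetric])
  also have "\<dots> \<le> (\<integral>x. K ^ 4 * g x \<partial>N)"
  proof (rule integral_mono)
    show "integrable N (\<lambda>x. \<Sum>w\<in>A. indicator (B w s) x * g x)"
      using int by (intro Bochner_Integration.integrable_sum)
    show "integrable N (\<lambda>x. K ^ 4 * g x)" using g by simp
    fix x assume "x \<in> space N"
    then show "(\<Sum>w\<in>A. indicator (B w s) x * g x) \<le> K ^ 4 * g x"
      unfolding sum_distrib_right[symmetric] using overlap[OF A s] g sp by (intro mult_right_mono) auto
  qed
  finally show ?thesis by simp
qed

lemma integral_le_sum_cover:
  fixes g :: "'a \<Rightarrow> real"
  assumes A: "finite A" "A \<subseteq> space M" "space M = (\<Union>w\<in>A. B w s)" and N: "sets N = sets M"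
    and g: "integrable N g" "\<And>x. x \<in> space M \<Longrightarrow> 0 \<le> g x"
  shows "(\<integral>x. g x \<partial>N) \<le> (\<Sum>w\<in>A. \<integral>x. indicator (B w s) x * g x \<partial>N)"
proof -
  have sp: "space N = space M" using N by (rule sets_eq_imp_space_eq)
  have int: "integrable N (\<lambda>x. indicator (B w s) x * g x)" if "w \<in> A" for w
    using that A(2) by (intro integrable_indicator_B N g) blast
  have "(\<integral>x. g x \<partial>N) \<le> (\<integral>x. (\<Sum>w\<in>A. indicator (B w s) x * g x) \<partial>N)"
  proof (rule integral_mono)
    show "integrable N (\<lambda>x. \<Sum>w\<in>A. indicator (B w s) x * g x)"
      using int by (intro Bochner_Integration.integrable_sum)
    fix x assume "x \<in> space N"
    then obtain w where w: "w \<in> A" "x \<in> B w s" and x: "x \<in> space M" using A sp by auto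
    have "g x = indicator (B w s) x * g x" using w by simp
    also have "\<dots> \<le> (\<Sum>w\<in>A. indicator (B w s) x * g x)"
      using w A x g by (intro member_le_sum) auto
    finally show "g x \<le> (\<Sum>w\<in>A. indicator (B w s) x * g x)" .
  qed (rule g)
  also have "\<dots> = (\<Sum>w\<in>A. \<integral>x. indicator (B w s) x * g x \<partial>N)"
    using int by (intro Bochner_Integration.integral_sum)
  finally show ?thesis .
qed

lemma integrable_decay:
  assumes w: "w \<in> space M" and n: "0 < n"
  shows "integrable M (\<lambda>x. 1 / (1 + n * d w x) ^ N)"
proof (rule integrable_const_bound[where B = 1])
  note [measurable] = d_measurable[OF w]
  show "(\<lambda>x. 1 / (1 + n * d w x) ^ N) \<in> borel_measurable M" by measurable
  have "norm (1 / (1 + n * d w x) ^ N) \<le> 1" for x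
  proof -
    have "1 \<le> (1 + n * d w x) ^ N" using d_nonneg n by (intro one_le_power) simp
    then show ?thesis by (simp add: divide_le_eq)
  qed
  then show "AE x in M. norm (1 / (1 + n * d w x) ^ N) \<le> 1" by simp
qed

text \<open>The space is split into the annuli between the balls of radius \<open>2 ^ k / n\<close> about \<open>w\<close>.\<close>

lemma integral_decay:
  assumes w: "w \<in> space M" and n: "0 < n" and N: "2 * K \<le> 2 ^ N"
  shows "(\<integral>x. 1 / (1 + n * d w x) ^ N \<partial>M) \<le> 2 ^ (N + 1) * measure M (B w (1 / n))"
proof -
  obtain k0 where k0: "4 * n < 2 ^ k0" using real_arch_pow[of 2] by auto
  let ?m = "measure M (B w (1 / n))"
  have "(\<integral>x. 1 / (1 + n * d w x) ^ N \<partial>M) \<le>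
      (\<integral>x. (\<Sum>k\<le>k0. (2::real) ^ N * (1 / 2 ^ N) ^ k * indicator (B w (2 ^ k / n)) x) \<partial>M)"
  proof (rule integral_mono[OF integrable_decay[OF w n]])
    show "integrable M (\<lambda>x. \<Sum>k\<le>k0. (2::real) ^ N * (1 / 2 ^ N) ^ k * indicator (B w (2 ^ k / n)) x)"
      using w by (intro Bochner_Integration.integrable_sum integrable_mult_right)
        (auto simp: integrable_indicator_iff emeasure_eq_measure)
    fix x assume x: "x \<in> space M"
    define k where "k = (LEAST k. n * d w x \<le> 2 ^ k)"
    have "n * d w x \<le> 4 * n" using d_bounded[OF w x] n by simp
    then have ex: "n * d w x \<le> 2 ^ k0" using k0 by simp
    have k: "n * d w x \<le> 2 ^ k" unfolding k_def by (rule LeastI[of _ k0]) (rule ex)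
    have kk0: "k \<le> k0" unfolding k_def by (rule Least_le) (rule ex)
    have xB: "x \<in> B w (2 ^ k / n)" using k x n by (simp add: B_def field_simps)
    have "1 / (1 + n * d w x) ^ N \<le> 2 ^ N * (1 / 2 ^ N) ^ k"
    proof (cases k)
      case 0
      have "1 \<le> (1 + n * d w x) ^ N" using d_nonneg n by (intro one_le_power) simp
      then have "1 / (1 + n * d w x) ^ N \<le> 1" by (simp add: divide_le_eq)
      also have "1 \<le> (2::real) ^ N" by simp
      finally show ?thesis using 0 by simp
    next
      \<comment> \<open>By minimality \<open>n * d w x\<close> exceeds \<open>2 ^ (k - 1)\<close>;
        the lost factor 2 reappears as \<open>2 ^ N\<close>.\<close>
      case (Suc i)
      have "\<not> n * d w x \<le> 2 ^ i"
        using not_less_Least[of i "\<lambda>k. n * d w x \<le> 2 ^ k"] Suc unfolding k_def by simp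
      then have "2 ^ i \<le> 1 + n * d w x" by simp
      then have "(2 ^ i) ^ N \<le> (1 + n * d w x) ^ N" by (intro power_mono) auto
      then have "1 / (1 + n * d w x) ^ N \<le> 1 / (2 ^ i) ^ N"
        using d_nonneg[of w x] n by (intro divide_left_mono mult_pos_pos zero_less_power add_pos_nonneg) auto
      also have "\<dots> = 2 ^ N * (1 / 2 ^ N) ^ k"
        unfolding Suc by (simp add: power_divide mult.commute flip: power_mult)
      finally show ?thesis .
    qed
    also have "\<dots> = 2 ^ N * (1 / 2 ^ N) ^ k * indicator (B w (2 ^ k / n)) x" using xB by simp
    also have "\<dots> \<le> (\<Sum>k\<le>k0. 2 ^ N * (1 / 2 ^ N) ^ k * indicator (B w (2 ^ k / n)) x)"
      using kk0
      by (intro member_le_sum[where f = "\<lambda>k. 2 ^ N * (1 / 2 ^ N) ^ k * indicator (B w (2 ^ k / n)) x"]) auto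
    finally show "1 / (1 + n * d w x) ^ N \<le> (\<Sum>k\<le>k0. 2 ^ N * (1 / 2 ^ N) ^ k * indicator (B w (2 ^ k / n)) x)" .
  qed
  also have "\<dots> = (\<Sum>k\<le>k0. 2 ^ N * (1 / 2 ^ N) ^ k * measure M (B w (2 ^ k / n)))"
    using w by (subst Bochner_Integration.integral_sum)
      (auto simp: integrable_indicator_iff emeasure_eq_measure Int_absorb2 B_subset)
  also have "\<dots> \<le> (\<Sum>k\<le>k0. 2 ^ N * (1 / 2 ^ N) ^ k * (K ^ k * ?m))"
    using n by (intro sum_mono mult_left_mono doubling_power w) auto
  \<comment> \<open>Each doubling of the radius multiplies the mass by at most \<open>K\<close> and
    the decay by \<open>1 / 2 ^ N\<close>, so \<open>2 * K \<le> 2 ^ N\<close> leaves a geometric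
    series of ratio 1/2.\<close>
  also have "\<dots> \<le> (\<Sum>k\<le>k0. 2 ^ N * ?m * (1 / 2) ^ k)"
  proof (rule sum_mono)
    fix k
    have "(K / 2 ^ N) ^ k \<le> (1 / 2) ^ k" using N K by (intro power_mono) (auto simp: field_simps)
    then have "2 ^ N * ?m * (K / 2 ^ N) ^ k \<le> 2 ^ N * ?m * (1 / 2) ^ k" by (intro mult_left_mono) auto
    then show "2 ^ N * (1 / 2 ^ N) ^ k * (K ^ k * ?m) \<le> 2 ^ N * ?m * (1 / 2) ^ k"
      by (simp add: power_divide mult_ac)
  qed
  also have "\<dots> = 2 ^ N * ?m * (\<Sum>k\<le>k0. (1 / 2) ^ k)" by (simp add: sum_distrib_left)
  also have "\<dots> \<le> 2 ^ N * ?m * 2"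
  proof (intro mult_left_mono)
    have "(\<Sum>k\<le>m. (1 / 2) ^ k :: real) = 2 - (1 / 2) ^ m" for m by (induction m) auto
    then show "(\<Sum>k\<le>k0. (1 / 2) ^ k :: real) \<le> 2" by simp
  qed simp
  finally show ?thesis by simp
qed

end

section \<open>Functions with controlled oscillation\<close>

lemma cSUP_mult_le:
  fixes f :: "'a \<Rightarrow> real"
  assumes "A \<noteq> {}" "0 \<le> c" "\<And>x. x \<in> A \<Longrightarrow> f x * c \<le> b"
  shows "(SUP x\<in>A. f x) * c \<le> b"
proof (cases "c = 0")
  case True
  then show ?thesis using assms by auto
next
  case False
  then have c: "0 < c" using assms by simp
  then have "(SUP x\<in>A. f x) \<le> b / c" using assms by (intro cSUP_least) (auto simp: field_simps)
  then show ?thesis using c by (simp add: field_simps)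
qed

lemma powr_add_le:
  fixes a b p :: real
  assumes "0 \<le> a" "0 \<le> b" "0 \<le> p"
  shows "(a + b) powr p \<le> 2 powr p * (a powr p + b powr p)"
proof -
  have "(a + b) powr p \<le> (2 * max a b) powr p" using assms by (intro powr_mono2) auto
  also have "\<dots> = 2 powr p * (max a b powr p)" using assms by (simp add: powr_mult)
  also have "max a b powr p \<le> a powr p + b powr p" by (auto simp: max_def)
  finally show ?thesis by (simp add: mult_left_mono)
qed

text \<open>The constants are defined outside the locales because they must be fixed before cap,
  weight and polynomial are given. Here the first factor comes from the power \<open>p\<close> in
  \<open>U\<close>, the second from \<open>integral_decay\<close>, and \<open>K ^ j\<close> from
  shrinking the radius from \<open>1 / n\<close> to \<open>\<delta>1 / n\<close>.\<close>

definition cell_const :: "real \<Rightarrow> real \<Rightarrow> nat \<Rightarrow> nat \<Rightarrow> real" where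
  "cell_const K p N j = (2 ^ (N + 1)) powr p * 2 ^ (N + 1) * K ^ j"

definition maximal_const :: "real \<Rightarrow> real \<Rightarrow> nat \<Rightarrow> nat \<Rightarrow> real" where
  "maximal_const K p N j = cell_const K p N j * K ^ 4"

definition sup_const :: "real \<Rightarrow> real \<Rightarrow> nat \<Rightarrow> nat \<Rightarrow> real" where
  "sup_const K p N j = (3 ^ N) powr p * K ^ 4 * maximal_const K p N j"

text \<open>Below this mesh size the error term in \<open>sup_sum_le_inf_sum\<close> has a
  coefficient of at most 1/2.\<close>

definition mesh_const :: "real \<Rightarrow> real \<Rightarrow> real \<Rightarrow> nat \<Rightarrow> nat \<Rightarrow> real" where
  "mesh_const K p C N j = 1 / (2 powr p * 8 * C * 3 ^ N * K ^ 4 * maximal_const K p N j)"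

lemma cell_const_ge_1:
  assumes "1 \<le> K" "1 \<le> p" shows "1 \<le> cell_const K p N j"
proof -
  have "(1::real) \<le> 2 ^ (N + 1)" by (rule one_le_power) simp
  then have "1 * 1 * 1 \<le> (2 ^ (N + 1)) powr p * 2 ^ (N + 1) * K ^ j"
    using assms by (intro mult_mono one_le_power ge_one_powr_ge_zero) auto
  then show ?thesis by (simp add: cell_const_def)
qed

lemma maximal_const_ge_1:
  assumes "1 \<le> K" "1 \<le> p" shows "1 \<le> maximal_const K p N j"
proof -
  have "1 * 1 \<le> cell_const K p N j * K ^ 4"
    using assms cell_const_ge_1[OF assms, of N j] by (intro mult_mono one_le_power) auto
  then show ?thesis by (simp add: maximal_const_def)
qed

lemma sup_const_ge_1:
  assumes "1 \<le> K" "1 \<le> p" shows "1 \<le> sup_const K p N j"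
proof -
  have "1 * 1 * 1 \<le> (3 ^ N) powr p * K ^ 4 * maximal_const K p N j"
    using assms maximal_const_ge_1[OF assms, of N j]
    by (intro mult_mono one_le_power ge_one_powr_ge_zero) auto
  then show ?thesis by (simp add: sup_const_def)
qed

lemma mesh_const_pos:
  assumes "1 \<le> K" "1 \<le> p" "0 < C" shows "0 < mesh_const K p C N j"
  using assms maximal_const_ge_1[OF assms(1,2), of N j] by (simp add: mesh_const_def)

text \<open>A nonnegative function whose oscillation at scale \<open>1 / n\<close> is controlled by its Peetre type
  maximal function, as is the case for the absolute value of a polynomial of degree \<open>n\<close>.\<close>

locale doubling_osc = doubling_space +
  fixes F :: "'a \<Rightarrow> real" and n p C \<delta>1 :: real and N j :: nat
  assumes F_measurable: "F \<in> borel_measurable M"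
    and F_nonneg: "\<And>x. x \<in> space M \<Longrightarrow> 0 \<le> F x"
    and F_bounded: "\<exists>b. \<forall>x\<in>space M. F x \<le> b"
    and n: "0 < n" and p: "1 \<le> p" and N: "2 * K \<le> 2 ^ N" and C: "0 < C"
    and osc: "\<And>x y S. x \<in> space M \<Longrightarrow> y \<in> space M \<Longrightarrow> n * d x y \<le> 1 \<Longrightarrow>
      (\<And>z. z \<in> space M \<Longrightarrow> F z \<le> S * (1 + n * d x z) ^ N) \<Longrightarrow> \<bar>F x - F y\<bar> \<le> C * (n * d x y) * S"
    and \<delta>1: "0 < \<delta>1" "4 * C * \<delta>1 \<le> 1" "\<delta>1 \<le> 1/2" "1 \<le> 2 ^ j * \<delta>1"
begin

abbreviation "growth x z \<equiv> (1 + n * d x z) ^ N"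
abbreviation "cell w \<equiv> B w (\<delta>1 / n)"

definition "Fstar x = (SUP z\<in>space M. F z / growth x z)"

lemma decay_ge_1: "1 \<le> growth x z"
  using d_nonneg n by (intro one_le_power) simp

lemma decay_pos: "0 < growth x z"
  using decay_ge_1[of x z] by linarith

text \<open>Boundedness of \<open>F\<close> enters here: it makes the real supremum in
  \<open>Fstar\<close> a genuine least upper bound.\<close>

lemma Fstar_upper: "z \<in> space M \<Longrightarrow> F z / growth x z \<le> Fstar x"
proof -
  assume z: "z \<in> space M"
  obtain b where b: "\<forall>x\<in>space M. F x \<le> b" using F_bounded by blast
  have "F y / growth x y \<le> b" if y: "y \<in> space M" for y
  proof -
    have "F y / growth x y \<le> F y / 1"
      using decay_ge_1[of x y] decay_pos[of x y] F_nonneg[OF y] by (intro divide_left_mono) auto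
    then show ?thesis using b y by auto
  qed
  then show ?thesis unfolding Fstar_def using z by (intro cSUP_upper bdd_aboveI2) auto
qed

lemma F_le_Fstar: "z \<in> space M \<Longrightarrow> F z \<le> Fstar x * growth x z"
  using Fstar_upper[of z x] decay_pos[of x z] by (simp add: field_simps)

lemma Fstar_nonneg: "x \<in> space M \<Longrightarrow> 0 \<le> Fstar x"
  using Fstar_upper[of x x] F_nonneg[of x] decay_pos[of x x] 
  by (meson divide_nonneg_pos order_trans)

lemma decay_submult:
  assumes "x \<in> space M" "y \<in> space M" "z \<in> space M"
  shows "growth x z \<le> growth x y * growth y z"
proof -
  have "1 + n * d x z \<le> 1 + n * (d x y + d y z)" using d_triangle[OF assms] n by simp
  also have "\<dots> \<le> (1 + n * d x y) * (1 + n * d y z)"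
    using d_nonneg n by (simp add: algebra_simps)
  finally show ?thesis unfolding power_mult_distrib[symmetric]
    using n d_nonneg by (intro power_mono) auto
qed

text \<open>\<open>growth\<close> is submultiplicative, so \<open>Fstar\<close> varies slowly: it is
  essentially constant at scale \<open>1 / n\<close>.\<close>

lemma Fstar_le:
  assumes "x \<in> space M" "y \<in> space M"
  shows "Fstar x \<le> growth x y * Fstar y"
  unfolding Fstar_def[of x]
proof (rule cSUP_least)
  fix z assume z: "z \<in> space M"
  have "F z \<le> Fstar y * growth y z" by (rule F_le_Fstar[OF z])
  also have "\<dots> \<le> Fstar y * (growth y x * growth x z)"
    using assms z by (intro mult_left_mono decay_submult Fstar_nonneg)
  finally show "F z / growth x z \<le> growth x y * Fstar y"
    using decay_pos[of x z] by (simp add: pos_divide_le_eq d_commute[of y x] mult_ac)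
qed (use assms in auto)

lemma osc_Fstar:
  assumes "x \<in> space M" "y \<in> space M" "n * d x y \<le> 1"
  shows "\<bar>F x - F y\<bar> \<le> C * (n * d x y) * Fstar x"
  by (intro osc assms F_le_Fstar)

definition "cellmin w = (INF y\<in>cell w. F y)"

lemma in_B_self: "w \<in> space M \<Longrightarrow> 0 \<le> r \<Longrightarrow> w \<in> B w r"
  by (simp add: B_def d_refl)

lemma dist_B:
  assumes "w \<in> space M" "x \<in> B w r" "y \<in> B w r"
  shows "d x y \<le> 2 * r"
  using assms d_triangle[of x w y] d_commute[of x w] by (auto simp: B_def)

lemma cellmin_le: "y \<in> cell w \<Longrightarrow> cellmin w \<le> F y"
  unfolding cellmin_def by (intro cINF_lower bdd_belowI2[of _ 0]) (auto simp: B_def F_nonneg)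

lemma cellmin_nonneg: "w \<in> space M \<Longrightarrow> 0 \<le> cellmin w"
  unfolding cellmin_def using n \<delta>1 in_B_self[of w "\<delta>1 / n"]
  by (intro cINF_greatest) (auto simp: B_def F_nonneg)

text \<open>A majorant for the power \<open>p\<close> of \<open>Fstar\<close> that can be integrated
  term by term. The decay is not raised to the power \<open>p\<close>: since \<open>growth\<close>
  is at least 1 this only enlarges the sum, and \<open>N\<close> is chosen for the plain
  decay.\<close>

definition "U A x = (\<Sum>w\<in>A. (2 ^ (N + 1) * cellmin w) powr p / growth w x)"

text \<open>The oscillation of \<open>F\<close> on a cell is at most half of \<^term>\<open>Fstar\<close>, so it is absorbed on the left.\<close>

lemma Fstar_powr_le:
  assumes A: "finite A" "A \<subseteq> space M" "space M = (\<Union>w\<in>A. cell w)" and x: "x \<in> space M"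
  shows "Fstar x powr p \<le> U A x"
proof -
  define V where "V w = 2 ^ N * cellmin w / growth w x" for w
  have A0: "A \<noteq> {}" using A x by auto
  have "F z / growth x z \<le> Max (V ` A) + Fstar x / 2" if z: "z \<in> space M" for z
  proof -
    obtain w where w: "w \<in> A" "z \<in> cell w" using A(3) z by auto
    have wM: "w \<in> space M" using w A by auto
    have cell: "F z \<le> cellmin w + Fstar z / 2"
    proof -
      have "F z - Fstar z / 2 \<le> F y" if y: "y \<in> cell w" for y
      proof -
        have yM: "y \<in> space M" using y by (auto simp: B_def)
        have nd: "n * d z y \<le> 2 * \<delta>1" using dist_B[OF wM w(2) y] n by (simp add: field_simps)
        have "\<bar>F z - F y\<bar> \<le> C * (n * d z y) * Fstar z"
          using nd \<delta>1 by (intro osc_Fstar z yM) auto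
        also have "\<dots> \<le> C * (2 * \<delta>1) * Fstar z"
          using nd C Fstar_nonneg[OF z] by (intro mult_right_mono mult_left_mono) auto
        \<comment> \<open>A cell has diameter at most \<open>2 * \<delta>1 / n\<close>, and
          \<open>4 * C * \<delta>1 \<le> 1\<close>.\<close>
        also have "\<dots> \<le> 1 / 2 * Fstar z"
          using \<delta>1 Fstar_nonneg[OF z] by (intro mult_right_mono) auto
        finally show ?thesis by linarith
      qed
      then have "F z - Fstar z / 2 \<le> cellmin w"
        unfolding cellmin_def using w by (intro cINF_greatest) auto
      then show ?thesis by simp
    qed
    \<comment> \<open>The centre \<open>w\<close> is within \<open>1 / n\<close> of
      \<open>z\<close>, so decay between \<open>x\<close> and \<open>z\<close> may be replaced by
      decay between \<open>w\<close> and \<open>x\<close> at the price of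
      \<open>2 ^ N\<close>.\<close>
    have "1 + n * d w x \<le> 2 * (1 + n * d x z)"
    proof -
      have "d w x \<le> d w z + d z x" using d_triangle wM z x by auto
      also have "d w z \<le> \<delta>1 / n" using w by (simp add: B_def)
      finally have "n * d w x \<le> n * (\<delta>1 / n + d x z)" using n d_commute[of x z] by simp
      then have "n * d w x \<le> \<delta>1 + n * d x z" using n by (simp add: distrib_left)
      moreover have "0 \<le> n * d x z" using n d_nonneg by simp
      ultimately show ?thesis using \<delta>1 by simp
    qed
    then have "growth w x \<le> (2 * (1 + n * d x z)) ^ N"
      using n d_nonneg by (intro power_mono) auto
    then have dec: "1 / growth x z \<le> 2 ^ N / growth w x"
      unfolding power_mult_distrib using decay_pos[of w x] decay_pos[of x z]
      by (simp add: divide_simps mult.commute)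
    have "F z / growth x z \<le> (cellmin w + Fstar z / 2) / growth x z"
      using cell decay_pos[of x z] by (intro divide_right_mono) auto
    also have "\<dots> = cellmin w * (1 / growth x z) + (Fstar z / growth x z) / 2"
      by (simp add: add_divide_distrib)
    also have "\<dots> \<le> cellmin w * (2 ^ N / growth w x) + Fstar x / 2"
    proof (intro add_mono mult_left_mono divide_right_mono dec cellmin_nonneg wM)
      show "Fstar z / growth x z \<le> Fstar x"
        using Fstar_le[OF z x] decay_pos[of x z] by (simp add: d_commute[of z x] pos_divide_le_eq mult.commute)
    qed simp
    also have "cellmin w * (2 ^ N / growth w x) = V w" by (simp add: V_def)
    also have "V w \<le> Max (V ` A)" using A w by (intro Max_ge) auto
    finally show ?thesis by simp
  qed
  then have "Fstar x \<le> Max (V ` A) + Fstar x / 2"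
    unfolding Fstar_def[of x] using x by (intro cSUP_least) (auto simp: Fstar_def)
  then have "Fstar x \<le> 2 * Max (V ` A)" by simp
  moreover have "Max (V ` A) \<in> V ` A" using A A0 by (intro Max_in) auto
  then obtain w where w: "w \<in> A" "Max (V ` A) = V w" by blast
  have wM: "w \<in> space M" using w A by auto
  ultimately have "Fstar x powr p \<le> (2 * V w) powr p"
    using w(2) p Fstar_nonneg[OF x] by (intro powr_mono2) auto
  also have "2 * V w = 2 ^ (N + 1) * cellmin w / growth w x" by (simp add: V_def)
  also have "\<dots> powr p = (2 ^ (N + 1) * cellmin w) powr p / growth w x powr p"
    by (rule powr_divide)
  also have "\<dots> \<le> (2 ^ (N + 1) * cellmin w) powr p / growth w x"
  proof (rule divide_left_mono)
    have "growth w x powr 1 \<le> growth w x powr p"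
      using p decay_ge_1 by (intro powr_mono) auto
    then show "growth w x \<le> growth w x powr p" using decay_pos[of w x] by simp
    have "0 < growth w x powr p" using decay_pos[of w x] by (metis less_irrefl powr_gt_zero)
    then show "0 < growth w x powr p * growth w x" using decay_pos by (rule mult_pos_pos)
  qed simp
  also have "\<dots> \<le> U A x"
    unfolding U_def
  proof (intro member_le_sum[where f = "\<lambda>w. (2 ^ (N + 1) * cellmin w) powr p / growth w x"])
    show "0 \<le> (2 ^ (N + 1) * cellmin v) powr p / growth v x" for v
      by (rule divide_nonneg_pos[OF powr_ge_zero decay_pos])
  qed (use A w in auto)
  finally show ?thesis .
qed

lemma integrable_U: "finite A \<Longrightarrow> A \<subseteq> space M \<Longrightarrow> integrable M (U A)"
  unfolding U_def[abs_def] using n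
  by (intro Bochner_Integration.integrable_sum)
    (auto simp: divide_inverse intro!: integrable_mult_right integrable_decay[unfolded divide_inverse mult_1])

lemma U_nonneg: "0 \<le> U A x"
  unfolding U_def by (intro sum_nonneg divide_nonneg_pos decay_pos) simp

lemma measurable_Fp [measurable]: "(\<lambda>x. F x powr p) \<in> borel_measurable M"
  using F_measurable by measurable

lemma integrable_bounded_on:
  fixes g :: "'a \<Rightarrow> real"
  assumes "finite_measure M'" "g \<in> borel_measurable M'" "\<And>x. x \<in> space M' \<Longrightarrow> 0 \<le> g x" "\<And>x. x \<in> space M' \<Longrightarrow> g x \<le> b"
  shows "integrable M' g"
proof -
  interpret M': finite_measure M' by fact
  show ?thesis using assms by (intro M'.integrable_const_bound[of _ b]) (auto intro!: AE_I2)
qed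

lemma Fp_bounded: "\<exists>b. \<forall>x\<in>space M. F x powr p \<le> b"
proof -
  obtain b where b: "\<forall>x\<in>space M. F x \<le> b" using F_bounded by blast
  have "\<forall>x\<in>space M. F x powr p \<le> b powr p" using b F_nonneg p by (auto intro!: powr_mono2)
  then show ?thesis by blast
qed

lemma integrable_Fp: "integrable M (\<lambda>x. F x powr p)"
proof -
  obtain b where "\<forall>x\<in>space M. F x powr p \<le> b" using Fp_bounded by blast
  then show ?thesis by (intro integrable_bounded_on[of _ _ b]) (auto intro: finite_measure_axioms)
qed

abbreviation "CV \<equiv> cell_const K p N j"
abbreviation "CU \<equiv> maximal_const K p N j"
abbreviation "CA \<equiv> sup_const K p N j"

lemma CV: "1 \<le> CV" and CU: "1 \<le> CU"
  using K p by (auto intro: cell_const_ge_1 maximal_const_ge_1)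

lemma powr_mult_cellmin:
  "w \<in> space M \<Longrightarrow> (2 ^ (N + 1) * cellmin w) powr p = (2 ^ (N + 1)) powr p * cellmin w powr p"
  by (rule powr_mult)

lemma integral_U_le_cells:
  assumes A: "finite A" "A \<subseteq> space M"
  shows "(\<integral>x. U A x \<partial>M) \<le> CV * (\<Sum>w\<in>A. cellmin w powr p * measure M (cell w))"
proof -
  have int: "integrable M (\<lambda>x. (2 ^ (N + 1) * cellmin w) powr p / growth w x)" if "w \<in> A" for w
    using integrable_mult_right[OF integrable_decay[of w n N], of "(2 ^ (N + 1) * cellmin w) powr p"] that A n by auto
  have "(\<integral>x. U A x \<partial>M) = (\<Sum>w\<in>A. \<integral>x. (2 ^ (N + 1) * cellmin w) powr p / growth w x \<partial>M)"
    unfolding U_def[abs_def] using int by (intro Bochner_Integration.integral_sum)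
  also have "\<dots> \<le> (\<Sum>w\<in>A. CV * (cellmin w powr p * measure M (cell w)))"
  proof (rule sum_mono)
    fix w assume "w \<in> A"
    then have w: "w \<in> space M" using A by auto
    have "(\<integral>x. (2 ^ (N + 1) * cellmin w) powr p / growth w x \<partial>M) =
        (2 ^ (N + 1) * cellmin w) powr p * (\<integral>x. 1 / growth w x \<partial>M)"
      by (subst integral_mult_right_zero[symmetric]) simp
    also have "\<dots> \<le> (2 ^ (N + 1) * cellmin w) powr p * (2 ^ (N + 1) * (K ^ j * measure M (cell w)))"
    proof (rule mult_left_mono)
      have "1 / n \<le> 2 ^ j * (\<delta>1 / n)" using \<delta>1(4) n by (simp add: field_simps)
      then have "measure M (B w (1 / n)) \<le> K ^ j * measure M (cell w)"
        using \<delta>1 n by (intro doubling_power w) auto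
      then have "2 ^ (N + 1) * measure M (B w (1 / n)) \<le> 2 ^ (N + 1) * (K ^ j * measure M (cell w))"
        by (intro mult_left_mono) auto
      then show "(\<integral>x. 1 / growth w x \<partial>M) \<le> 2 ^ (N + 1) * (K ^ j * measure M (cell w))"
        using integral_decay[OF w n N] by linarith
    qed simp
    finally show "(\<integral>x. (2 ^ (N + 1) * cellmin w) powr p / growth w x \<partial>M) \<le>
        CV * (cellmin w powr p * measure M (cell w))"
      unfolding cell_const_def powr_mult_cellmin[OF w] by (simp only: mult_ac)
  qed
  finally show ?thesis by (simp add: sum_distrib_left)
qed

lemma cell_integral_ge:
  assumes w: "w \<in> space M" and g: "integrable M g" and c: "\<And>x. x \<in> B w r \<Longrightarrow> c \<le> g x"
  shows "c * measure M (B w r) \<le> (\<integral>x. indicator (B w r) x * g x \<partial>M)"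
proof -
  have "(\<integral>x. indicator (B w r) x * c \<partial>M) \<le> (\<integral>x. indicator (B w r) x * g x \<partial>M)"
    using c w g by (intro integral_mono integrable_indicator_B[OF refl]) (auto simp: indicator_def)
  then show ?thesis unfolding integral_indicator_B[OF refl w] .
qed

lemma cell_integral_le:
  assumes w: "w \<in> space M" and g: "integrable M g" and c: "\<And>x. x \<in> B w r \<Longrightarrow> g x \<le> c"
  shows "(\<integral>x. indicator (B w r) x * g x \<partial>M) \<le> c * measure M (B w r)"
proof -
  have "(\<integral>x. indicator (B w r) x * g x \<partial>M) \<le> (\<integral>x. indicator (B w r) x * c \<partial>M)"
    using c w g by (intro integral_mono integrable_indicator_B[OF refl]) (auto simp: indicator_def)
  then show ?thesis unfolding integral_indicator_B[OF refl w] .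
qed

text \<open>The central estimate: through \<open>Fstar_powr_le\<close> it bounds the integral of the
  power \<open>p\<close> of the maximal function. The minimum over a cell is below \<open>F\<close>
  on the whole cell, and the cells overlap boundedly.\<close>

lemma integral_U_le:
  assumes A: "net (\<delta>1 / n) A"
  shows "(\<integral>x. U A x \<partial>M) \<le> CU * (\<integral>x. F x powr p \<partial>M)"
proof -
  have A': "finite A" "A \<subseteq> space M" using A by (auto simp: net_def)
  have "(\<Sum>w\<in>A. cellmin w powr p * measure M (cell w)) \<le>
      (\<Sum>w\<in>A. \<integral>x. indicator (cell w) x * F x powr p \<partial>M)"
    using A' cellmin_nonneg cellmin_le p
    by (intro sum_mono cell_integral_ge integrable_Fp powr_mono2) auto
  also have "\<dots> \<le> K ^ 4 * (\<integral>x. F x powr p \<partial>M)"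
    using \<delta>1 n by (intro sum_integral_overlap A integrable_Fp) auto
  finally have "CV * (\<Sum>w\<in>A. cellmin w powr p * measure M (cell w)) \<le> CV * (K ^ 4 * (\<integral>x. F x powr p \<partial>M))"
    using CV by (intro mult_left_mono) auto
  then show ?thesis using integral_U_le_cells[OF A'] by (simp add: maximal_const_def mult.assoc)
qed

section \<open>Sums over the balls of a net\<close>

definition "sup_sum A r = (\<Sum>w\<in>A. (SUP x\<in>B w r. F x powr p) * measure M (B w r))"
definition "inf_sum A r = (\<Sum>w\<in>A. (INF x\<in>B w r. F x powr p) * measure M (B w r))"

lemma Fp_le_SUP: "x \<in> B w r \<Longrightarrow> F x powr p \<le> (SUP x\<in>B w r. F x powr p)"
proof -
  assume x: "x \<in> B w r"
  obtain b where "\<forall>x\<in>space M. F x powr p \<le> b" using Fp_bounded by blast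
  then have "bdd_above ((\<lambda>x. F x powr p) ` B w r)"
    using B_subset by (intro bdd_aboveI2[of _ _ b]) auto
  then show ?thesis using x by (rule cSUP_upper2) simp
qed

lemma INF_le_Fp: "x \<in> B w r \<Longrightarrow> (INF x\<in>B w r. F x powr p) \<le> F x powr p"
  by (intro cINF_lower bdd_belowI2[of _ 0]) auto

lemma inf_sum_le_sup_sum:
  assumes "A \<subseteq> space M" "0 \<le> r"
  shows "inf_sum A r \<le> sup_sum A r"
  unfolding inf_sum_def sup_sum_def
proof (intro sum_mono mult_right_mono)
  fix w assume "w \<in> A"
  then have "w \<in> B w r" using assms by (intro in_B_self) auto
  then show "(INF x\<in>B w r. F x powr p) \<le> (SUP x\<in>B w r. F x powr p)"
    using INF_le_Fp Fp_le_SUP by (meson order_trans)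
qed simp

lemma integral_le_sup_sum:
  assumes A: "finite A" "A \<subseteq> space M" "space M = (\<Union>w\<in>A. B w r)"
  shows "(\<integral>x. F x powr p \<partial>M) \<le> sup_sum A r"
proof -
  have "(\<integral>x. F x powr p \<partial>M) \<le> (\<Sum>w\<in>A. \<integral>x. indicator (B w r) x * F x powr p \<partial>M)"
    by (intro integral_le_sum_cover A integrable_Fp) auto
  also have "\<dots> \<le> sup_sum A r"
    unfolding sup_sum_def using A by (intro sum_mono cell_integral_le integrable_Fp Fp_le_SUP) auto
  finally show ?thesis .
qed

lemma Fstar_in_cell:
  assumes "w \<in> space M" "0 \<le> \<delta>" "\<delta> \<le> 1" "x \<in> B w (\<delta> / n)" "y \<in> B w (\<delta> / n)"
  shows "Fstar x \<le> 3 ^ N * Fstar y"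
proof -
  have xy: "x \<in> space M" "y \<in> space M" using assms B_subset by auto
  have "n * d x y \<le> 2 * \<delta>" using dist_B[OF assms(1,4,5)] n by (simp add: field_simps)
  then have "growth x y \<le> 3 ^ N"
    using assms n d_nonneg by (intro power_mono) auto
  then have "growth x y * Fstar y \<le> 3 ^ N * Fstar y"
    using Fstar_nonneg[OF xy(2)] by (intro mult_right_mono)
  then show ?thesis using Fstar_le[OF xy] by simp
qed

text \<open>The auxiliary net \<open>A1\<close> has the fixed mesh \<open>\<delta>1 / n\<close> and
  only serves to form \<open>U\<close>. On a ball of \<open>A\<close> the supremum of
  \<open>F\<close> is at most \<open>3 ^ N\<close> times \<open>Fstar\<close> at any point, so it
  may be averaged over the ball.\<close>

lemma sup_sum_le:
  assumes A: "net (\<delta> / n) A" and \<delta>: "0 < \<delta>" "\<delta> \<le> 1"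
  shows "sup_sum A (\<delta> / n) \<le> CA * (\<integral>x. F x powr p \<partial>M)"
proof -
  have A': "finite A" "A \<subseteq> space M" using A by (auto simp: net_def)
  obtain A1 where A1: "net (\<delta>1 / n) A1" "space M = (\<Union>w\<in>A1. cell w)"
    using maximal_net_exists[of "\<delta>1 / n"] \<delta>1 n by auto
  have A1': "finite A1" "A1 \<subseteq> space M" using A1 by (auto simp: net_def)
  let ?U = "\<lambda>x. (3 ^ N) powr p * U A1 x"
  have intU: "integrable M ?U" using integrable_U[OF A1'] by simp
  have "sup_sum A (\<delta> / n) \<le> (\<Sum>w\<in>A. \<integral>x. indicator (B w (\<delta> / n)) x * ?U x \<partial>M)"
    unfolding sup_sum_def
  proof (intro sum_mono cSUP_mult_le cell_integral_ge intU)
    fix w x y assume w: "w \<in> A" and x: "x \<in> B w (\<delta> / n)" and y: "y \<in> B w (\<delta> / n)"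
    have wM: "w \<in> space M" using w A' by auto
    have xy: "x \<in> space M" "y \<in> space M" using x y B_subset by auto
    have "F x \<le> Fstar x" using F_le_Fstar[OF xy(1), of x] xy(1) by (simp add: d_refl)
    also have "\<dots> \<le> 3 ^ N * Fstar y" using \<delta> by (intro Fstar_in_cell[OF wM _ _ x y]) auto
    finally have "F x powr p \<le> (3 ^ N * Fstar y) powr p"
      using F_nonneg xy p by (intro powr_mono2) auto
    also have "\<dots> = (3 ^ N) powr p * Fstar y powr p" using Fstar_nonneg[OF xy(2)] by (intro powr_mult)
    also have "\<dots> \<le> ?U y" using Fstar_powr_le[OF A1' A1(2) xy(2)] by (intro mult_left_mono) auto
    finally show "F x powr p \<le> ?U y" .
  next
    fix w assume "w \<in> A"
    then show "B w (\<delta> / n) \<noteq> {}" "w \<in> space M"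
      using in_B_self[of w "\<delta> / n"] A' \<delta> n by auto
  qed simp
  also have "\<dots> \<le> K ^ 4 * (\<integral>x. ?U x \<partial>M)"
    using \<delta> n U_nonneg by (intro sum_integral_overlap A intU) auto
  also have "(\<integral>x. ?U x \<partial>M) = (3 ^ N) powr p * (\<integral>x. U A1 x \<partial>M)" by simp
  also have "K ^ 4 * \<dots> \<le> K ^ 4 * ((3 ^ N) powr p * (CU * (\<integral>x. F x powr p \<partial>M)))"
    using K by (intro mult_left_mono integral_U_le A1) auto
  finally show ?thesis by (simp add: sup_const_def mult_ac)
qed

text \<open>For \<open>x\<close>, \<open>y\<close>, \<open>z\<close> in one ball \<open>F x\<close>
  exceeds \<open>F y\<close> by at most a small multiple of \<open>Fstar z\<close>. Varying
  \<open>x\<close> and \<open>y\<close> yields supremum and infimum, integrating over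
  \<open>z\<close> yields the maximal function, and the latter leads back to a small multiple of
  \<open>sup_sum\<close>, which is absorbed.\<close>

lemma sup_sum_le_inf_sum:
  assumes A: "net (\<delta> / n) A" "space M = (\<Union>w\<in>A. B w (\<delta> / n))"
    and \<delta>: "0 < \<delta>" "\<delta> \<le> 1/2" "2 * C * 3 ^ N * \<delta> \<le> 1" "\<delta> \<le> mesh_const K p C N j"
  shows "sup_sum A (\<delta> / n) \<le> 2 * 2 powr p * inf_sum A (\<delta> / n)"
proof -
  have A': "finite A" "A \<subseteq> space M" using A by (auto simp: net_def)
  obtain A1 where A1: "net (\<delta>1 / n) A1" "space M = (\<Union>w\<in>A1. cell w)"
    using maximal_net_exists[of "\<delta>1 / n"] \<delta>1 n by auto
  have A1': "finite A1" "A1 \<subseteq> space M" using A1 by (auto simp: net_def)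
  define \<epsilon> where "\<epsilon> = 2 powr p * (2 * C * 3 ^ N * \<delta>)"
  have \<epsilon>0: "0 \<le> \<epsilon>" using C \<delta> by (simp add: \<epsilon>_def)
  let ?U = "\<lambda>x. \<epsilon> * U A1 x"
  let ?inf = "\<lambda>w. INF x\<in>B w (\<delta> / n). F x powr p"
  have intU: "integrable M ?U" using integrable_U[OF A1'] by simp
  have "sup_sum A (\<delta> / n) \<le> (\<Sum>w\<in>A. 2 powr p * (?inf w * measure M (B w (\<delta> / n))) +
      (\<integral>x. indicator (B w (\<delta> / n)) x * ?U x \<partial>M))"
    unfolding sup_sum_def
  proof (intro sum_mono cSUP_mult_le)
    fix w x assume w: "w \<in> A" and x: "x \<in> B w (\<delta> / n)"
    have wM: "w \<in> space M" using w A' by auto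
    have xM: "x \<in> space M" using x B_subset by auto
    have *: "F x powr p - 2 powr p * F y powr p \<le> ?U z" if y: "y \<in> B w (\<delta> / n)" and z: "z \<in> B w (\<delta> / n)" for y z
    proof -
      have yzM: "y \<in> space M" "z \<in> space M" using y z B_subset by auto
      have nd: "n * d x y \<le> 2 * \<delta>" using dist_B[OF wM x y] n by (simp add: field_simps)
      have "\<bar>F x - F y\<bar> \<le> C * (n * d x y) * Fstar x"
        using nd \<delta> by (intro osc_Fstar xM yzM) auto
      also have "\<dots> \<le> C * (2 * \<delta>) * (3 ^ N * Fstar z)"
      proof (rule mult_mono)
        show "C * (n * d x y) \<le> C * (2 * \<delta>)" using nd C by (intro mult_left_mono) auto
        show "Fstar x \<le> 3 ^ N * Fstar z" using \<delta> by (intro Fstar_in_cell[OF wM _ _ x z]) auto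
      qed (use C \<delta> Fstar_nonneg[OF xM] in auto)
      finally have "F x \<le> F y + (2 * C * 3 ^ N * \<delta>) * Fstar z" by (simp add: mult_ac)
      then have "F x powr p \<le> (F y + (2 * C * 3 ^ N * \<delta>) * Fstar z) powr p"
        using F_nonneg xM p by (intro powr_mono2) auto
      also have "\<dots> \<le> 2 powr p * (F y powr p + ((2 * C * 3 ^ N * \<delta>) * Fstar z) powr p)"
        using F_nonneg[OF yzM(1)] Fstar_nonneg[OF yzM(2)] C \<delta> p by (intro powr_add_le) auto
      also have "((2 * C * 3 ^ N * \<delta>) * Fstar z) powr p = (2 * C * 3 ^ N * \<delta>) powr p * Fstar z powr p"
        using Fstar_nonneg[OF yzM(2)] C \<delta> by (intro powr_mult)
      also have "\<dots> \<le> (2 * C * 3 ^ N * \<delta>) * U A1 z"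
      proof (intro mult_mono Fstar_powr_le A1' A1 yzM)
        \<comment> \<open>For a number in [0, 1] the power \<open>p\<close> is at most the number
          itself, so the smallness condition is linear in \<open>\<delta>\<close>.\<close>
        have "(2 * C * 3 ^ N * \<delta>) powr p \<le> (2 * C * 3 ^ N * \<delta>) powr 1"
          using \<delta> C p by (intro powr_mono') auto
        then show "(2 * C * 3 ^ N * \<delta>) powr p \<le> 2 * C * 3 ^ N * \<delta>" using C \<delta> by simp
      qed (use C \<delta> in auto)
      finally show ?thesis by (simp add: \<epsilon>_def distrib_left mult_ac mult_left_mono)
    qed
    have **: "F x powr p - 2 powr p * ?inf w \<le> ?U z" if z: "z \<in> B w (\<delta> / n)" for z
    proof -
      have "(F x powr p - ?U z) / 2 powr p \<le> ?inf w"
      proof (intro cINF_greatest)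
        fix y assume y: "y \<in> B w (\<delta> / n)"
        have "F x powr p - ?U z \<le> F y powr p * 2 powr p"
          using *[OF y z] unfolding mult.commute[of "2 powr p"] by linarith
        then show "(F x powr p - ?U z) / 2 powr p \<le> F y powr p" by (simp add: pos_divide_le_eq)
      qed (use x in auto)
      then show ?thesis by (simp add: pos_divide_le_eq mult.commute)
    qed
    have "(F x powr p - 2 powr p * ?inf w) * measure M (B w (\<delta> / n)) \<le> (\<integral>x. indicator (B w (\<delta> / n)) x * ?U x \<partial>M)"
      by (intro cell_integral_ge wM intU **)
    then show "F x powr p * measure M (B w (\<delta> / n)) \<le> 2 powr p * (?inf w * measure M (B w (\<delta> / n))) +
      (\<integral>x. indicator (B w (\<delta> / n)) x * ?U x \<partial>M)"
      by (simp add: algebra_simps)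
  next
    fix w assume "w \<in> A"
    then show "B w (\<delta> / n) \<noteq> {}" using in_B_self[of w "\<delta> / n"] A' \<delta> n by auto
  qed simp
  also have "\<dots> = 2 powr p * inf_sum A (\<delta> / n) + (\<Sum>w\<in>A. \<integral>x. indicator (B w (\<delta> / n)) x * ?U x \<partial>M)"
    by (simp add: sum.distrib inf_sum_def sum_distrib_left)
  also have "(\<Sum>w\<in>A. \<integral>x. indicator (B w (\<delta> / n)) x * ?U x \<partial>M) \<le> K ^ 4 * (\<integral>x. ?U x \<partial>M)"
    using \<delta> n U_nonneg \<epsilon>0 by (intro sum_integral_overlap A intU) auto
  also have "(\<integral>x. ?U x \<partial>M) = \<epsilon> * (\<integral>x. U A1 x \<partial>M)" by simp
  also have "K ^ 4 * \<dots> \<le> K ^ 4 * (\<epsilon> * (CU * sup_sum A (\<delta> / n)))"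
  proof (intro mult_left_mono)
    have "CU * (\<integral>x. F x powr p \<partial>M) \<le> CU * sup_sum A (\<delta> / n)"
      using CU by (intro mult_left_mono integral_le_sup_sum A' A) auto
    then show "(\<integral>x. U A1 x \<partial>M) \<le> CU * sup_sum A (\<delta> / n)" using integral_U_le[OF A1(1)] by simp
  qed (use K \<epsilon>0 in auto)
  also have "\<dots> = (K ^ 4 * \<epsilon> * CU) * sup_sum A (\<delta> / n)" by simp
  also have "\<dots> \<le> 1 / 2 * sup_sum A (\<delta> / n)"
  proof (intro mult_right_mono)
    have c: "0 < 2 powr p * 8 * C * 3 ^ N * K ^ 4 * CU" using C K CU by simp
    have "\<delta> * (2 powr p * 8 * C * 3 ^ N * K ^ 4 * CU) \<le> 1"
      using \<delta>(4) c unfolding mesh_const_def by (simp add: pos_le_divide_eq del: mult_pos_pos)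
    then show "K ^ 4 * \<epsilon> * CU \<le> 1 / 2" using \<delta> C K CU by (simp add: \<epsilon>_def mult_ac)
    show "0 \<le> sup_sum A (\<delta> / n)"
      by (rule order.trans[OF _ integral_le_sup_sum[OF A' A(2)]]) simp
  qed
  finally show ?thesis by simp
qed

text \<open>For the second measure \<open>S\<close> (the surface measure, while \<open>M\<close> is \<open>W d\<sigma>\<close>) doubling is only
  needed from scale \<open>\<delta>1 / n\<close> to scale \<open>2 / n\<close>.\<close>

context
  fixes S :: "'a measure" and D :: real
  assumes S_finite: "finite_measure S" and S_sets: "sets S = sets M"
    and S_pos: "\<And>x r. x \<in> space M \<Longrightarrow> 0 < r \<Longrightarrow> 0 < measure S (B x r)"
    and S_doubling: "\<And>x. x \<in> space M \<Longrightarrow> measure S (B x (2 / n)) \<le> D * measure S (cell x)"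
    and D: "0 < D"
    and avg_measurable: "(\<lambda>x. measure M (B x (1 / n)) / measure S (B x (1 / n))) \<in> borel_measurable S"
begin

interpretation S: finite_measure S by (rule S_finite)

definition "avg x = measure M (B x (1 / n)) / measure S (B x (1 / n))"

lemma space_S: "space S = space M" using S_sets by (rule sets_eq_imp_space_eq)

lemma B_sets_S: "x \<in> space M \<Longrightarrow> B x r \<in> sets S" using S_sets by simp

text \<open>As \<open>\<delta>1\<close> is at most 1/2, the ball of radius \<open>1 / n\<close>
  about any point of a cell lies between the cell and the ball of radius \<open>2 / n\<close> about
  its centre.\<close>

lemma avg_bounds:
  assumes w: "w \<in> space M" and x: "x \<in> cell w"
  shows "avg x \<le> measure M (B w (2 / n)) / measure S (cell w)"
    "measure M (cell w) / measure S (B w (2 / n)) \<le> avg x"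
proof -
  have xM: "x \<in> space M" using x B_subset by auto
  have dx: "d w x \<le> \<delta>1 / n" "d x w \<le> \<delta>1 / n" using x d_commute[of w x] by (auto simp: B_def)
  have dn: "\<delta>1 / n \<le> 1 / n - \<delta>1 / n" "1 / n + \<delta>1 / n \<le> 2 / n" "0 \<le> \<delta>1 / n"
    using \<delta>1 n by (auto simp: field_simps)
  have sub: "cell w \<subseteq> B x (1 / n)" "B x (1 / n) \<subseteq> B w (2 / n)"
    using dx dn by (intro B_subset_B w xM; linarith)+
  have m: "measure M (cell w) \<le> measure M (B x (1 / n))" "measure M (B x (1 / n)) \<le> measure M (B w (2 / n))"
    "measure S (cell w) \<le> measure S (B x (1 / n))" "measure S (B x (1 / n)) \<le> measure S (B w (2 / n))"
    using sub w xM by (auto intro!: finite_measure_mono S.finite_measure_mono simp: B_sets_S)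
  have pos: "0 < measure S (cell w)" "0 < measure S (B x (1 / n))" "0 < measure S (B w (2 / n))"
    using w xM \<delta>1 n by (auto intro!: S_pos)
  show "avg x \<le> measure M (B w (2 / n)) / measure S (cell w)"
    "measure M (cell w) / measure S (B w (2 / n)) \<le> avg x"
    unfolding avg_def using m pos by (auto intro!: frac_le)
qed

lemma avg_nonneg: "0 \<le> avg x" by (simp add: avg_def)

text \<open>Finitely many cells cover the space and \<open>avg\<close> is bounded on each, hence
  bounded altogether.\<close>

lemma integrable_Fp_avg: "integrable S (\<lambda>x. F x powr p * avg x)"
proof -
  obtain b where b: "\<forall>x\<in>space M. F x powr p \<le> b" using Fp_bounded by blast
  obtain A where A: "net (\<delta>1 / n) A" "space M = (\<Union>w\<in>A. cell w)"
    using maximal_net_exists[of "\<delta>1 / n"] \<delta>1 n by auto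
  have A': "finite A" "A \<subseteq> space M" using A by (auto simp: net_def)
  define G where "G = (\<Sum>w\<in>A. measure M (B w (2 / n)) / measure S (cell w))"
  have "avg x \<le> G" if x: "x \<in> space M" for x
  proof -
    obtain w where w: "w \<in> A" "x \<in> cell w" using A(2) x by auto
    have "avg x \<le> measure M (B w (2 / n)) / measure S (cell w)"
      using w A' by (intro avg_bounds) auto
    also have "\<dots> \<le> G" unfolding G_def using w A' by (intro member_le_sum[of w A]) auto
    finally show ?thesis .
  qed
  then have "F x powr p * avg x \<le> b * G" if "x \<in> space M" for x
    using that b avg_nonneg powr_ge_zero by (intro mult_mono) (auto intro: order_trans[OF powr_ge_zero])
  moreover have "(\<lambda>x. F x powr p * avg x) \<in> borel_measurable S"
    unfolding avg_def using avg_measurable measurable_Fp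
    by (intro borel_measurable_times) (simp_all add: measurable_cong_sets[OF S_sets refl])
  ultimately show ?thesis
    using avg_nonneg by (intro integrable_bounded_on[OF S_finite, of _ "b * G"]) (auto simp: space_S)
qed

text \<open>On a cell the upper bound for \<open>avg\<close> has the measure of the cell under
  \<open>S\<close> in the denominator, which cancels on integration. What remains is to double the
  radius \<open>j + 1\<close> times in \<open>M\<close>.\<close>

lemma avg_integral_le:
  "(\<integral>x. F x powr p * avg x \<partial>S) \<le> K ^ (j + 1) * CA * (\<integral>x. F x powr p \<partial>M)"
proof -
  obtain A where A: "net (\<delta>1 / n) A" "space M = (\<Union>w\<in>A. cell w)"
    using maximal_net_exists[of "\<delta>1 / n"] \<delta>1 n by auto
  have A': "finite A" "A \<subseteq> space M" using A by (auto simp: net_def)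
  have "(\<integral>x. F x powr p * avg x \<partial>S) \<le>
      (\<Sum>w\<in>A. \<integral>x. indicator (cell w) x * (F x powr p * avg x) \<partial>S)"
    using avg_nonneg by (intro integral_le_sum_cover A A' S_sets integrable_Fp_avg) auto
  also have "\<dots> \<le> (\<Sum>w\<in>A. K ^ (j + 1) * ((SUP x\<in>cell w. F x powr p) * measure M (cell w)))"
  proof (rule sum_mono)
    fix w assume "w \<in> A"
    then have w: "w \<in> space M" using A' by auto
    let ?s = "SUP x\<in>cell w. F x powr p"
    have s0: "0 \<le> ?s"
      using Fp_le_SUP[OF in_B_self[OF w]] \<delta>1 n by (meson divide_nonneg_nonneg less_imp_le order_trans powr_ge_zero)
    have bound: "F x powr p * avg x \<le> ?s * (measure M (B w (2 / n)) / measure S (cell w))"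
      if "x \<in> cell w" for x
      using that s0 avg_nonneg by (intro mult_mono Fp_le_SUP avg_bounds(1) w) auto
    have "(\<integral>x. indicator (cell w) x * (F x powr p * avg x) \<partial>S) \<le>
        (\<integral>x. indicator (cell w) x * (?s * (measure M (B w (2 / n)) / measure S (cell w))) \<partial>S)"
      by (intro integral_mono integrable_indicator_B[OF S_sets] integrable_Fp_avg S.integrable_const w)
        (simp split: split_indicator add: bound del: times_divide_eq_right)
    also have "\<dots> = ?s * measure M (B w (2 / n))"
      using S_pos[OF w, of "\<delta>1 / n"] \<delta>1 n by (subst integral_indicator_B[OF S_sets w]) simp
    also have "\<dots> \<le> ?s * (K ^ (j + 1) * measure M (cell w))"
      using \<delta>1 n s0 by (intro mult_left_mono doubling_power w) (auto simp: field_simps)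
    finally show "(\<integral>x. indicator (cell w) x * (F x powr p * avg x) \<partial>S) \<le>
        K ^ (j + 1) * (?s * measure M (cell w))" by (simp add: mult_ac)
  qed
  also have "\<dots> = K ^ (j + 1) * sup_sum A (\<delta>1 / n)" by (simp add: sup_sum_def sum_distrib_left)
  also have "\<dots> \<le> K ^ (j + 1) * (CA * (\<integral>x. F x powr p \<partial>M))"
    using K \<delta>1 by (intro mult_left_mono sup_sum_le A) auto
  finally show ?thesis by (simp add: mult.assoc)
qed

text \<open>The minimum of \<open>F\<close> over a cell is paired with the lower bound for
  \<open>avg\<close>, whose denominator is the measure under \<open>S\<close> of the ball of radius
  \<open>2 / n\<close>; its doubling brings this back to the cell.\<close>

lemma integral_le_avg:
  "(\<integral>x. F x powr p \<partial>M) \<le> CV * D * K ^ 4 * (\<integral>x. F x powr p * avg x \<partial>S)"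
proof -
  obtain A where A: "net (\<delta>1 / n) A" "space M = (\<Union>w\<in>A. cell w)"
    using maximal_net_exists[of "\<delta>1 / n"] \<delta>1 n by auto
  have A': "finite A" "A \<subseteq> space M" using A by (auto simp: net_def)
  have "(\<integral>x. F x powr p \<partial>M) \<le> (\<integral>x. U A x \<partial>M)"
  proof (intro integral_mono integrable_Fp integrable_U A')
    fix x assume x: "x \<in> space M"
    have "F x \<le> Fstar x" using F_le_Fstar[OF x, of x] x by (simp add: d_refl)
    then have "F x powr p \<le> Fstar x powr p" using F_nonneg[OF x] p by (intro powr_mono2) auto
    then show "F x powr p \<le> U A x" using Fstar_powr_le[OF A' A(2) x] by simp
  qed
  also have "\<dots> \<le> CV * (\<Sum>w\<in>A. cellmin w powr p * measure M (cell w))"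
    by (rule integral_U_le_cells[OF A'])
  also have "\<dots> \<le> CV * (\<Sum>w\<in>A. D * (\<integral>x. indicator (cell w) x * (F x powr p * avg x) \<partial>S))"
  proof (intro mult_left_mono sum_mono)
    fix w assume "w \<in> A"
    then have w: "w \<in> space M" using A' by auto
    let ?m = "measure M (cell w)" and ?s = "measure S (cell w)" and ?s2 = "measure S (B w (2 / n))"
    have pos: "0 < ?s" "0 < ?s2" using S_pos[OF w] \<delta>1 n by auto
    have bound: "cellmin w powr p * (?m / ?s2) \<le> F x powr p * avg x" if x: "x \<in> cell w" for x
      using x p cellmin_nonneg[OF w] cellmin_le[OF x]
      by (intro mult_mono powr_mono2 avg_bounds(2) w) auto
    have "cellmin w powr p * ?m = cellmin w powr p * (?m / ?s2) * ?s2" using pos by simp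
    also have "\<dots> \<le> cellmin w powr p * (?m / ?s2) * (D * ?s)"
      using S_doubling[OF w] by (intro mult_left_mono) auto
    also have "\<dots> = D * (\<integral>x. indicator (cell w) x * (cellmin w powr p * (?m / ?s2)) \<partial>S)"
      by (subst integral_indicator_B[OF S_sets w]) simp
    also have "\<dots> \<le> D * (\<integral>x. indicator (cell w) x * (F x powr p * avg x) \<partial>S)"
    proof (rule mult_left_mono, rule integral_mono)
      show "indicator (cell w) x * (cellmin w powr p * (?m / ?s2)) \<le>
        indicator (cell w) x * (F x powr p * avg x)" for x
        using bound[of x] by (simp split: split_indicator del: times_divide_eq_right)
    qed (use D in \<open>auto intro!: integrable_indicator_B[OF S_sets _ w] integrable_Fp_avg\<close>)
    finally show "cellmin w powr p * ?m \<le> D * (\<integral>x. indicator (cell w) x * (F x powr p * avg x) \<partial>S)" .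
  qed (use CV in simp)
  also have "\<dots> = CV * D * (\<Sum>w\<in>A. \<integral>x. indicator (cell w) x * (F x powr p * avg x) \<partial>S)"
    by (simp add: sum_distrib_left mult.assoc)
  also have "\<dots> \<le> CV * D * (K ^ 4 * (\<integral>x. F x powr p * avg x \<partial>S))"
    using CV D \<delta>1 n avg_nonneg
    by (intro mult_left_mono sum_integral_overlap A S_sets integrable_Fp_avg) auto
  finally show ?thesis by (simp add: mult.assoc)
qed

end
end

section \<open>Surface measure is doubling\<close>

lemma space_surface_measure: "space (surface_measure :: (real ^ 'n) measure) = sphere 0 1"
  by (simp add: surface_measure_def space_scale_measure)

lemma sets_surface_measure:
  fixes E :: "(real ^ 'n) set"
  assumes "E \<in> sets borel" "E \<subseteq> sphere 0 1"
  shows "E \<in> sets surface_measure"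
proof -
  have "E \<in> sets (restrict_space borel (sphere 0 1))" using assms by (auto simp: sets_restrict_space)
  then show ?thesis unfolding surface_measure_def by (intro sets_completionI_sets) simp
qed

definition cone :: "(real ^ 'n) set \<Rightarrow> (real ^ 'n) set" where
  "cone E = {x \<in> cball 0 1 - {0}. sgn x \<in> E}"

lemma cone_borel:
  fixes E :: "(real ^ 'n) set"
  assumes "E \<in> sets borel" shows "cone E \<in> sets borel"
proof -
  have [measurable]: "(\<lambda>x :: real ^ 'n. x /\<^sub>R norm x) \<in> borel_measurable borel" by measurable
  have "(\<lambda>x :: real ^ 'n. x /\<^sub>R norm x) -` E \<inter> space borel \<in> sets borel"
    by (rule measurable_sets[OF _ assms]) measurable
  moreover have "cone E = (cball 0 1 - {0}) \<inter> ((\<lambda>x. x /\<^sub>R norm x) -` E \<inter> space borel)"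
    by (auto simp: cone_def sgn_div_norm)
  ultimately show ?thesis by (auto intro!: sets.Int)
qed

lemma cone_lmeasurable: "E \<in> sets borel \<Longrightarrow> cone E \<in> lmeasurable"
  using cone_borel[of E] by (intro bounded_set_imp_lmeasurable) (auto simp: cone_def bounded_iff)

lemma emeasure_lborel_cone_finite:
  fixes E :: "(real ^ 'n) set"
  shows "emeasure lborel (cone E) < \<infinity>"
proof -
  have "emeasure lborel (cone E) \<le> emeasure lborel (cball 0 1 :: (real ^ 'n) set)"
    by (intro emeasure_mono) (auto simp: cone_def)
  then show ?thesis using emeasure_lborel_cball_finite order.strict_trans1 by blast
qed

lemma measure_surface_measure:
  fixes E :: "(real ^ 'n) set"
  assumes "E \<in> sets borel" "E \<subseteq> sphere 0 1"
  shows "measure surface_measure E = CARD('n) * measure lebesgue (cone E)"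
  using emeasure_surface_measure[OF assms] cone_borel[OF assms(1)]
  unfolding measure_def cone_def[symmetric] by (simp add: enn2real_mult)

lemma finite_measure_surface_measure: "finite_measure (surface_measure :: (real ^ 'n) measure)"
proof
  have "sphere (0 :: real ^ 'n) 1 \<in> sets borel" by simp
  then show "emeasure surface_measure (space (surface_measure :: (real ^ 'n) measure)) \<noteq> \<infinity>"
    unfolding space_surface_measure
    using emeasure_surface_measure[of "sphere (0 :: real ^ 'n) 1"] emeasure_lborel_cone_finite[of "sphere (0 :: real ^ 'n) 1"]
    by (simp add: cone_def ennreal_mult_eq_top_iff)
qed

text \<open>For a unit vector \<open>x\<close> this keeps the component of \<open>z\<close> along
  \<open>x\<close> and shrinks the orthogonal one by the factor \<open>l\<close>.\<close>

definition contract :: "real \<Rightarrow> real ^ 'n \<Rightarrow> real ^ 'n \<Rightarrow> real ^ 'n" where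
  "contract l x z = l *\<^sub>R z + ((1 - l) * (z \<bullet> x)) *\<^sub>R x"

lemma norm_contract_sq:
  assumes "norm x = 1"
  shows "(norm (contract l x z))\<^sup>2 = (z \<bullet> x)\<^sup>2 + l\<^sup>2 * ((norm z)\<^sup>2 - (z \<bullet> x)\<^sup>2)"
proof -
  have "x \<bullet> x = 1" using assms by (simp add: dot_square_norm)
  then show ?thesis
    unfolding power2_norm_eq_inner contract_def
    by (simp add: inner_add_left inner_add_right inner_commute[of x z] power2_eq_square algebra_simps)
qed

text \<open>The homothety \<open>w \<mapsto> l w + (1 - l) x\<close> scales volumes by a power of \<open>l\<close>, and it maps the cone over
  \<open>E\<close> into the cone over the contracted set.\<close>

lemma measure_surface_contract:
  fixes x :: "real ^ 'n"
  assumes x: "norm x = 1" and l: "0 < l" "l \<le> 1/2"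
    and E: "E \<in> sets borel" "E \<subseteq> sphere 0 1" and E': "E' \<in> sets borel" "E' \<subseteq> sphere 0 1"
    and pos: "\<And>z. z \<in> E \<Longrightarrow> 0 < z \<bullet> x"
    and map: "\<And>z k. z \<in> E \<Longrightarrow> 0 < k \<Longrightarrow> k \<le> 2 * l \<Longrightarrow> sgn (contract k x z) \<in> E'"
  shows "l ^ CARD('n) * measure surface_measure E \<le> measure surface_measure E'"
proof -
  let ?H = "\<lambda>w. l *\<^sub>R w + (1 - l) *\<^sub>R x"
  have sub: "?H ` cone E \<subseteq> cone E'"
  proof (rule image_subsetI)
    fix w assume w: "w \<in> cone E"
    define t where "t = norm w"
    define z where "z = sgn w"
    have w0: "0 < t" "t \<le> 1" "z \<in> E" and wz: "w = t *\<^sub>R z"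
      using w by (auto simp: cone_def t_def z_def sgn_div_norm)
    define c where "c = z \<bullet> x"
    have c: "0 < c" "c \<le> 1"
      using pos[OF w0(3)] abs_inner_le_1[of z x] x w0(3) E by (auto simp: c_def)
    \<comment> \<open>For \<open>w = t *\<^sub>R z\<close> the point \<open>?H w\<close> is a
      positive multiple of \<open>contract k x z\<close>, with \<open>D\<close> normalizing the
      coefficients. Since \<open>k\<close> depends on \<open>t\<close>, the hypothesis
      \<open>map\<close> is needed for a whole range of \<open>k\<close>; the limit
      \<open>2 * l\<close> results from \<open>1/2 \<le> D\<close>.\<close>
    define D where "D = (1 - l) + l * t * c"
    have D: "1/2 \<le> D" using l w0 c by (simp add: D_def add_increasing2)
    define k where "k = l * t * c / D"
    have k0: "0 < k" using l w0 c D by (simp add: k_def)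
    have "l * t * c \<le> l * 1 * 1" using l w0 c by (intro mult_mono) auto
    then have k1: "k \<le> 2 * l" using D l mult_left_mono[OF D, of "2 * l"] by (simp add: k_def pos_divide_le_eq)
    have k': "1 - k = (1 - l) / D" using D by (simp add: k_def D_def field_simps)
    have "contract k x z = (l * t * c / D) *\<^sub>R z + ((1 - l) / D * c) *\<^sub>R x"
      unfolding contract_def k' c_def[symmetric] by (simp only: k_def)
    also have "\<dots> = (c / D) *\<^sub>R ?H w" by (simp add: wz scaleR_add_right mult_ac)
    finally have "contract k x z = (c / D) *\<^sub>R ?H w" .
    then have "sgn (contract k x z) = sgn (?H w)" using c D by (simp add: sgn_scaleR)
    then have s: "sgn (?H w) \<in> E'" using map[OF w0(3) k0 k1] by simp
    then have "?H w \<noteq> 0" using E' by auto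
    moreover have "norm (?H w) \<le> 1"
    proof -
      have "norm (?H w) \<le> norm (l *\<^sub>R w) + norm ((1 - l) *\<^sub>R x)" by (rule norm_triangle_ineq)
      also have "\<dots> \<le> l * 1 + (1 - l)" using l w0 x by (auto simp: t_def intro!: mult_left_mono)
      finally show ?thesis by simp
    qed
    ultimately show "?H w \<in> cone E'" using s by (simp add: cone_def)
  qed
  have img: "measure lebesgue (?H ` cone E) = l ^ CARD('n) * measure lebesgue (cone E)"
    using measure_lebesgue_affine[of l "(1 - l) *\<^sub>R x" "cone E"] l by simp
  have "measure lebesgue (?H ` cone E) \<le> measure lebesgue (cone E')"
  proof (rule measure_mono_fmeasurable[OF sub _ cone_lmeasurable[OF E'(1)]])
    have "?H ` cone E = (\<lambda>w. (1 / l) *\<^sub>R (w - (1 - l) *\<^sub>R x)) -` cone E"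
      using l by (force simp: image_iff vimage_def)
    moreover have "(\<lambda>w. (1 / l) *\<^sub>R (w - (1 - l) *\<^sub>R x)) -` cone E \<inter> space borel \<in> sets borel"
      by (rule measurable_sets[OF _ cone_borel[OF E(1)]]) measurable
    ultimately show "?H ` cone E \<in> sets lebesgue" by simp
  qed
  then show ?thesis
    unfolding measure_surface_measure[OF E] measure_surface_measure[OF E'] img
    by (simp add: mult.left_commute mult_left_mono)
qed

section \<open>Surface measure of the balls of \<open>\<rho>\<close>\<close>

context spherical_cap
begin

lemma closed_cap: "closed (cap e \<alpha>)"
proof -
  have "cap e \<alpha> = {x. norm x = 1} \<inter> {x. cos \<alpha> \<le> x \<bullet> e}" by (auto simp: cap_iff)
  moreover have "closed {x :: real ^ 'n. norm x = 1}" by (intro closed_Collect_eq continuous_intros)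
  moreover have "closed {x. cos \<alpha> \<le> x \<bullet> e}" by (intro closed_Collect_le continuous_intros)
  ultimately show ?thesis by auto
qed

lemma rho_continuous: "x \<in> cap e \<alpha> \<Longrightarrow> continuous_on (cap e \<alpha>) (\<rho> x)"
  unfolding rho_def geodesic_dist_def
  using abs_inner_le_1[of x] abs_inner_le_1[OF _ e] cap_D(1)
  by (intro continuous_intros) (auto simp: abs_le_iff)

lemma rho_ball_borel:
  assumes "x \<in> cap e \<alpha>"
  shows "rho_ball e \<alpha> x r \<in> sets borel" "rho_ball e \<alpha> x r \<subseteq> sphere 0 1"
proof -
  have "closed (rho_ball e \<alpha> x r)" unfolding rho_ball_def
    by (intro continuous_on_closed_Collect_le rho_continuous assms closed_cap continuous_intros)
  then show "rho_ball e \<alpha> x r \<in> sets borel" by (rule borel_closed)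
  show "rho_ball e \<alpha> x r \<subseteq> sphere 0 1" by (auto simp: rho_ball_def cap_def)
qed

text \<open>Two points of the cap enclose an angle of at most 2\<alpha>, hence at most 1, which is
  below pi/3.\<close>

lemma inner_cap_ge:
  assumes "x \<in> cap e \<alpha>" "z \<in> cap e \<alpha>"
  shows "1/2 \<le> z \<bullet> x"
proof -
  note n = cap_D(1)[OF assms(1)] cap_D(1)[OF assms(2)]
  have i: "-1 \<le> z \<bullet> x" "z \<bullet> x \<le> 1" using abs_inner_le_1[OF n(2,1)] by (auto simp: abs_le_iff)
  have "arccos (z \<bullet> x) \<le> arccos (z \<bullet> e) + arccos (e \<bullet> x)" by (rule arccos_inner_triangle[OF n(2) e n(1)])
  also have "\<dots> \<le> 2 * \<alpha>" using angle(2)[OF assms(1)] angle(2)[OF assms(2)]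
    by (simp add: angle_def geodesic_dist_def inner_commute)
  finally have "arccos (z \<bullet> x) \<le> pi / 3" using \<alpha> pi_gt3 by simp
  then have "cos (pi / 3) \<le> cos (arccos (z \<bullet> x))"
    using i pi_gt3 by (intro cos_monotone_0_pi_le arccos_lbound) auto
  then show ?thesis using i by (simp add: cos_60)
qed

text \<open>The contracted point lies on the arc from \<open>x\<close> to \<open>z\<close>, and caps
  are convex. The factor is only \<open>sqrt l\<close>: the height changes by a multiple of
  \<open>l\<close>, and near the boundary the square root of this change counts.\<close>

lemma contract_cap:
  assumes x: "x \<in> cap e \<alpha>" and z: "z \<in> cap e \<alpha>" and l: "0 < l" "l \<le> 1"
  shows "sgn (contract l x z) \<in> cap e \<alpha>"
    "hdist x (sgn (contract l x z)) \<le> 11 * sqrt l * hdist x z"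
proof -
  note nx = cap_D(1)[OF x] and nz = cap_D(1)[OF z]
  define w where "w = contract l x z"
  define c where "c = z \<bullet> x"
  have c: "1/2 \<le> c" "c \<le> 1"
    using inner_cap_ge[OF x z] abs_inner_le_1[OF nz nx] by (auto simp: c_def)
  have c2: "c\<^sup>2 \<le> 1" using c by (simp add: power_le_one)
  have w2: "(norm w)\<^sup>2 = c\<^sup>2 + l\<^sup>2 * (1 - c\<^sup>2)"
    unfolding w_def c_def norm_contract_sq[OF nx] nz by simp
  have wc: "c \<le> norm w"
  proof (rule power2_le_imp_le)
    have "0 \<le> l\<^sup>2 * (1 - c\<^sup>2)" using c2 by (intro mult_nonneg_nonneg) auto
    then show "c\<^sup>2 \<le> (norm w)\<^sup>2" unfolding w2 by simp
  qed simp
  have w0: "0 < norm w" using wc c by linarith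
  have wle: "norm w \<le> l + (1 - l) * c"
  proof -
    have "norm w \<le> norm (l *\<^sub>R z) + norm (((1 - l) * (z \<bullet> x)) *\<^sub>R x)"
      unfolding w_def contract_def by (rule norm_triangle_ineq)
    then show ?thesis using nz nx l c by (simp add: c_def abs_mult)
  qed
  have we: "w \<bullet> e = l * (z \<bullet> e) + (1 - l) * c * (x \<bullet> e)"
    by (simp add: w_def contract_def inner_add_left c_def)
  have se: "sgn w \<bullet> e = (w \<bullet> e) / norm w" by (simp add: sgn_div_norm divide_inverse mult.commute)
  show cap: "sgn (contract l x z) \<in> cap e \<alpha>"
  proof -
    \<comment> \<open>Convexity: \<open>w\<close> combines \<open>z\<close> and \<open>x\<close>
      with nonnegative coefficients whose sum is at least \<open>norm w\<close>.\<close>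
    have "cos \<alpha> * norm w \<le> cos \<alpha> * (l + (1 - l) * c)"
      using wle cos_\<alpha> by (intro mult_left_mono) auto
    also have "\<dots> = l * cos \<alpha> + (1 - l) * c * cos \<alpha>" by (simp add: algebra_simps)
    also have "\<dots> \<le> w \<bullet> e"
      unfolding we using cap_D(2)[OF x] cap_D(2)[OF z] l c by (intro add_mono mult_left_mono) auto
    finally have "cos \<alpha> \<le> sgn w \<bullet> e" unfolding se using w0 by (simp add: pos_le_divide_eq)
    moreover have "norm (sgn w) = 1" using w0 by (simp add: norm_sgn)
    ultimately show ?thesis by (simp add: cap_iff w_def)
  qed
  have zx2: "(norm (z - x))\<^sup>2 = 2 - 2 * c" unfolding c_def by (rule norm_diff_sq_sphere[OF nz nx])
  have zc: "norm (z - c *\<^sub>R x) \<le> norm (z - x)"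
  proof (rule power2_le_imp_le)
    have "(norm (z - c *\<^sub>R x))\<^sup>2 = (1 - c) * (1 + c)"
      unfolding c_def norm_sub_proj_sq[OF nz nx] by (simp add: power2_eq_square algebra_simps)
    also have "\<dots> \<le> (1 - c) * 2" using c by (intro mult_left_mono) auto
    finally show "(norm (z - c *\<^sub>R x))\<^sup>2 \<le> (norm (z - x))\<^sup>2" unfolding zx2 by simp
  qed simp
  define s where "s = norm (x - z) + \<bar>sqrt (height x) - sqrt (height z)\<bar>"
  have s0: "0 \<le> s" and sz: "norm (z - x) \<le> s" by (auto simp: s_def norm_minus_commute)
  have d1: "norm (x - sgn w) \<le> 4 * l * s"
  proof -
    have wcx: "w - c *\<^sub>R x = l *\<^sub>R (z - c *\<^sub>R x)" by (simp add: w_def contract_def c_def algebra_simps)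
    have n1: "norm (w - c *\<^sub>R x) \<le> l * s"
      unfolding wcx using l zc sz by (simp add: mult_left_mono)
    have "norm (c *\<^sub>R x) = c" using nx c by simp
    then have "\<bar>norm w - c\<bar> \<le> l * s" using norm_triangle_ineq3[of w "c *\<^sub>R x"] n1 by simp
    then have n2: "norm ((c - norm w) *\<^sub>R x) \<le> l * s" using nx by (simp add: abs_minus_commute)
    have eq: "w - norm w *\<^sub>R x = (w - c *\<^sub>R x) + (c - norm w) *\<^sub>R x" by (simp add: algebra_simps)
    have n3: "norm (w - norm w *\<^sub>R x) \<le> 2 * (l * s)"
      unfolding eq using norm_triangle_ineq[of "w - c *\<^sub>R x" "(c - norm w) *\<^sub>R x"] n1 n2 by linarith
    have "sgn w - x = (1 / norm w) *\<^sub>R (w - norm w *\<^sub>R x)"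
      using w0 by (simp add: sgn_div_norm algebra_simps divide_inverse)
    then have "norm (sgn w - x) = norm (w - norm w *\<^sub>R x) / norm w" using w0 by simp
    also have "\<dots> \<le> 2 * (l * s) / (1/2)" using n3 w0 wc c l s0 by (intro frac_le) auto
    finally show ?thesis by (simp add: norm_minus_commute)
  qed
  \<comment> \<open>The change splits into \<open>l\<close> times the difference of heights and the
    defect of \<open>norm w\<close> in the triangle inequality, which is of second order in
    \<open>s\<close>.\<close>
  have d2: "\<bar>height (sgn w) - height x\<bar> \<le> l * (4 * s * sqrt (height x) + 3 * s\<^sup>2)"
  proof -
    have vx: "0 \<le> x \<bullet> e" "x \<bullet> e \<le> 1" using cap_D[OF x] cos_\<alpha> by auto
    have e1: "w \<bullet> e - norm w * (x \<bullet> e) = l * (z \<bullet> e - x \<bullet> e) + (x \<bullet> e) * (l + (1 - l) * c - norm w)"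
      by (simp add: we algebra_simps)
    have "0 \<le> (x \<bullet> e) * (l + (1 - l) * c - norm w)" using vx wle by simp
    moreover have "(x \<bullet> e) * (l + (1 - l) * c - norm w) \<le> 1 * (l * (1 - c))"
      using vx wle wc by (intro mult_mono) (auto simp: algebra_simps)
    moreover have "l * (1 - c) \<le> l * (s\<^sup>2 / 2)"
    proof (intro mult_left_mono)
      have "(norm (z - x))\<^sup>2 \<le> s\<^sup>2" using sz by (intro power_mono) auto
      then show "1 - c \<le> s\<^sup>2 / 2" using zx2 by simp
    qed (use l in simp)
    ultimately have e2: "\<bar>(x \<bullet> e) * (l + (1 - l) * c - norm w)\<bar> \<le> l * (s\<^sup>2 / 2)" by simp
    have "\<bar>height z - height x\<bar> \<le> s * (2 * sqrt (height x) + s)"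
    proof -
      let ?p = "sqrt (height z)" and ?q = "sqrt (height x)"
      have h: "0 \<le> height z" "0 \<le> height x" using cap_D(4) x z by auto
      then have "\<bar>height z - height x\<bar> = \<bar>?p - ?q\<bar> * (?p + ?q)"
        by (simp add: abs_sqrt_diff_mult_add)
      also have "\<dots> \<le> s * (2 * ?q + s)"
      proof (intro mult_mono)
        show "\<bar>?p - ?q\<bar> \<le> s" unfolding s_def using norm_ge_zero[of "x - z"] by linarith
        then show "?p + ?q \<le> 2 * ?q + s" by linarith
      qed (use h s0 in auto)
      finally show ?thesis .
    qed
    then have e3: "\<bar>l * (z \<bullet> e - x \<bullet> e)\<bar> \<le> l * (s * (2 * sqrt (height x) + s))"
      using l by (simp add: abs_mult height_def)
    have "height (sgn w) - height x = (w \<bullet> e - norm w * (x \<bullet> e)) / norm w"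
      using w0 by (simp add: height_def se diff_divide_distrib)
    then have "\<bar>height (sgn w) - height x\<bar> = \<bar>w \<bullet> e - norm w * (x \<bullet> e)\<bar> / norm w"
      using w0 by simp
    also have "\<dots> \<le> (l * (s * (2 * sqrt (height x) + s)) + l * (s\<^sup>2 / 2)) / (1/2)"
    proof (intro frac_le)
      show "\<bar>w \<bullet> e - norm w * (x \<bullet> e)\<bar> \<le> l * (s * (2 * sqrt (height x) + s)) + l * (s\<^sup>2 / 2)"
        unfolding e1 using e2 e3 by (intro order.trans[OF abs_triangle_ineq] add_mono)
    qed (use wc c l s0 cap_D(4)[OF x] in auto)
    also have "\<dots> = l * (4 * s * sqrt (height x) + 3 * s\<^sup>2)"
      by (simp add: power2_eq_square algebra_simps)
    finally show ?thesis .
  qed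
  have ll: "l \<le> sqrt l"
    using l by (intro real_le_rsqrt) (simp add: power2_eq_square mult_left_le)
  have d3: "\<bar>sqrt (height x) - sqrt (height (sgn w))\<bar> \<le> 7 * sqrt l * s"
  proof -
    let ?q = "sqrt (height x)" and ?r = "sqrt (height (sgn w))"
    have h: "0 \<le> height (sgn w)" "0 \<le> height x"
      using cap_D(4) x cap by (auto simp: w_def)
    have r0: "0 \<le> ?r" using h by simp
    \<comment> \<open>If \<open>s\<close> is at most \<open>sqrt (height x)\<close>, division by
      that root gives a bound linear in \<open>l\<close>. Otherwise \<open>x\<close> is close to the
      boundary compared with \<open>s\<close>, and the root of a change of order
      \<open>l * s\<^sup>2\<close> is taken.\<close>
    show ?thesis
    proof (cases "s \<le> ?q \<and> 0 < ?q")
      case True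
      have "\<bar>?q - ?r\<bar> \<le> \<bar>height x - height (sgn w)\<bar> / ?q"
        using True h r0 by (intro abs_sqrt_diff_le) auto
      also have "\<dots> \<le> (l * (7 * s * ?q)) / ?q"
      proof (intro divide_right_mono)
        have "s\<^sup>2 \<le> s * ?q" using True s0 by (simp add: power2_eq_square mult_left_mono)
        then have "l * (4 * s * ?q + 3 * s\<^sup>2) \<le> l * (7 * s * ?q)" using l by (intro mult_left_mono) auto
        then show "\<bar>height x - height (sgn w)\<bar> \<le> l * (7 * s * ?q)" using d2 by (simp add: abs_minus_commute)
      qed (use True in simp)
      also have "\<dots> = 7 * l * s" using True by simp
      also have "\<dots> \<le> 7 * sqrt l * s" using ll s0 by (intro mult_right_mono) auto
      finally show ?thesis .
    next
      case False
      have qs: "?q \<le> s" using False h s0 by (cases "?q = 0") auto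
      have "\<bar>?q - ?r\<bar>\<^sup>2 \<le> \<bar>height x - height (sgn w)\<bar>" by (intro abs_sqrt_diff_sq_le h)
      also have "\<dots> \<le> l * (4 * s * ?q + 3 * s\<^sup>2)" using d2 by (simp add: abs_minus_commute)
      also have "\<dots> \<le> l * (4 * s * s + 3 * s\<^sup>2)" using qs s0 l by (intro mult_left_mono add_right_mono) auto
      also have "\<dots> \<le> (7 * sqrt l * s)\<^sup>2" using l s0 by (simp add: power_mult_distrib power2_eq_square)
      finally show ?thesis using l s0 by (intro power2_le_imp_le[of "\<bar>?q - ?r\<bar>"]) auto
    qed
  qed
  have "4 * l * s \<le> 4 * sqrt l * s" using ll s0 by (intro mult_right_mono) auto
  then have "norm (x - sgn w) + \<bar>sqrt (height x) - sqrt (height (sgn w))\<bar> \<le> 11 * sqrt l * s"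
    using d1 d3 by simp
  then show "hdist x (sgn (contract l x z)) \<le> 11 * sqrt l * hdist x z"
    using \<alpha> by (simp add: hdist_def s_def w_def divide_right_mono)
qed

text \<open>704 = 16 * 11 * 4: two passages between \<open>\<rho>\<close> and \<open>hdist\<close>
  and the factor of \<open>contract_cap\<close>; \<open>2 * l\<close> is the largest contraction
  factor that occurs.\<close>

lemma surface_doubling:
  assumes x: "x \<in> cap e \<alpha>" and l: "0 < l" "l \<le> 1/2" and r: "704 * sqrt (2 * l) * r \<le> r'"
  shows "l ^ CARD('n) * measure surface_measure (rho_ball e \<alpha> x r) \<le> measure surface_measure (rho_ball e \<alpha> x r')"
proof (intro measure_surface_contract cap_D(1) x l rho_ball_borel)
  fix z k assume z: "z \<in> rho_ball e \<alpha> x r" and k: "0 < k" "k \<le> 2 * l"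
  then have zc: "z \<in> cap e \<alpha>" "\<rho> x z \<le> r" by (auto simp: rho_ball_def)
  have k1: "k \<le> 1" using k l by simp
  have r0: "0 \<le> r" using zc rho_nonneg order.trans by blast
  have "\<rho> x (sgn (contract k x z)) \<le> 16 * hdist x (sgn (contract k x z))"
    by (intro rho_le_hdist x contract_cap zc k k1)
  also have "\<dots> \<le> 16 * (11 * sqrt k * hdist x z)"
    using contract_cap(2)[OF x zc(1) k(1) k1] by simp
  also have "\<dots> \<le> 16 * (11 * sqrt (2 * l) * (4 * r))"
    using hdist_le_rho[OF x zc(1)] zc(2) k r0 hdist_nonneg by (intro mult_left_mono mult_mono) auto
  also have "\<dots> \<le> r'" using r by simp
  finally show "sgn (contract k x z) \<in> rho_ball e \<alpha> x r'"
    using contract_cap(1)[OF x zc(1) k(1) k1] by (simp add: rho_ball_def)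
next
  fix z assume "z \<in> rho_ball e \<alpha> x r"
  then show "0 < z \<bullet> x" using inner_cap_ge[OF x, of z] by (auto simp: rho_ball_def)
qed (use x in simp_all)

end

section \<open>Doubling weights on a cap\<close>

definition full_doubling_const :: "real \<Rightarrow> real" where
  "full_doubling_const L = max 1 L ^ 3"

definition osc_const :: "nat \<Rightarrow> real" where
  "osc_const N = 26880 * (real N + 1) * 70 ^ N * (1 + 5 ^ N) * 16 ^ N"

lemma osc_const_ge_1: "1 \<le> osc_const N"
proof -
  have "1 * 1 * 1 * 1 * 1 \<le> 26880 * (real N + 1) * 70 ^ N * (1 + 5 ^ N) * (16 :: real) ^ N"
    by (intro mult_mono one_le_power) auto
  then show ?thesis by (simp add: osc_const_def)
qed

lemma equiv_constI: "0 < C \<Longrightarrow> A \<le> C * B \<Longrightarrow> B \<le> C * A \<Longrightarrow> equiv_const C A B"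
  by (simp add: equiv_const_def field_simps)

locale weighted_cap = spherical_cap e \<alpha> for e :: "real ^ 'n" and \<alpha> :: real +
  fixes W :: "real ^ 'n \<Rightarrow> real" and L :: real
  assumes W: "doubling_weight e \<alpha> L W"
begin

definition "\<sigma> = restrict_space surface_measure (cap e \<alpha>)"
definition "\<nu> = density \<sigma> (\<lambda>x. ennreal (W x))"

lemma cap_borel: "cap e \<alpha> \<in> sets borel" using closed_cap by (rule borel_closed)

lemma cap_subset: "cap e \<alpha> \<subseteq> sphere 0 1" by (auto simp: cap_def)

lemma cap_sets: "cap e \<alpha> \<inter> space surface_measure \<in> sets surface_measure"
  using cap_subset sets_surface_measure[OF cap_borel] by (simp add: space_surface_measure Int_absorb2)

lemma space_\<sigma>: "space \<sigma> = cap e \<alpha>"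
  using cap_subset by (auto simp: \<sigma>_def space_restrict_space space_surface_measure)

lemma space_\<nu>: "space \<nu> = cap e \<alpha>" by (simp add: \<nu>_def space_\<sigma>)

lemma sets_\<nu>: "sets \<nu> = sets \<sigma>" by (simp add: \<nu>_def)

lemma sets_\<sigma>: "E \<in> sets borel \<Longrightarrow> E \<subseteq> cap e \<alpha> \<Longrightarrow> E \<in> sets \<sigma>"
  unfolding \<sigma>_def using cap_sets cap_subset sets_surface_measure[of E]
  by (subst sets_restrict_space_iff) auto

lemma finite_\<sigma>: "finite_measure \<sigma>"
proof -
  interpret s: finite_measure "surface_measure :: (real ^ 'n) measure" by (rule finite_measure_surface_measure)
  show ?thesis
  proof
    show "emeasure \<sigma> (space \<sigma>) \<noteq> \<infinity>"
      unfolding space_\<sigma> unfolding \<sigma>_def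
      using s.emeasure_finite by (subst emeasure_restrict_space[OF cap_sets]) auto
  qed
qed

lemma measure_\<sigma>: "E \<subseteq> cap e \<alpha> \<Longrightarrow> measure \<sigma> E = measure surface_measure E"
  unfolding \<sigma>_def using cap_sets by (intro measure_restrict_space) auto

lemma W_nonneg: "x \<in> cap e \<alpha> \<Longrightarrow> 0 \<le> W x"
  using W by (simp add: doubling_weight_def weight_def)

lemma W_integrable: "integrable \<sigma> W"
  unfolding \<sigma>_def integrable_restrict_space[OF cap_sets]
  using W by (simp add: doubling_weight_def weight_def set_integrable_def)

lemma W_measurable: "W \<in> borel_measurable \<sigma>" using W_integrable by simp

lemma AE_W_nonneg: "AE x in \<sigma>. 0 \<le> W x"
  using W_nonneg by (intro AE_I2) (simp add: space_\<sigma>)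

lemma integral_\<nu>:
  fixes g :: "real ^ 'n \<Rightarrow> real"
  assumes "g \<in> borel_measurable \<sigma>"
  shows "(\<integral>x. g x \<partial>\<nu>) = (LINT x:cap e \<alpha>|surface_measure. g x * W x)"
proof -
  have "(\<integral>x. g x \<partial>\<nu>) = (\<integral>x. W x *\<^sub>R g x \<partial>\<sigma>)"
    unfolding \<nu>_def using assms W_measurable AE_W_nonneg by (rule integral_density)
  also have "\<dots> = (\<integral>x. indicator (cap e \<alpha>) x *\<^sub>R (W x *\<^sub>R g x) \<partial>surface_measure)"
    unfolding \<sigma>_def by (rule integral_restrict_space[OF cap_sets])
  finally show ?thesis by (simp add: set_lebesgue_integral_def mult.commute)
qed

lemma integral_\<sigma>:
  fixes g :: "real ^ 'n \<Rightarrow> real"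
  shows "(\<integral>x. g x \<partial>\<sigma>) = (LINT x:cap e \<alpha>|surface_measure. g x)"
  unfolding \<sigma>_def set_lebesgue_integral_def by (rule integral_restrict_space[OF cap_sets])

lemma finite_\<nu>: "finite_measure \<nu>"
proof
  have "emeasure \<nu> (space \<nu>) = (\<integral>\<^sup>+x. ennreal (W x) \<partial>\<sigma>)"
    unfolding \<nu>_def using W_measurable
    by (subst emeasure_density) (auto intro!: nn_integral_cong)
  also have "\<dots> < \<infinity>"
    using W_integrable AE_W_nonneg by (simp add: nn_integral_eq_integral)
  finally show "emeasure \<nu> (space \<nu>) \<noteq> \<infinity>" by simp
qed

sublocale \<nu>: finite_measure \<nu> by (rule finite_\<nu>)
sublocale \<sigma>: finite_measure \<sigma> by (rule finite_\<sigma>)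

lemma measure_\<nu>:
  assumes "E \<in> sets borel" "E \<subseteq> cap e \<alpha>"
  shows "measure \<nu> E = (LINT y:E|surface_measure. W y)"
proof -
  have E: "E \<in> sets \<sigma>" by (rule sets_\<sigma>[OF assms])
  have "measure \<nu> E = (\<integral>x. indicator E x \<partial>\<nu>)"
    using assms(2) by (simp add: space_\<nu> Int_absorb2)
  also have "\<dots> = (LINT x:cap e \<alpha>|surface_measure. indicator E x * W x)"
    using E by (intro integral_\<nu>) simp
  also have "\<dots> = (LINT y:E|surface_measure. W y)"
    unfolding set_lebesgue_integral_def using assms(2)
    by (intro Bochner_Integration.integral_cong) (auto split: split_indicator)
  finally show ?thesis .
qed

lemma rho_ball_props:
  assumes "x \<in> cap e \<alpha>"
  shows "rho_ball e \<alpha> x r \<in> sets borel" "rho_ball e \<alpha> x r \<subseteq> cap e \<alpha>" "rho_ball e \<alpha> x r \<in> sets \<nu>"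
proof -
  show 1: "rho_ball e \<alpha> x r \<in> sets borel" by (rule rho_ball_borel[OF assms])
  show 2: "rho_ball e \<alpha> x r \<subseteq> cap e \<alpha>" by (auto simp: rho_ball_def)
  show "rho_ball e \<alpha> x r \<in> sets \<nu>" unfolding sets_\<nu> by (rule sets_\<sigma>[OF 1 2])
qed

lemma L: "0 < L" using W by (simp add: doubling_weight_def)

lemma doubling_small:
  assumes "x \<in> cap e \<alpha>" "0 < r" "r < 1"
  shows "measure \<nu> (rho_ball e \<alpha> x (2 * r)) \<le> L * measure \<nu> (rho_ball e \<alpha> x r)"
  using W assms unfolding doubling_weight_def
  by (auto simp: measure_\<nu> rho_ball_props)

lemma cap_eq_ball: "cap e \<alpha> = rho_ball e \<alpha> e (3/2)"
  using rho_center_le rho_commute[of e] by (auto simp: rho_ball_def)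

abbreviation "K \<equiv> full_doubling_const L"

lemma K: "1 \<le> K" "L \<le> K" "L ^ 3 \<le> K"
proof -
  show 1: "1 \<le> K" unfolding full_doubling_const_def by (rule one_le_power) simp
  have "max 1 L \<le> max 1 L ^ 3" by (rule self_le_power) auto
  then show "L \<le> K" by (simp add: full_doubling_const_def)
  show "L ^ 3 \<le> K" unfolding full_doubling_const_def using L by (intro power_mono) auto
qed

text \<open>For radii of at least 1 the whole cap, a ball of radius 3/2 about \<open>e\<close>, is
  halved twice about \<open>e\<close>. The ball of radius 3/8 so reached lies in the ball of radius
  15/8 about \<open>x\<close>, and one more halving brings the radius below 1. These three steps
  account for the cube.\<close>

lemma doubling_all:
  assumes x: "x \<in> cap e \<alpha>" and r: "0 < r"
  shows "measure \<nu> (rho_ball e \<alpha> x (2 * r)) \<le> K * measure \<nu> (rho_ball e \<alpha> x r)"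
proof (cases "r < 1")
  case True
  have "L * measure \<nu> (rho_ball e \<alpha> x r) \<le> K * measure \<nu> (rho_ball e \<alpha> x r)"
    using K by (intro mult_right_mono) auto
  then show ?thesis using doubling_small[OF x r True] by simp
next
  case False
  let ?m = "\<lambda>y s. measure \<nu> (rho_ball e \<alpha> y s)"
  have "?m x (2 * r) \<le> measure \<nu> (cap e \<alpha>)"
    using x by (intro \<nu>.finite_measure_mono rho_ball_props) (simp_all add: sets_\<nu> sets_\<sigma>[OF cap_borel])
  also have "\<dots> \<le> L * ?m e (3/4)" using doubling_small[OF e_in_cap, of "3/4"] cap_eq_ball by simp
  also have "\<dots> \<le> L * (L * ?m e (3/8))" using doubling_small[OF e_in_cap, of "3/8"] L by simp
  also have "?m e (3/8) \<le> ?m x (15/8)"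
  proof (intro \<nu>.finite_measure_mono rho_ball_props x subsetI)
    fix y assume "y \<in> rho_ball e \<alpha> e (3/8)"
    then have y: "y \<in> cap e \<alpha>" "\<rho> e y \<le> 3/8" by (auto simp: rho_ball_def)
    then show "y \<in> rho_ball e \<alpha> x (15/8)"
      using rho_triangle[OF x e_in_cap y(1)] rho_center_le[OF x] by (simp add: rho_ball_def)
  qed
  also have "?m x (15/8) \<le> L * ?m x (15/16)" using doubling_small[OF x, of "15/16"] by simp
  also have "?m x (15/16) \<le> ?m x r"
    using False by (intro \<nu>.finite_measure_mono rho_ball_props x) (auto simp: rho_ball_def)
  finally have "?m x (2 * r) \<le> L ^ 3 * ?m x r"
    using L by (simp add: mult_left_mono power3_eq_cube mult.assoc)
  also have "\<dots> \<le> K * ?m x r" using K by (intro mult_right_mono) auto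
  finally show ?thesis .
qed

text \<open>A null ball stays null under doubling of its radius and after finitely many steps is the
  whole cap.\<close>

lemma rho_ball_pos:
  assumes x: "x \<in> cap e \<alpha>" and r: "0 < r" and pos: "0 < measure \<nu> (cap e \<alpha>)"
  shows "0 < measure \<nu> (rho_ball e \<alpha> x r)"
proof (rule ccontr)
  assume "\<not> 0 < measure \<nu> (rho_ball e \<alpha> x r)"
  then have 0: "measure \<nu> (rho_ball e \<alpha> x r) = 0" using measure_nonneg[of \<nu> "rho_ball e \<alpha> x r"] by linarith
  have z: "measure \<nu> (rho_ball e \<alpha> x (2 ^ k * r)) = 0" for k
  proof (induction k)
    case (Suc k)
    have "measure \<nu> (rho_ball e \<alpha> x (2 * (2 ^ k * r))) \<le> K * measure \<nu> (rho_ball e \<alpha> x (2 ^ k * r))"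
      using r by (intro doubling_all x) simp
    also have "\<dots> = 0" using Suc by simp
    finally show ?case by (simp add: mult.assoc measure_le_0_iff)
  qed (simp add: 0)
  obtain k where k: "3 / r < 2 ^ k" using real_arch_pow[of 2] by auto
  have "\<rho> x y \<le> 2 ^ k * r" if y: "y \<in> cap e \<alpha>" for y
  proof -
    have "\<rho> x y \<le> \<rho> x e + \<rho> e y" by (rule rho_triangle[OF x e_in_cap y])
    also have "\<dots> \<le> 3" using rho_center_le[OF x] rho_center_le[OF y] rho_commute[of e y] by simp
    finally show ?thesis using k r by (simp add: pos_divide_less_eq)
  qed
  then have "rho_ball e \<alpha> x (2 ^ k * r) = cap e \<alpha>" by (auto simp: rho_ball_def)
  then show False using z[of k] pos by simp
qed

section \<open>Measurability on the cap\<close>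

lemma rho_measurable: "x \<in> cap e \<alpha> \<Longrightarrow> \<rho> x \<in> borel_measurable \<sigma>"
proof -
  assume x: "x \<in> cap e \<alpha>"
  show ?thesis
  proof (rule borel_measurableI_le)
    fix r
    have "{y \<in> space \<sigma>. \<rho> x y \<le> r} = rho_ball e \<alpha> x r" by (simp add: rho_ball_def space_\<sigma>)
    then show "{y \<in> space \<sigma>. \<rho> x y \<le> r} \<in> sets \<sigma>" using rho_ball_props(3)[OF x] sets_\<nu> by simp
  qed
qed

lemma continuous_measurable_\<sigma>:
  fixes g :: "real ^ 'n \<Rightarrow> 'b :: topological_space"
  assumes "continuous_on UNIV g"
  shows "g \<in> borel_measurable \<sigma>"
proof (rule borel_measurableI)
  fix S :: "'b set" assume "open S"
  then have "open (g -` S)" using assms by (rule open_vimage)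
  then show "g -` S \<inter> space \<sigma> \<in> sets \<sigma>"
    using cap_borel by (intro sets_\<sigma>) (auto simp: space_\<sigma>)
qed

lemma rho_measurable_pair: "(\<lambda>(x, y). \<rho> x y) \<in> borel_measurable (\<sigma> \<Otimes>\<^sub>M \<sigma>)"
proof -
  \<comment> \<open>Clamping the argument to [-1, 1] makes the arc cosine continuous on the line
    without changing it on inner products of unit vectors.\<close>
  define ac where "ac t = arccos (max (-1) (min 1 t))" for t :: real
  have "continuous_on UNIV ac" unfolding ac_def by (intro continuous_intros) auto
  then have [measurable]: "ac \<in> borel_measurable borel" by (rule borel_measurable_continuous_onI)
  have [measurable]: "(\<lambda>x. x) \<in> borel_measurable \<sigma>" by (intro continuous_measurable_\<sigma> continuous_intros)
  have ac: "ac (x \<bullet> y) = arccos (x \<bullet> y)" if "norm x = 1" "norm y = 1" for x y :: "real ^ 'n"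
  proof -
    have "max (-1) (min 1 (x \<bullet> y)) = x \<bullet> y" using abs_inner_le_1[OF that] by auto
    then show ?thesis by (simp add: ac_def)
  qed
  have "(\<lambda>(x, y). 1 / \<alpha> * sqrt ((ac (x \<bullet> y))\<^sup>2 + \<alpha> * (sqrt (\<alpha> - ac (x \<bullet> e)) - sqrt (\<alpha> - ac (y \<bullet> e)))\<^sup>2))
      \<in> borel_measurable (\<sigma> \<Otimes>\<^sub>M \<sigma>)"
    by measurable
  then show ?thesis
  proof (rule measurable_cong[THEN iffD1, rotated])
    fix p assume "p \<in> space (\<sigma> \<Otimes>\<^sub>M \<sigma>)"
    then show "(case p of (x, y) \<Rightarrow> 1 / \<alpha> * sqrt ((ac (x \<bullet> y))\<^sup>2 + \<alpha> * (sqrt (\<alpha> - ac (x \<bullet> e)) - sqrt (\<alpha> - ac (y \<bullet> e)))\<^sup>2))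
      = (case p of (x, y) \<Rightarrow> \<rho> x y)"
      using cap_D(1) e by (auto simp: space_pair_measure space_\<sigma> ac rho_def geodesic_dist_def)
  qed
qed

text \<open>Balls are sections of a measurable set in the product, so their measures depend
  measurably on the centre. This makes the averaged weight measurable.\<close>

lemma measure_rho_ball_measurable:
  assumes "finite_measure M" "sets M = sets \<sigma>"
  shows "(\<lambda>x. measure M (rho_ball e \<alpha> x r)) \<in> borel_measurable \<sigma>"
proof -
  interpret M: finite_measure M by fact
  let ?Q = "{p \<in> space (\<sigma> \<Otimes>\<^sub>M \<sigma>). (\<lambda>(x, y). \<rho> x y) p \<le> r}"
  have "?Q \<in> sets (\<sigma> \<Otimes>\<^sub>M \<sigma>)" using rho_measurable_pair by measurable
  then have Q: "?Q \<in> sets (\<sigma> \<Otimes>\<^sub>M M)" by (simp cong: sets_pair_measure_cong add: assms(2))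
  have "(\<lambda>x. emeasure M (Pair x -` ?Q)) \<in> borel_measurable \<sigma>"
    by (rule M.measurable_emeasure_Pair[OF Q])
  then have "(\<lambda>x. measure M (Pair x -` ?Q)) \<in> borel_measurable \<sigma>"
    unfolding measure_def by measurable
  moreover have "Pair x -` ?Q = rho_ball e \<alpha> x r" if "x \<in> space \<sigma>" for x
    using that by (auto simp: space_pair_measure space_\<sigma> rho_ball_def)
  ultimately show ?thesis by (simp cong: measurable_cong)
qed

lemma sphere_polys_measurable:
  assumes "f \<in> sphere_polys n"
  shows "f \<in> borel_measurable \<sigma>"
proof -
  obtain g where g: "spoly n g" "\<And>x. x \<in> sphere 0 1 \<Longrightarrow> f x = g x"
    using sphere_polys_spoly[OF assms] by blast
  have "g \<in> borel_measurable \<sigma>" by (intro continuous_measurable_\<sigma> spoly_continuous[OF g(1)])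
  moreover have "f x = g x" if "x \<in> space \<sigma>" for x using g(2) that cap_subset by (auto simp: space_\<sigma>)
  ultimately show ?thesis by (simp cong: measurable_cong)
qed

lemma doubling_osc_cap:
  assumes pos: "0 < measure \<nu> (cap e \<alpha>)" and f: "f \<in> sphere_polys n" and n: "n \<ge> 1" and p: "1 \<le> p"
    and N: "2 * K \<le> 2 ^ N"
    and \<delta>1: "0 < \<delta>1" "4 * osc_const N * \<delta>1 \<le> 1" "\<delta>1 \<le> 1/2" "1 \<le> 2 ^ j * \<delta>1"
  shows "doubling_osc \<nu> (\<rho>) K (\<lambda>x. \<bar>f x\<bar>) (real n) p (osc_const N) \<delta>1 N j"
proof -
  obtain g where g: "spoly n g" "\<And>x. x \<in> sphere 0 1 \<Longrightarrow> f x = g x"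
    using sphere_polys_spoly[OF f] by blast
  have fg: "f x = g x" if "x \<in> cap e \<alpha>" for x using g(2) that cap_subset by auto
  have ball: "{y \<in> space \<nu>. \<rho> x y \<le> r} = rho_ball e \<alpha> x r" for x r
    by (simp add: rho_ball_def space_\<nu>)
  show ?thesis
  proof
    show "1 \<le> K" by (rule K)
    show "\<rho> x \<in> borel_measurable \<nu>" if "x \<in> space \<nu>" for x
    proof -
      have "\<rho> x \<in> borel_measurable \<sigma>" using that by (intro rho_measurable) (simp add: space_\<nu>)
      then show ?thesis unfolding \<nu>_def by simp
    qed
    show "0 \<le> \<rho> x y" for x y by (rule rho_nonneg)
    show "\<rho> x x = 0" if "x \<in> space \<nu>" for x using that by (simp add: space_\<nu> rho_refl)
    show "\<rho> x y = \<rho> y x" for x y by (rule rho_commute)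
    show "\<rho> x z \<le> \<rho> x y + \<rho> y z"
      if "x \<in> space \<nu>" "y \<in> space \<nu>" "z \<in> space \<nu>" for x y z
      using that unfolding space_\<nu> by (rule rho_triangle)
    show "\<rho> x y \<le> 4" if "x \<in> space \<nu>" "y \<in> space \<nu>" for x y
      using that rho_triangle[of x e y] rho_center_le[of x] rho_center_le[of y] rho_commute[of e y] e_in_cap
      by (simp add: space_\<nu>)
    show "measure \<nu> {y \<in> space \<nu>. \<rho> x y \<le> 2 * r} \<le> K * measure \<nu> {y \<in> space \<nu>. \<rho> x y \<le> r}"
      if "x \<in> space \<nu>" "0 < r" for x r
      using that unfolding ball unfolding space_\<nu> by (rule doubling_all)
    show "0 < measure \<nu> {y \<in> space \<nu>. \<rho> x y \<le> r}" if "x \<in> space \<nu>" "0 < r" for x r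
      using that pos unfolding ball unfolding space_\<nu> by (rule rho_ball_pos)
    show "(\<lambda>x. \<bar>f x\<bar>) \<in> borel_measurable \<nu>"
      using sphere_polys_measurable[OF f] unfolding \<nu>_def by simp
    \<comment> \<open>Boundedness is taken from \<open>g\<close>, which is continuous and agrees
      with \<open>f\<close> on the cap, since \<open>f\<close> is arbitrary off the sphere.\<close>
    have "compact (cap e \<alpha>)"
      using closed_cap cap_subset compact_sphere[of 0 1] by (metis compact_Int_closed inf.absorb_iff2)
    then have "compact ((\<lambda>x. \<bar>g x\<bar>) ` cap e \<alpha>)"
      by (intro compact_continuous_image continuous_intros spoly_continuous[OF g(1)])
    then have "bounded ((\<lambda>x. \<bar>g x\<bar>) ` cap e \<alpha>)" by (rule compact_imp_bounded)
    then obtain b where "\<forall>x\<in>cap e \<alpha>. \<bar>g x\<bar> \<le> b" by (auto simp: bounded_iff)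
    then show "\<exists>b. \<forall>x\<in>space \<nu>. \<bar>f x\<bar> \<le> b" using fg by (auto simp: space_\<nu>)
    show "\<bar>\<bar>f x\<bar> - \<bar>f y\<bar>\<bar> \<le> osc_const N * (real n * \<rho> x y) * S"
      if "x \<in> space \<nu>" "y \<in> space \<nu>" "real n * \<rho> x y \<le> 1"
        "\<And>z. z \<in> space \<nu> \<Longrightarrow> \<bar>f z\<bar> \<le> S * (1 + real n * \<rho> x z) ^ N" for x y S
    proof -
      have xy: "x \<in> cap e \<alpha>" "y \<in> cap e \<alpha>" using that by (auto simp: space_\<nu>)
      have "\<bar>g x - g y\<bar> \<le> osc_const N * (real n * \<rho> x y) * S"
        unfolding osc_const_def
        by (intro spoly_rho_lipschitz g(1) n xy that(3)) (use that(4) fg in \<open>simp add: space_\<nu>\<close>)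
      then show ?thesis using fg xy by simp
    qed
  qed (use n p N \<delta>1 osc_const_ge_1[of N] in auto)
qed

context
  fixes f :: "real ^ 'n \<Rightarrow> real" and n :: nat and p \<delta>1 :: real and N j :: nat
  assumes pos: "0 < measure \<nu> (cap e \<alpha>)" and f: "f \<in> sphere_polys n" and n: "n \<ge> 1" and p: "1 \<le> p"
    and N: "2 * K \<le> 2 ^ N"
    and \<delta>1: "0 < \<delta>1" "4 * osc_const N * \<delta>1 \<le> 1" "\<delta>1 \<le> 1/2" "1 \<le> 2 ^ j * \<delta>1"
begin

interpretation X: doubling_osc \<nu> "rho e \<alpha>" K "\<lambda>x. \<bar>f x\<bar>" "real n" p "osc_const N" \<delta>1 N j
  by (rule doubling_osc_cap[OF pos f n p N \<delta>1])

lemma B_eq: "X.B x r = rho_ball e \<alpha> x r"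
  by (simp add: X.B_def rho_ball_def space_\<nu>)

lemma Fp_measurable: "(\<lambda>x. \<bar>f x\<bar> powr p) \<in> borel_measurable \<sigma>"
  using sphere_polys_measurable[OF f] by measurable

lemma integral_Fp: "(\<integral>x. \<bar>f x\<bar> powr p \<partial>\<nu>) = (LINT x:cap e \<alpha>|surface_measure. \<bar>f x\<bar> powr p * W x)"
  by (rule integral_\<nu>[OF Fp_measurable])

lemma sums_eq:
  assumes "A \<subseteq> cap e \<alpha>"
  shows "X.sup_sum A r = (\<Sum>\<omega>\<in>A. (SUP x\<in>rho_ball e \<alpha> \<omega> r. \<bar>f x\<bar> powr p) * (LINT y:rho_ball e \<alpha> \<omega> r|surface_measure. W y))"
    "X.inf_sum A r = (\<Sum>\<omega>\<in>A. (INF x\<in>rho_ball e \<alpha> \<omega> r. \<bar>f x\<bar> powr p) * (LINT y:rho_ball e \<alpha> \<omega> r|surface_measure. W y))"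
  unfolding X.sup_sum_def X.inf_sum_def B_eq using assms
  by (auto intro!: sum.cong simp: measure_\<nu> rho_ball_props)

lemma CA_ge_1: "1 \<le> X.CA" using K p by (intro sup_const_ge_1)

lemma marcinkiewicz_zygmund:
  assumes \<delta>: "0 < \<delta>" "\<delta> \<le> 1/2" "2 * osc_const N * 3 ^ N * \<delta> \<le> 1" "\<delta> \<le> mesh_const K p (osc_const N) N j"
    and \<Lambda>: "maximal_separable e \<alpha> (\<delta> / real n) \<Lambda>"
  shows "equiv_const (max X.CA (2 * 2 powr p))
      (LINT x:cap e \<alpha>|surface_measure. \<bar>f x\<bar> powr p * W x)
      (\<Sum>\<omega>\<in>\<Lambda>. (SUP x\<in>rho_ball e \<alpha> \<omega> (\<delta> / real n). \<bar>f x\<bar> powr p) *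
        (LINT y:rho_ball e \<alpha> \<omega> (\<delta> / real n)|surface_measure. W y)) \<and>
    equiv_const (max X.CA (2 * 2 powr p))
      (\<Sum>\<omega>\<in>\<Lambda>. (SUP x\<in>rho_ball e \<alpha> \<omega> (\<delta> / real n). \<bar>f x\<bar> powr p) *
        (LINT y:rho_ball e \<alpha> \<omega> (\<delta> / real n)|surface_measure. W y))
      (\<Sum>\<omega>\<in>\<Lambda>. (INF x\<in>rho_ball e \<alpha> \<omega> (\<delta> / real n). \<bar>f x\<bar> powr p) *
        (LINT y:rho_ball e \<alpha> \<omega> (\<delta> / real n)|surface_measure. W y))"
proof -
  let ?I = "\<integral>x. \<bar>f x\<bar> powr p \<partial>\<nu>" and ?S = "X.sup_sum \<Lambda> (\<delta> / n)" and ?T = "X.inf_sum \<Lambda> (\<delta> / n)"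
  let ?C = "max X.CA (2 * 2 powr p)"
  have sub: "\<Lambda> \<subseteq> cap e \<alpha>" and fin: "finite \<Lambda>" using \<Lambda> by (auto simp: maximal_separable_def separable_def)
  have net: "X.net (\<delta> / n) \<Lambda>"
    using \<Lambda> by (auto simp: maximal_separable_def separable_def X.net_def space_\<nu>)
  have cover: "space \<nu> = (\<Union>w\<in>\<Lambda>. X.B w (\<delta> / n))"
    using \<Lambda> unfolding B_eq space_\<nu> by (simp add: maximal_separable_def)
  have C: "1 \<le> ?C" "X.CA \<le> ?C" "2 * 2 powr p \<le> ?C" using CA_ge_1 by auto
  have IS: "?I \<le> ?S" using sub by (intro X.integral_le_sup_sum fin cover) (simp add: space_\<nu>)
  have SI: "?S \<le> X.CA * ?I" using \<delta> by (intro X.sup_sum_le net) auto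
  have TS: "?T \<le> ?S" using sub \<delta> by (intro X.inf_sum_le_sup_sum) (auto simp: space_\<nu>)
  have ST: "?S \<le> 2 * 2 powr p * ?T" by (intro X.sup_sum_le_inf_sum net cover \<delta>)
  have I0: "0 \<le> ?I" by simp
  then have S0: "0 \<le> ?S" using IS by (rule order.trans)
  then have "0 \<le> 2 * 2 powr p * ?T" using ST by simp
  then have T0: "0 \<le> ?T" by (simp add: zero_le_mult_iff)
  have "equiv_const ?C ?I ?S"
  proof (rule equiv_constI)
    show "?I \<le> ?C * ?S" using IS mult_right_mono[OF C(1) S0] by simp
    show "?S \<le> ?C * ?I" using SI mult_right_mono[OF C(2) I0] by linarith
  qed (use C in simp)
  moreover have "equiv_const ?C ?S ?T"
  proof (rule equiv_constI)
    show "?S \<le> ?C * ?T" using ST mult_right_mono[OF C(3) T0] by linarith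
    show "?T \<le> ?C * ?S" using TS mult_right_mono[OF C(1) S0] by simp
  qed (use C in simp)
  ultimately show ?thesis unfolding integral_Fp sums_eq[OF sub] by blast
qed

lemma averaged_weight_equiv:
  assumes l: "0 < l" "l \<le> 1/2" "1408 * sqrt (2 * l) \<le> \<delta>1"
  shows "equiv_const (max (K ^ (j + 1) * X.CA) (X.CV * (1 / l ^ CARD('n)) * K ^ 4))
     (LINT x:cap e \<alpha>|surface_measure. \<bar>f x\<bar> powr p * W x)
     (LINT x:cap e \<alpha>|surface_measure. \<bar>f x\<bar> powr p * averaged_weight e \<alpha> W n x)"
proof -
  let ?D = "1 / l ^ CARD('n)"
  \<comment> \<open>\<open>\<nu>\<close> has a density with respect to \<open>\<sigma>\<close>, so a
    null ball for \<open>\<sigma>\<close> would be null for \<open>\<nu>\<close>.\<close>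
  have S_pos: "0 < measure \<sigma> (X.B x r)" if "x \<in> space \<nu>" "0 < r" for x r
  proof (rule ccontr)
    assume "\<not> 0 < measure \<sigma> (X.B x r)"
    then have "measure \<sigma> (X.B x r) = 0" using measure_nonneg[of \<sigma> "X.B x r"] by linarith
    then have "emeasure \<sigma> (X.B x r) = 0" by (simp add: \<sigma>.emeasure_eq_measure)
    then have "X.B x r \<in> null_sets \<sigma>" using X.B_sets[OF that(1), of r] sets_\<nu> by auto
    then have "X.B x r \<in> null_sets \<nu>"
      unfolding \<nu>_def using W_measurable
      by (subst null_sets_density_iff) (auto dest: AE_not_in simp: null_setsD2)
    then have "measure \<nu> (X.B x r) = 0" by (simp add: measure_eq_0_null_sets)
    then show False using rho_ball_pos[OF _ that(2) pos, of x] that(1) by (simp add: B_eq space_\<nu>)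
  qed
  have S_doubling: "measure \<sigma> (X.B x (2 / n)) \<le> ?D * measure \<sigma> (X.B x (\<delta>1 / n))" if "x \<in> space \<nu>" for x
  proof -
    have x: "x \<in> cap e \<alpha>" using that by (simp add: space_\<nu>)
    have "704 * sqrt (2 * l) * (2 / n) = 1408 * sqrt (2 * l) / n" by simp
    also have "\<dots> \<le> \<delta>1 / n" using l(3) by (intro divide_right_mono) auto
    finally have "l ^ CARD('n) * measure \<sigma> (X.B x (2 / n)) \<le> measure \<sigma> (X.B x (\<delta>1 / n))"
      unfolding B_eq measure_\<sigma>[OF rho_ball_props(2)[OF x]] by (intro surface_doubling x l)
    then show ?thesis using l by (simp add: field_simps)
  qed
  have D: "0 < ?D" using l by simp
  have meas: "(\<lambda>x. measure \<nu> (X.B x (1 / n)) / measure \<sigma> (X.B x (1 / n))) \<in> borel_measurable \<sigma>"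
    unfolding B_eq by (intro borel_measurable_divide measure_rho_ball_measurable finite_\<nu> finite_\<sigma> sets_\<nu> refl)
  note prems = finite_\<sigma> sets_\<nu>[symmetric] S_pos S_doubling D meas
  let ?I = "\<integral>x. \<bar>f x\<bar> powr p \<partial>\<nu>" and ?J = "\<integral>x. \<bar>f x\<bar> powr p * X.avg \<sigma> x \<partial>\<sigma>"
  have 1: "?J \<le> K ^ (j + 1) * X.CA * ?I"
    by (rule X.avg_integral_le[OF prems])
  have 2: "?I \<le> X.CV * ?D * K ^ 4 * ?J"
    by (rule X.integral_le_avg[OF prems])
  have J: "?J = (LINT x:cap e \<alpha>|surface_measure. \<bar>f x\<bar> powr p * averaged_weight e \<alpha> W n x)"
  proof -
    have "?J = (LINT x:cap e \<alpha>|surface_measure. \<bar>f x\<bar> powr p * X.avg \<sigma> x)" by (rule integral_\<sigma>)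
    also have "\<dots> = (LINT x:cap e \<alpha>|surface_measure. \<bar>f x\<bar> powr p * averaged_weight e \<alpha> W n x)"
      unfolding set_lebesgue_integral_def
    proof (intro Bochner_Integration.integral_cong refl)
      fix x
      have "X.avg \<sigma> x = averaged_weight e \<alpha> W n x" if "x \<in> cap e \<alpha>"
        using that rho_ball_props[OF that]
        by (simp add: X.avg_def[OF prems] averaged_weight_def B_eq measure_\<nu> measure_\<sigma>)
      then show "indicat_real (cap e \<alpha>) x *\<^sub>R (\<bar>f x\<bar> powr p * X.avg \<sigma> x) =
          indicat_real (cap e \<alpha>) x *\<^sub>R (\<bar>f x\<bar> powr p * averaged_weight e \<alpha> W n x)"
        by (simp split: split_indicator)
    qed
    finally show ?thesis .
  qed
  have I0: "0 \<le> ?I" by simp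
  have J0: "0 \<le> ?J"
    by (intro Bochner_Integration.integral_nonneg mult_nonneg_nonneg)
      (auto simp: X.avg_def[OF prems])
  let ?C = "max (K ^ (j + 1) * X.CA) (X.CV * ?D * K ^ 4)"
  have C: "K ^ (j + 1) * X.CA \<le> ?C" "X.CV * ?D * K ^ 4 \<le> ?C" by auto
  have "0 < K ^ (j + 1) * X.CA" using K(1) CA_ge_1 by simp
  then have C0: "0 < ?C" by simp
  have "equiv_const ?C ?I ?J"
    using 1 2 C0 mult_right_mono[OF C(1) I0] mult_right_mono[OF C(2) J0] by (intro equiv_constI) linarith+
  then show ?thesis unfolding integral_Fp J .
qed

end

text \<open>If the weight has no mass, balls are not positive and the general theory does not apply;
  but then every quantity to be compared vanishes.\<close>

lemma null_weight:
  assumes "measure \<nu> (cap e \<alpha>) = 0"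
  shows "x \<in> cap e \<alpha> \<Longrightarrow> (LINT y:rho_ball e \<alpha> x r|surface_measure. W y) = 0"
    "f \<in> sphere_polys n \<Longrightarrow> (LINT x:cap e \<alpha>|surface_measure. \<bar>f x\<bar> powr p * W x) = 0"
    "(LINT x:cap e \<alpha>|surface_measure. \<bar>f x\<bar> powr p * averaged_weight e \<alpha> W n x) = 0"
proof -
  show ball: "(LINT y:rho_ball e \<alpha> x r|surface_measure. W y) = 0" if x: "x \<in> cap e \<alpha>" for x r
  proof -
    have "measure \<nu> (rho_ball e \<alpha> x r) \<le> measure \<nu> (cap e \<alpha>)"
      using x by (intro \<nu>.finite_measure_mono rho_ball_props) (simp_all add: sets_\<nu> sets_\<sigma>[OF cap_borel])
    then have "measure \<nu> (rho_ball e \<alpha> x r) = 0" using assms by (simp add: measure_le_0_iff)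
    then show ?thesis using measure_\<nu>[OF rho_ball_props(1,2)[OF x]] by simp
  qed
  show "(LINT x:cap e \<alpha>|surface_measure. \<bar>f x\<bar> powr p * W x) = 0" if f: "f \<in> sphere_polys n"
  proof -
    have "emeasure \<nu> (space \<nu>) = 0" using assms by (simp add: \<nu>.emeasure_eq_measure space_\<nu>)
    then have "space \<nu> \<in> null_sets \<nu>" by auto
    then have "AE x in \<nu>. \<bar>f x\<bar> powr p = 0" by (rule AE_I') auto
    then have "(\<integral>x. \<bar>f x\<bar> powr p \<partial>\<nu>) = 0" by (rule integral_eq_zero_AE)
    moreover have "(\<lambda>x. \<bar>f x\<bar> powr p) \<in> borel_measurable \<sigma>"
      using sphere_polys_measurable[OF f] by measurable
    ultimately show ?thesis using integral_\<nu> by simp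
  qed
  have "(\<lambda>x. indicat_real (cap e \<alpha>) x *\<^sub>R (\<bar>f x\<bar> powr p * averaged_weight e \<alpha> W n x)) = (\<lambda>_. 0)"
    by (rule ext) (use ball in \<open>simp add: averaged_weight_def split: split_indicator\<close>)
  then show "(LINT x:cap e \<alpha>|surface_measure. \<bar>f x\<bar> powr p * averaged_weight e \<alpha> W n x) = 0"
    unfolding set_lebesgue_integral_def by simp
qed

end

theorem theorem5p1:
  fixes d :: nat and p L :: real
  assumes "d \<ge> 1" and "CARD('n :: finite) = d + 1" and "1 \<le> p" and "L > 0"
  shows
    "(\<exists>C>0. \<forall>(e :: real ^ 'n) \<alpha> W n f.
        e \<in> sphere 0 1 \<and> \<alpha> \<in> {0<..1/2} \<and> doubling_weight e \<alpha> L W \<and> n \<ge> 1 \<and> f \<in> sphere_polys n \<longrightarrow>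
        equiv_const C
          (LINT x:cap e \<alpha>|surface_measure. \<bar>f x\<bar> powr p * W x)
          (LINT x:cap e \<alpha>|surface_measure. \<bar>f x\<bar> powr p * averaged_weight e \<alpha> W n x)) \<and>
     (\<exists>\<delta>\<^sub>0>0. \<exists>C>0. \<forall>(e :: real ^ 'n) \<alpha> W n \<delta> \<Lambda> f.
        e \<in> sphere 0 1 \<and> \<alpha> \<in> {0<..1/2} \<and> doubling_weight e \<alpha> L W \<and> n \<ge> 1 \<and>
        \<delta> \<in> {0<..<\<delta>\<^sub>0} \<and> maximal_separable e \<alpha> (\<delta> / real n) \<Lambda> \<and> f \<in> sphere_polys n \<longrightarrow>
        equiv_const C
          (LINT x:cap e \<alpha>|surface_measure. \<bar>f x\<bar> powr p * W x)
          (\<Sum>\<omega>\<in>\<Lambda>. (SUP x\<in>rho_ball e \<alpha> \<omega> (\<delta> / real n). \<bar>f x\<bar> powr p) *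
                  (LINT y:rho_ball e \<alpha> \<omega> (\<delta> / real n)|surface_measure. W y)) \<and>
        equiv_const C
          (\<Sum>\<omega>\<in>\<Lambda>. (SUP x\<in>rho_ball e \<alpha> \<omega> (\<delta> / real n). \<bar>f x\<bar> powr p) *
                  (LINT y:rho_ball e \<alpha> \<omega> (\<delta> / real n)|surface_measure. W y))
          (\<Sum>\<omega>\<in>\<Lambda>. (INF x\<in>rho_ball e \<alpha> \<omega> (\<delta> / real n). \<bar>f x\<bar> powr p) *
                  (LINT y:rho_ball e \<alpha> \<omega> (\<delta> / real n)|surface_measure. W y)))"
proof -
  \<comment> \<open>All constants are fixed here from the dimension, \<open>p\<close> and
    \<open>L\<close>, before cap, weight, degree and polynomial are introduced.\<close>
  define K where "K = full_doubling_const L"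
  have K: "1 \<le> K" unfolding K_def full_doubling_const_def by (rule one_le_power) simp
  obtain N where "2 * K < 2 ^ N" using real_arch_pow[of 2] by auto
  then have N: "2 * K \<le> 2 ^ N" by simp
  define c where "c = osc_const N"
  have c: "1 \<le> c" unfolding c_def by (rule osc_const_ge_1)
  define \<delta>1 where "\<delta>1 = 1 / (4 * c)"
  have \<delta>1: "0 < \<delta>1" "4 * c * \<delta>1 \<le> 1" "\<delta>1 \<le> 1/2" using c by (auto simp: \<delta>1_def field_simps)
  obtain j where "1 / \<delta>1 < 2 ^ j" using real_arch_pow[of 2] by auto
  then have j: "1 \<le> 2 ^ j * \<delta>1" using \<delta>1(1) by (simp add: pos_divide_less_eq)
  \<comment> \<open>So \<open>sqrt (2 * l)\<close> is \<open>\<delta>1 / 1408\<close>: with 1408 = 2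
    * 704 the contraction takes the radius \<open>2 / n\<close> to
    \<open>\<delta>1 / n\<close>.\<close>
  define l where "l = (\<delta>1 / 1408)\<^sup>2 / 2"
  have l: "0 < l" "l \<le> 1/2" "1408 * sqrt (2 * l) \<le> \<delta>1"
    using \<delta>1 by (auto simp: l_def power_le_one)
  have cap: "weighted_cap e \<alpha> W L"
    if "e \<in> sphere 0 1 \<and> \<alpha> \<in> {0<..1/2} \<and> doubling_weight e \<alpha> L W" for e :: "real ^ 'n" and \<alpha> W
    using that by unfold_locales auto
  define C1 where "C1 = max (K ^ (j + 1) * sup_const K p N j)
    (cell_const K p N j * (1 / l ^ CARD('n)) * K ^ 4)"
  have "0 < K ^ (j + 1) * sup_const K p N j"
    using K sup_const_ge_1[OF K \<open>1 \<le> p\<close>, of N j] by simp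
  then have C1: "0 < C1" by (simp add: C1_def)
  define C2 where "C2 = max (sup_const K p N j) (2 * 2 powr p)"
  have C2: "0 < C2" by (simp add: C2_def less_max_iff_disj)
  \<comment> \<open>The three bounds keep the balls small at scale \<open>1 / n\<close>, make the
    oscillation factor at most 1 so that its power \<open>p\<close> does not exceed it, and allow
    the error term to be absorbed.\<close>
  define \<delta>\<^sub>0 where "\<delta>\<^sub>0 = min (1/2) (min (1 / (2 * c * 3 ^ N)) (mesh_const K p c N j))"
  have \<delta>\<^sub>0: "0 < \<delta>\<^sub>0" using c mesh_const_pos[OF K \<open>1 \<le> p\<close>, of c N j] by (simp add: \<delta>\<^sub>0_def)
  show ?thesis
  proof (rule conjI, rule exI[of _ C1], goal_cases first second)
    case first
    show ?case
    proof (intro conjI C1 allI impI, goal_cases)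
      case (1 e \<alpha> W n f)
      then interpret weighted_cap e \<alpha> W L by (intro cap) simp
      have f: "f \<in> sphere_polys n" and n: "n \<ge> 1" using 1 by blast+
      show ?case
      proof (cases "measure \<nu> (cap e \<alpha>) = 0")
        case True
        from null_weight(2)[OF True f] null_weight(3)[OF True] show ?thesis
          by (simp only: equiv_const_def) simp
      next
        case False
        then have "0 < measure \<nu> (cap e \<alpha>)" by (simp add: less_le)
        then show ?thesis
          unfolding C1_def K_def using f n \<open>1 \<le> p\<close> N \<delta>1 j l unfolding K_def c_def
          by (intro averaged_weight_equiv) auto
      qed
    qed
  next
    case second
    show ?case
    proof (rule exI[of _ \<delta>\<^sub>0], rule conjI[OF \<delta>\<^sub>0], rule exI[of _ C2], rule conjI[OF C2],
        intro allI impI, goal_cases)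
      case (1 e \<alpha> W n \<delta> \<Lambda> f)
      then interpret weighted_cap e \<alpha> W L by (intro cap) simp
      have f: "f \<in> sphere_polys n" and n: "n \<ge> 1"
        and \<Lambda>: "maximal_separable e \<alpha> (\<delta> / real n) \<Lambda>" using 1 by blast+
      have \<delta>: "0 < \<delta>" "\<delta> \<le> 1/2" "2 * c * 3 ^ N * \<delta> \<le> 1" "\<delta> \<le> mesh_const K p c N j"
        using 1 c by (auto simp: \<delta>\<^sub>0_def pos_less_divide_eq mult_ac)
      show ?case
      proof (cases "measure \<nu> (cap e \<alpha>) = 0")
        case True
        have "(LINT y:rho_ball e \<alpha> \<omega> (\<delta> / real n)|surface_measure. W y) = 0" if "\<omega> \<in> \<Lambda>" for \<omega>
          using null_weight(1)[OF True] \<Lambda> that unfolding maximal_separable_def separable_def by blast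
        with null_weight(2)[OF True f] show ?thesis
          by (simp only: equiv_const_def mult_zero_right sum.neutral_const cong: sum.cong) simp
      next
        case False
        then have pos: "0 < measure \<nu> (cap e \<alpha>)" by (simp add: less_le)
        show ?thesis unfolding C2_def K_def
          by (rule marcinkiewicz_zygmund[OF pos f n \<open>1 \<le> p\<close> N[unfolded K_def] \<delta>1(1) \<delta>1(2)[unfolded c_def]
            \<delta>1(3) j \<delta>(1,2) \<delta>(3)[unfolded c_def] \<delta>(4)[unfolded K_def c_def] \<Lambda>])
      qed
    qed
  qed
qed

end
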